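(* Let $G$ be an infinite compact abelian group with dual group $\Gamma$, and let $\Lambda\subset\Gamma$ be such that $\Gamma\setminus(-\Lambda)$ is a semi-Riesz set. Let $T\in L(C_\Lambda)$ and suppose that $T$ is weakly compact, or that $T$ factors through a closed subspace of $c_0$, or (more generally than weak compactness) that for every $h\in G$ the function $g\mapsto \pi_h(T^*p_g)$ is continuous on $G$. Then $\|\mathrm{Id}+T\|=1+\|T\|$.
   Context: $C_\Lambda=\{f\in C(G):\hat f(\gamma)=0 \text{ for all }\gamma\notin\Lambda\}$ with the sup norm, where $\hat f$ is the Fourier transform. For $\Lambda'\subset\Gamma$, $M_{\Lambda'}$ is the space of measures $\mu\in M(G)$ with $\hat\mu(\gamma)=0$ for $\gamma\notin\Lambda'$; $M_{\rm diff}$ is the space of diffuse measures (those vanishing on singletons). $\Lambda'$ is semi-Riesz if $M_{\Lambda'}\subset M_{\rm diff}$. For $g\in G$, $p_g\in C_\Lambda^*$ is the point evaluation $f\mapsto f(g)$; $\operatorname{lin}\{p_g\}$ is an $L$-summand of $C_\Lambda^*$, i.e. there is a projection $\Pi_g$ of $C_\Lambda^*$ onto it with $\|x^*\|=\|\Pi_gx^*\|+\|x^*-\Pi_gx^*\|$, and $\pi_g\in C_\Lambda^{**}$ is defined by $\Pi_g(x^* )=\pi_g(x^* )p_g$. $T$ factors through a subspace of $c_0$ if $T=T_2T_1$ with bounded $T_1\colon C_\Lambda\to E$, $T_2\colon E\to C_\Lambda$, $E\subset c_0$ closed. *)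

theory Defs
  imports "HOL-Analysis.Analysis"
begin

definition dual_group :: "('g::topological_ab_group_add \<Rightarrow> complex) set" where
  "dual_group = {\<gamma>. continuous_on UNIV \<gamma> \<and> (\<forall>x y. \<gamma> (x + y) = \<gamma> x * \<gamma> y)
                    \<and> (\<forall>x. norm (\<gamma> x) = 1)}"

text \<open>Group inverse in the dual group: \<open>-\<gamma> = conj \<gamma>\<close>; \<open>-\<Lambda>\<close>.\<close>
definition neg_set :: "('g \<Rightarrow> complex) set \<Rightarrow> ('g \<Rightarrow> complex) set" where
  "neg_set L = (\<lambda>\<gamma> x. cnj (\<gamma> x)) ` L"

definition radon :: "'g::topological_space measure \<Rightarrow> bool" where
  "radon M \<longleftrightarrow> sets M = sets borel \<and> finite_measure M \<and>
     (\<forall>A\<in>sets borel. emeasure M A = (INF U\<in>{U. open U \<and> A \<subseteq> U}. emeasure M U)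
                   \<and> emeasure M A = (SUP K\<in>{K. compact K \<and> K \<subseteq> A}. emeasure M K))"

definition haar :: "'g::topological_ab_group_add measure \<Rightarrow> bool" where
  "haar m \<longleftrightarrow> radon m \<and> emeasure m (space m) = 1 \<and>
     (\<forall>x. \<forall>A\<in>sets borel. emeasure m ((\<lambda>y. x + y) ` A) = emeasure m A)"

definition fourier :: "'g measure \<Rightarrow> ('g \<Rightarrow> complex) \<Rightarrow> ('g \<Rightarrow> complex) \<Rightarrow> complex" where
  "fourier m f \<gamma> = (\<integral>x. f x * cnj (\<gamma> x) \<partial>m)"

text \<open>A complex measure is represented as \<open>m1 - m2 + i (m3 - m4)\<close> with finite
  positive Radon measures \<open>mi\<close>.\<close>
type_synonym 'g cmeasure = "'g measure \<times> 'g measure \<times> 'g measure \<times> 'g measure"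

definition is_cmeasure :: "'g::topological_space cmeasure \<Rightarrow> bool" where
  "is_cmeasure \<mu> = (case \<mu> of (m1, m2, m3, m4) \<Rightarrow> radon m1 \<and> radon m2 \<and> radon m3 \<and> radon m4)"

definition cm_val :: "'g cmeasure \<Rightarrow> 'g set \<Rightarrow> complex" where
  "cm_val \<mu> A = (case \<mu> of (m1, m2, m3, m4) \<Rightarrow>
     complex_of_real (measure m1 A - measure m2 A) + \<i> * complex_of_real (measure m3 A - measure m4 A))"

definition cm_int :: "'g cmeasure \<Rightarrow> ('g \<Rightarrow> complex) \<Rightarrow> complex" where
  "cm_int \<mu> f = (case \<mu> of (m1, m2, m3, m4) \<Rightarrow>
     (\<integral>x. f x \<partial>m1) - (\<integral>x. f x \<partial>m2) + \<i> * ((\<integral>x. f x \<partial>m3) - (\<integral>x. f x \<partial>m4)))"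

definition fs_transform :: "'g cmeasure \<Rightarrow> ('g \<Rightarrow> complex) \<Rightarrow> complex" where
  "fs_transform \<mu> \<gamma> = cm_int \<mu> (\<lambda>x. cnj (\<gamma> x))"

definition M_spec :: "('g::topological_ab_group_add \<Rightarrow> complex) set \<Rightarrow> 'g cmeasure set" where
  "M_spec L' = {\<mu>. is_cmeasure \<mu> \<and> (\<forall>\<gamma>\<in>dual_group - L'. fs_transform \<mu> \<gamma> = 0)}"

definition M_diff :: "'g::topological_space cmeasure set" where
  "M_diff = {\<mu>. is_cmeasure \<mu> \<and> (\<forall>x. cm_val \<mu> {x} = 0)}"

definition semi_riesz :: "('g::topological_ab_group_add \<Rightarrow> complex) set \<Rightarrow> bool" where
  "semi_riesz L' \<longleftrightarrow> M_spec L' \<subseteq> M_diff"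

definition supn :: "('x \<Rightarrow> complex) \<Rightarrow> real" where
  "supn f = Sup (range (\<lambda>x. norm (f x)))"

definition C_Lambda :: "'g measure \<Rightarrow> ('g::topological_ab_group_add \<Rightarrow> complex) set
    \<Rightarrow> ('g \<Rightarrow> complex) set" where
  "C_Lambda m L = {f. continuous_on UNIV f \<and> (\<forall>\<gamma>\<in>dual_group - L. fourier m f \<gamma> = 0)}"

definition bdd_clin :: "('x \<Rightarrow> complex) set \<Rightarrow> (('x \<Rightarrow> complex) \<Rightarrow> real) \<Rightarrow>
    ('y \<Rightarrow> complex) set \<Rightarrow> (('y \<Rightarrow> complex) \<Rightarrow> real) \<Rightarrow>
    (('x \<Rightarrow> complex) \<Rightarrow> ('y \<Rightarrow> complex)) \<Rightarrow> bool" where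
  "bdd_clin A nA B nB T \<longleftrightarrow> T ` A \<subseteq> B \<and>
     (\<forall>f\<in>A. \<forall>g\<in>A. T (\<lambda>x. f x + g x) = (\<lambda>y. T f y + T g y)) \<and>
     (\<forall>c. \<forall>f\<in>A. T (\<lambda>x. c * f x) = (\<lambda>y. c * T f y)) \<and>
     (\<exists>K. \<forall>f\<in>A. nB (T f) \<le> K * nA f)"

definition opnorm_on :: "('x \<Rightarrow> complex) set \<Rightarrow> (('x \<Rightarrow> complex) \<Rightarrow> ('x \<Rightarrow> complex)) \<Rightarrow> real" where
  "opnorm_on S T = Sup ((\<lambda>f. supn (T f)) ` {f\<in>S. supn f \<le> 1})"

definition dual_sp :: "('x \<Rightarrow> complex) set \<Rightarrow> (('x \<Rightarrow> complex) \<Rightarrow> complex) set" where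
  "dual_sp S = {\<phi>. (\<forall>f\<in>S. \<forall>g\<in>S. \<phi> (\<lambda>x. f x + g x) = \<phi> f + \<phi> g) \<and>
      (\<forall>c. \<forall>f\<in>S. \<phi> (\<lambda>x. c * f x) = c * \<phi> f) \<and>
      (\<exists>K. \<forall>f\<in>S. norm (\<phi> f) \<le> K * supn f) \<and> (\<forall>f. f \<notin> S \<longrightarrow> \<phi> f = 0)}"

definition dnorm :: "('x \<Rightarrow> complex) set \<Rightarrow> (('x \<Rightarrow> complex) \<Rightarrow> complex) \<Rightarrow> real" where
  "dnorm S \<phi> = Sup ((\<lambda>f. norm (\<phi> f)) ` {f\<in>S. supn f \<le> 1})"

definition pt_eval :: "('x \<Rightarrow> complex) set \<Rightarrow> 'x \<Rightarrow> (('x \<Rightarrow> complex) \<Rightarrow> complex)" where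
  "pt_eval S g = (\<lambda>f. if f \<in> S then f g else 0)"

definition adj_pt :: "('x \<Rightarrow> complex) set \<Rightarrow> (('x \<Rightarrow> complex) \<Rightarrow> ('x \<Rightarrow> complex)) \<Rightarrow> 'x
    \<Rightarrow> (('x \<Rightarrow> complex) \<Rightarrow> complex)" where
  "adj_pt S T g = (\<lambda>f. if f \<in> S then T f g else 0)"

definition L_proj :: "('x \<Rightarrow> complex) set \<Rightarrow> 'x \<Rightarrow>
    ((('x \<Rightarrow> complex) \<Rightarrow> complex) \<Rightarrow> (('x \<Rightarrow> complex) \<Rightarrow> complex)) \<Rightarrow> bool" where
  "L_proj S h P \<longleftrightarrow>
     (\<forall>\<phi>\<in>dual_sp S. \<forall>\<psi>\<in>dual_sp S. P (\<lambda>f. \<phi> f + \<psi> f) = (\<lambda>f. P \<phi> f + P \<psi> f)) \<and>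
     (\<forall>c. \<forall>\<phi>\<in>dual_sp S. P (\<lambda>f. c * \<phi> f) = (\<lambda>f. c * P \<phi> f)) \<and>
     (\<forall>\<phi>\<in>dual_sp S. P (P \<phi>) = P \<phi>) \<and>
     P ` dual_sp S = {(\<lambda>f. c * pt_eval S h f) | c. True} \<and>
     (\<forall>\<phi>\<in>dual_sp S. dnorm S \<phi> = dnorm S (P \<phi>) + dnorm S (\<lambda>f. \<phi> f - P \<phi> f))"

definition Pi_proj :: "('x \<Rightarrow> complex) set \<Rightarrow> 'x \<Rightarrow>
    ((('x \<Rightarrow> complex) \<Rightarrow> complex) \<Rightarrow> (('x \<Rightarrow> complex) \<Rightarrow> complex))" where
  "Pi_proj S h = (SOME P. L_proj S h P)"

definition pi_fun :: "('x \<Rightarrow> complex) set \<Rightarrow> 'x \<Rightarrow> (('x \<Rightarrow> complex) \<Rightarrow> complex) \<Rightarrow> complex" where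
  "pi_fun S h \<phi> = (SOME c. Pi_proj S h \<phi> = (\<lambda>f. c * pt_eval S h f))"

definition weak_top :: "('x \<Rightarrow> complex) set \<Rightarrow> ('x \<Rightarrow> complex) topology" where
  "weak_top S = topology_generated_by {S \<inter> \<phi> -` U | \<phi> U. \<phi> \<in> dual_sp S \<and> open U}"

definition weakly_compact_op :: "('x \<Rightarrow> complex) set \<Rightarrow> (('x \<Rightarrow> complex) \<Rightarrow> ('x \<Rightarrow> complex)) \<Rightarrow> bool" where
  "weakly_compact_op S T \<longleftrightarrow>
     compactin (weak_top S) ((weak_top S) closure_of (T ` {f\<in>S. supn f \<le> 1}))"

definition c0 :: "(nat \<Rightarrow> complex) set" where
  "c0 = {x. (x \<longlonglongrightarrow> 0)}"

definition closed_subspace_c0 :: "(nat \<Rightarrow> complex) set \<Rightarrow> bool" where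
  "closed_subspace_c0 E \<longleftrightarrow> E \<subseteq> c0 \<and> (\<lambda>n. 0) \<in> E \<and>
     (\<forall>x\<in>E. \<forall>y\<in>E. (\<lambda>n. x n + y n) \<in> E) \<and> (\<forall>c. \<forall>x\<in>E. (\<lambda>n. c * x n) \<in> E) \<and>
     (\<forall>xs x. (\<forall>k. xs k \<in> E) \<and> x \<in> c0 \<and> ((\<lambda>k. supn (\<lambda>n. xs k n - x n)) \<longlonglongrightarrow> 0) \<longrightarrow> x \<in> E)"

definition factors_c0 :: "('x \<Rightarrow> complex) set \<Rightarrow> (('x \<Rightarrow> complex) \<Rightarrow> ('x \<Rightarrow> complex)) \<Rightarrow> bool" where
  "factors_c0 S T \<longleftrightarrow> (\<exists>E T1 T2. closed_subspace_c0 E \<and> bdd_clin S supn E supn T1 \<and>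
      bdd_clin E supn S supn T2 \<and> (\<forall>f\<in>S. T f = T2 (T1 f)))"

end

theory Submission
  imports Defs
begin

text \<open>
  A functional \<open>\<phi>\<close> on \<open>C\<^sub>\<Lambda>\<close> extends with the same norm to a complex measure on \<open>G\<close>. Two
  extensions differ by a measure annihilating \<open>C\<^sub>\<Lambda>\<close>, hence the characters in \<open>\<Lambda>\<close>, which is
  diffuse because \<open>\<Gamma> - (-\<Lambda>)\<close> is semi-Riesz. So the point masses of the extension depend only
  on \<open>\<phi>\<close>; they are the numbers \<open>\<pi>\<^sub>h(\<phi>)\<close>, and splitting off finitely many of them is
  \<open>\<ell>\<^sub>1\<close>-additive for the norm.

  Consequently \<open>\<parallel>p\<^sub>s + T* p\<^sub>s\<parallel> = |1 + \<pi>\<^sub>s(T* p\<^sub>s)| - |\<pi>\<^sub>s(T* p\<^sub>s)| + \<parallel>T* p\<^sub>s\<parallel>\<close>, and the Daugavet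
  equation follows once every nonempty open set contains a point \<open>s\<close> with \<open>\<pi>\<^sub>s(T* p\<^sub>s)\<close> small. If
  \<open>T\<close> factors through a subspace of \<open>c\<^sub>0\<close>, only countably many \<open>t\<close> can be atoms of any \<open>T* p\<^sub>s\<close>,
  while nonempty open sets are uncountable. If \<open>s \<mapsto> \<pi>\<^sub>t(T* p\<^sub>s)\<close> is continuous for every \<open>t\<close>,
  large values would accumulate against \<open>\<Sum>\<^sub>t |\<pi>\<^sub>t(T* p\<^sub>s)| \<le> \<parallel>T\<parallel>\<close>; weak compactness gives this
  continuity because \<open>T**\<close> then maps \<open>\<pi>\<^sub>t\<close> into \<open>C\<^sub>\<Lambda>\<close>.
\<close>

section \<open>The Hahn--Banach theorem\<close>

text \<open>The transform integrates \<open>cnj (\<gamma> x)\<close>, so a measure annihilating a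
  character of \<open>L\<close> has a transform vanishing at the conjugate character; this is why
  the semi-Riesz hypothesis concerns the complement of \<open>neg_set L\<close>.

  A complex measure is encoded as a quadruple of positive ones, and different quadruples give the
  same functional. So point masses are read off from functionals as limits along narrow bump
  functions, and norm identities for measures are proved by testing functionals against explicit
  functions of sup norm at most 1; no total variation is formed.

  The numbers \<open>pi_fun\<close> come from an arbitrarily chosen L-projection, so they become
  usable only once L-projections onto a given line are known to be unique.

  One small atom suffices for the norm of Id + T because the points where a fixed near-maximal
  \<open>T f\<close> is large form an open set, and the evaluation point \<open>s\<close> may be
  moved freely within it. This freedom is what both mechanisms for finding a small atom
  exploit.\<close>

definition sublinear :: "('a::real_vector \<Rightarrow> real) \<Rightarrow> bool" where
  "sublinear p \<longleftrightarrow> (\<forall>x y. p (x + y) \<le> p x + p y) \<and> (\<forall>t x. t \<ge> 0 \<longrightarrow> p (t *\<^sub>R x) = t * p x)"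

lemma sublinearD:
  assumes "sublinear p"
  shows "p (x + y) \<le> p x + p y" "t \<ge> 0 \<Longrightarrow> p (t *\<^sub>R x) = t * p x"
  using assms by (auto simp: sublinear_def)

text \<open>Partial linear functionals are treated as their graphs, which are subspaces of
  \<open>'a \<times> real\<close>; a subspace lying below the graph of \<open>p\<close> is automatically single-valued.\<close>

lemma dominated_graph_extend:
  fixes p :: "'a::real_vector \<Rightarrow> real"
  assumes p: "sublinear p" and G: "subspace G" and le: "\<And>x a. (x, a) \<in> G \<Longrightarrow> a \<le> p x"
  obtains c H where "subspace H" "G \<subseteq> H" "(z, c) \<in> H" "\<And>x a. (x, a) \<in> H \<Longrightarrow> a \<le> p x"
proof -
  have sep: "a - p (x - z) \<le> p (y + z) - b" if "(x, a) \<in> G" "(y, b) \<in> G" for x a y b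
  proof -
    have "(x + y, a + b) \<in> G" using subspace_add[OF G that] by simp
    then have "a + b \<le> p (x + y)" by (rule le)
    also have "\<dots> = p ((x - z) + (y + z))" by simp
    also have "\<dots> \<le> p (x - z) + p (y + z)" by (rule sublinearD[OF p])
    finally show ?thesis by simp
  qed
  \<comment> \<open>Every number between the two sides of \<open>sep\<close> is an admissible value
    at \<open>z\<close>; the supremum of the left sides is one, and comparison with the pair
    \<open>(0, 0)\<close> shows that it is finite.\<close>
  define c where "c = (SUP (x, a)\<in>G. a - p (x - z))"
  have 0: "(0, 0) \<in> G" using subspace_0[OF G] by (simp add: zero_prod_def)
  have bdd: "bdd_above ((\<lambda>(x, a). a - p (x - z)) ` G)"
    using sep[OF _ 0] by (auto simp: bdd_above_def intro!: exI[of _ "p (0 + z) - 0"])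
  have lo: "a - p (x - z) \<le> c" if "(x, a) \<in> G" for x a
    unfolding c_def using cSUP_upper[OF that bdd] by simp
  have hi: "c \<le> p (y + z) - b" if "(y, b) \<in> G" for y b
    unfolding c_def using 0 sep[OF _ that] by (intro cSUP_least) auto
  define H where "H = {(x + t *\<^sub>R z, a + t * c) | x a t. (x, a) \<in> G}"
  have "subspace H"
  proof (rule subspaceI)
    show "0 \<in> H" unfolding H_def zero_prod_def using 0 by force
  next
    fix u v assume "u \<in> H" "v \<in> H"
    then obtain x a t y b s where *: "u = (x + t *\<^sub>R z, a + t * c)" "(x, a) \<in> G"
       "v = (y + s *\<^sub>R z, b + s * c)" "(y, b) \<in> G" unfolding H_def by blast
    have "(x + y, a + b) \<in> G" using subspace_add[OF G *(2,4)] by simp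
    moreover have "u + v = ((x + y) + (t + s) *\<^sub>R z, (a + b) + (t + s) * c)"
      unfolding * by (simp add: algebra_simps)
    ultimately show "u + v \<in> H" unfolding H_def by blast
  next
    fix r u assume "u \<in> H"
    then obtain x a t where *: "u = (x + t *\<^sub>R z, a + t * c)" "(x, a) \<in> G" unfolding H_def by blast
    have "(r *\<^sub>R x, r * a) \<in> G" using subspace_scale[OF G *(2), of r] by simp
    moreover have "r *\<^sub>R u = (r *\<^sub>R x + (r * t) *\<^sub>R z, r * a + (r * t) * c)"
      unfolding * by (simp add: algebra_simps)
    ultimately show "r *\<^sub>R u \<in> H" unfolding H_def by blast
  qed
  moreover have "G \<subseteq> H"
  proof
    fix u assume "u \<in> G"
    moreover have "u = (fst u + 0 *\<^sub>R z, snd u + 0 * c)" by simp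
    ultimately show "u \<in> H" unfolding H_def by (metis (mono_tags, lifting) mem_Collect_eq prod.collapse)
  qed
  moreover have "(z, c) \<in> H"
  proof -
    have "(z, c) = (0 + 1 *\<^sub>R z, 0 + 1 * c)" by simp
    then show ?thesis unfolding H_def using 0 by blast
  qed
  moreover have "b \<le> p y" if yb: "(y, b) \<in> H" for y b
  proof -
    obtain x a t where y: "y = x + t *\<^sub>R z" and b: "b = a + t * c" and xa: "(x, a) \<in> G"
      using yb unfolding H_def by blast
    \<comment> \<open>Homogeneity reduces the signs of \<open>t\<close> to t = 1 and t = -1, which
      are \<open>hi\<close> and \<open>lo\<close> at a rescaled point of the graph.\<close>
    have scal: "(r *\<^sub>R x, r * a) \<in> G" for r
      using subspace_scale[OF G xa, of r] by simp
    consider "t = 0" | "t > 0" | "t < 0" by linarith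
    then show ?thesis
    proof cases
      case 1
      then show ?thesis using le[OF xa] y b by simp
    next
      case 2
      have "t * c \<le> t * (p ((1/t) *\<^sub>R x + z) - (1/t) * a)"
        using hi[OF scal, of "1/t"] 2 by (intro mult_left_mono) auto
      also have "\<dots> = t * p ((1/t) *\<^sub>R x + z) - a" using 2 by (simp add: algebra_simps)
      also have "t * p ((1/t) *\<^sub>R x + z) = p (t *\<^sub>R ((1/t) *\<^sub>R x + z))"
        using 2 sublinearD(2)[OF p, of t] by simp
      also have "t *\<^sub>R ((1/t) *\<^sub>R x + z) = y" using 2 y by (simp add: algebra_simps)
      finally show ?thesis using b by simp
    next
      case 3
      define s where "s = - t"
      have s: "s > 0" "t = - s" using 3 s_def by auto
      have "s * ((1/s) * a - p ((1/s) *\<^sub>R x - z)) \<le> s * c"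
        using lo[OF scal, of "1/s"] s by (intro mult_left_mono) auto
      moreover have "s * ((1/s) * a - p ((1/s) *\<^sub>R x - z)) = a - s * p ((1/s) *\<^sub>R x - z)"
        using s by (simp add: algebra_simps)
      moreover have "s * p ((1/s) *\<^sub>R x - z) = p y"
        using s y sublinearD(2)[OF p, of s "(1/s) *\<^sub>R x - z"] by (simp add: scaleR_diff_right)
      moreover have "b = a - s * c" using b s by simp
      ultimately show ?thesis by linarith
    qed
  qed
  ultimately show ?thesis using that by blast
qed

text \<open>Zorn's lemma is applied to the dominated subspaces of the product that contain the graph
  of \<open>u\<close>. A maximal one has full domain, since otherwise the one-step extension would
  enlarge it.\<close>

theorem hahn_banach:
  fixes p :: "'a::real_vector \<Rightarrow> real" and u :: "'a \<Rightarrow> real"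
  assumes p: "sublinear p" and S: "subspace S"
    and add: "\<And>x y. x \<in> S \<Longrightarrow> y \<in> S \<Longrightarrow> u (x + y) = u x + u y"
    and scale: "\<And>t x. x \<in> S \<Longrightarrow> u (t *\<^sub>R x) = t * u x"
    and le: "\<And>x. x \<in> S \<Longrightarrow> u x \<le> p x"
  obtains w where "linear w" "\<And>x. w x \<le> p x" "\<And>x. x \<in> S \<Longrightarrow> w x = u x"
proof -
  define A where "A = {G. subspace G \<and> (\<lambda>x. (x, u x)) ` S \<subseteq> G \<and> (\<forall>(x, a)\<in>G. a \<le> p x)}"
  have "(\<lambda>x. (x, u x)) ` S \<in> A"
  proof -
    have "subspace ((\<lambda>x. (x, u x)) ` S)"
    proof (rule subspaceI)
      show "0 \<in> (\<lambda>x. (x, u x)) ` S"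
        using subspace_0[OF S] scale[of 0 0] by (auto simp: zero_prod_def image_iff)
    next
      fix a b assume "a \<in> (\<lambda>x. (x, u x)) ` S" "b \<in> (\<lambda>x. (x, u x)) ` S"
      then show "a + b \<in> (\<lambda>x. (x, u x)) ` S"
        using subspace_add[OF S] by (auto simp: add image_iff)
    next
      fix r a assume "a \<in> (\<lambda>x. (x, u x)) ` S"
      then show "r *\<^sub>R a \<in> (\<lambda>x. (x, u x)) ` S"
        using subspace_scale[OF S] by (auto simp: scale image_iff)
    qed
    then show ?thesis using le by (auto simp: A_def)
  qed
  then have "A \<noteq> {}" by blast
  moreover have "\<Union>C \<in> A" if "C \<noteq> {}" "subset.chain A C" for C
  proof -
    have CA: "C \<subseteq> A" and ch: "\<And>X Y. X \<in> C \<Longrightarrow> Y \<in> C \<Longrightarrow> X \<subseteq> Y \<or> Y \<subseteq> X"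
      using that(2) by (auto simp: subset_chain_def)
    have sub: "subspace X" if "X \<in> C" for X using CA that by (auto simp: A_def)
    have "subspace (\<Union>C)"
    proof (rule subspaceI)
      show "0 \<in> \<Union>C" using that(1) sub subspace_0 by blast
    next
      fix x y assume "x \<in> \<Union>C" "y \<in> \<Union>C"
      then obtain X Y where "X \<in> C" "Y \<in> C" "x \<in> X" "y \<in> Y" by blast
      then show "x + y \<in> \<Union>C" using ch[of X Y] sub subspace_add by blast
    next
      fix r x assume "x \<in> \<Union>C"
      then show "r *\<^sub>R x \<in> \<Union>C" using sub subspace_scale by blast
    qed
    moreover have "(\<lambda>x. (x, u x)) ` S \<subseteq> \<Union>C" using that(1) CA unfolding A_def by blast
    moreover have "\<forall>(x, a)\<in>\<Union>C. a \<le> p x" using CA unfolding A_def by blast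
    ultimately show ?thesis by (simp add: A_def)
  qed
  ultimately obtain G where GA: "G \<in> A" and mx: "\<And>X. X \<in> A \<Longrightarrow> G \<subseteq> X \<Longrightarrow> X = G"
    using subset_Zorn_nonempty[of A] by blast
  have G: "subspace G" and GS: "\<And>x. x \<in> S \<Longrightarrow> (x, u x) \<in> G" and Gle: "\<And>x a. (x, a) \<in> G \<Longrightarrow> a \<le> p x"
    using GA unfolding A_def by auto
  have "\<exists>c. (z, c) \<in> G" for z
  proof -
    obtain c H where H: "subspace H" "G \<subseteq> H" "(z, c) \<in> H" "\<And>x a. (x, a) \<in> H \<Longrightarrow> a \<le> p x"
      using dominated_graph_extend[OF p G Gle] by metis
    then have "H \<in> A" using GA by (auto simp: A_def)
    then show ?thesis using mx H by blast
  qed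
  then obtain w where w: "\<And>z. (z, w z) \<in> G" by metis
  have p0: "p 0 = 0" using sublinearD(2)[OF p, of 0 0] by simp
  \<comment> \<open>Two values at \<open>x\<close> put both \<open>(0, a - b)\<close> and its
    negative into \<open>G\<close>, where \<open>p 0 = 0\<close> bounds the second
    components.\<close>
  have uniq: "a = b" if "(x, a) \<in> G" "(x, b) \<in> G" for x a b
  proof -
    have "(0, a - b) \<in> G" "(0, b - a) \<in> G"
      using subspace_diff[OF G that] subspace_diff[OF G that(2,1)] by simp_all
    then show ?thesis using Gle[of 0 "a - b"] Gle[of 0 "b - a"] p0 by simp
  qed
  have "linear w"
  proof (rule linearI)
    fix x y show "w (x + y) = w x + w y"
      using uniq[OF w] subspace_add[OF G w[of x] w[of y]] by simp
  next
    fix r x show "w (r *\<^sub>R x) = r *\<^sub>R w x"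
      using uniq[OF w] subspace_scale[OF G w[of x], of r] by simp
  qed
  moreover have "w x \<le> p x" for x using Gle[OF w] .
  moreover have "w x = u x" if "x \<in> S" for x using uniq[OF w GS[OF that]] .
  ultimately show ?thesis using that by blast
qed

section \<open>Subspaces of bounded functions, their sup norm and their dual norm\<close>

definition csubspace_fun :: "('x \<Rightarrow> complex) set \<Rightarrow> bool" where
  "csubspace_fun S \<longleftrightarrow> (\<lambda>x. 0) \<in> S \<and> (\<forall>f\<in>S. \<forall>g\<in>S. (\<lambda>x. f x + g x) \<in> S) \<and>
     (\<forall>c. \<forall>f\<in>S. (\<lambda>x. c * f x) \<in> S)"

lemma csubspace_funD:
  assumes "csubspace_fun S"
  shows "(\<lambda>x. 0) \<in> S" "f \<in> S \<Longrightarrow> g \<in> S \<Longrightarrow> (\<lambda>x. f x + g x) \<in> S" "f \<in> S \<Longrightarrow> (\<lambda>x. c * f x) \<in> S"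
  using assms by (auto simp: csubspace_fun_def)

lemma csubspace_fun_diff:
  assumes "csubspace_fun S" "f \<in> S" "g \<in> S" shows "(\<lambda>x. f x - g x) \<in> S"
  using csubspace_funD(2)[OF assms(1,2) csubspace_funD(3)[OF assms(1,3), of "-1"]] by simp

lemma bcontfun_iff: "f \<in> bcontfun \<longleftrightarrow> continuous_on UNIV f \<and> bounded (range f)"
  by (simp add: bcontfun_def)

lemma norm_le_supn: "f \<in> bcontfun \<Longrightarrow> norm (f x) \<le> supn f"
  unfolding supn_def bcontfun_iff bounded_iff
  by (intro cSUP_upper) (auto simp: bdd_above_def)

lemma supn_le: "(\<And>x. norm (f x) \<le> b) \<Longrightarrow> supn f \<le> b"
  unfolding supn_def by (intro cSUP_least) auto

lemma supn_nonneg: "f \<in> bcontfun \<Longrightarrow> 0 \<le> supn f"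
  using norm_le_supn[of f] norm_ge_zero order_trans by blast

lemma supn_zero [simp]: "supn (\<lambda>x. 0) = 0"
  by (simp add: supn_def)

text \<open>\<open>hahn_banach\<close> needs a real vector space as a type, whereas the spaces here
  are sets of functions. Bounded continuous functions form such a type, and its norm is the sup
  norm.\<close>

lemma supn_eq_norm: "supn f = norm (Bcontfun f)" if "f \<in> bcontfun"
proof -
  have f: "apply_bcontfun (Bcontfun f) = f" using that by (simp add: Bcontfun_inverse)
  have "norm (f x) \<le> norm (Bcontfun f)" for x using norm_bounded[of "Bcontfun f" x] f by simp
  moreover have "norm (Bcontfun f) \<le> supn f"
    by (rule norm_bound) (simp add: f norm_le_supn that)
  ultimately show ?thesis by (intro antisym supn_le)
qed

lemma csubspace_fun_bcontfun: "csubspace_fun (bcontfun :: ('x::topological_space \<Rightarrow> complex) set)"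
proof -
  have "(\<lambda>x. c * f x) \<in> bcontfun" if "f \<in> bcontfun" for c and f :: "'x \<Rightarrow> complex"
    by (rule bcontfun_normI[where b = "norm c * supn f"])
      (use that in \<open>auto simp: norm_mult bcontfun_iff norm_le_supn[OF that] intro!: continuous_intros mult_left_mono\<close>)
  then show ?thesis by (simp add: csubspace_fun_def plus_cont const_bcontfun)
qed

lemma supn_cmult: "f \<in> bcontfun \<Longrightarrow> supn (\<lambda>x. c * f x) = norm c * supn f"
proof (cases "c = 0")
  case False
  assume f: "f \<in> bcontfun"
  have cf: "(\<lambda>x. c * f x) \<in> bcontfun" by (rule csubspace_funD(3)[OF csubspace_fun_bcontfun f])
  have "norm (f x) \<le> supn (\<lambda>x. c * f x) / norm c" for x
    using norm_le_supn[OF cf, of x] False by (simp add: field_simps norm_mult)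
  then have "supn f \<le> supn (\<lambda>x. c * f x) / norm c" by (rule supn_le)
  then have "norm c * supn f \<le> supn (\<lambda>x. c * f x)" using False by (simp add: field_simps)
  moreover have "supn (\<lambda>x. c * f x) \<le> norm c * supn f"
    by (rule supn_le) (simp add: norm_mult norm_le_supn[OF f] mult_left_mono)
  ultimately show ?thesis by simp
qed simp

lemma dual_spD:
  assumes "\<phi> \<in> dual_sp S"
  shows "f \<in> S \<Longrightarrow> g \<in> S \<Longrightarrow> \<phi> (\<lambda>x. f x + g x) = \<phi> f + \<phi> g"
    and "f \<in> S \<Longrightarrow> \<phi> (\<lambda>x. c * f x) = c * \<phi> f"
    and "f \<notin> S \<Longrightarrow> \<phi> f = 0"
  using assms by (auto simp: dual_sp_def)

lemma dual_spI:
  assumes "\<And>f g. f \<in> S \<Longrightarrow> g \<in> S \<Longrightarrow> \<phi> (\<lambda>x. f x + g x) = \<phi> f + \<phi> g"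
    and "\<And>c f. f \<in> S \<Longrightarrow> \<phi> (\<lambda>x. c * f x) = c * \<phi> f"
    and "\<And>f. f \<in> S \<Longrightarrow> norm (\<phi> f) \<le> K * supn f"
    and "\<And>f. f \<notin> S \<Longrightarrow> \<phi> f = 0"
  shows "\<phi> \<in> dual_sp S"
  using assms unfolding dual_sp_def by blast

lemma dual_sp_diff:
  assumes "\<phi> \<in> dual_sp S" "csubspace_fun S" "f \<in> S" "g \<in> S"
  shows "\<phi> (\<lambda>x. f x - g x) = \<phi> f - \<phi> g"
  using dual_spD(1)[OF assms(1,3) csubspace_funD(3)[OF assms(2,4), of "-1"]]
    dual_spD(2)[OF assms(1,4), of "-1"] by simp

text \<open>Rotating values onto the nonnegative reals turns moduli, and sums of moduli, into values
  of linear expressions.\<close>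

lemma unimodular_factor:
  obtains c :: complex where "norm c = 1" "c * z = of_real (norm z)"
proof (cases "z = 0")
  case False
  then show ?thesis by (intro that[of "of_real (norm z) / z"]) (auto simp: norm_divide)
qed (use that[of 1] in auto)

context
  fixes S :: "('x::topological_space \<Rightarrow> complex) set"
  assumes S: "csubspace_fun S" "S \<subseteq> bcontfun"
begin

lemma dnorm_bdd: "\<phi> \<in> dual_sp S \<Longrightarrow> bdd_above ((\<lambda>f. norm (\<phi> f)) ` {f\<in>S. supn f \<le> 1})"
proof -
  assume "\<phi> \<in> dual_sp S"
  then obtain K where K: "\<And>f. f \<in> S \<Longrightarrow> norm (\<phi> f) \<le> K * supn f" unfolding dual_sp_def by blast
  have "norm (\<phi> f) \<le> \<bar>K\<bar>" if "f \<in> S" "supn f \<le> 1" for f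
  proof -
    have "0 \<le> supn f" using supn_nonneg that S by blast
    then have "K * supn f \<le> \<bar>K\<bar> * 1" using that by (intro mult_mono) auto
    then show ?thesis using K[OF that(1)] by simp
  qed
  then show ?thesis by (auto simp: bdd_above_def)
qed

lemma norm_le_dnorm1: "\<phi> \<in> dual_sp S \<Longrightarrow> f \<in> S \<Longrightarrow> supn f \<le> 1 \<Longrightarrow> norm (\<phi> f) \<le> dnorm S \<phi>"
  unfolding dnorm_def by (rule cSUP_upper[OF _ dnorm_bdd]) auto

lemma dnorm_nonneg: "\<phi> \<in> dual_sp S \<Longrightarrow> 0 \<le> dnorm S \<phi>"
  using norm_le_dnorm1[of \<phi> "\<lambda>x. 0"] csubspace_funD(1)[OF S(1)] norm_ge_zero
  by (metis order_trans supn_zero zero_le_one)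

lemma norm_le_dnorm: "\<phi> \<in> dual_sp S \<Longrightarrow> f \<in> S \<Longrightarrow> norm (\<phi> f) \<le> dnorm S \<phi> * supn f"
proof (cases "supn f = 0")
  case True
  assume *: "\<phi> \<in> dual_sp S" "f \<in> S"
  then obtain K where K: "\<And>f. f \<in> S \<Longrightarrow> norm (\<phi> f) \<le> K * supn f" unfolding dual_sp_def by blast
  then show ?thesis using K[OF *(2)] True by simp
next
  case False
  assume *: "\<phi> \<in> dual_sp S" "f \<in> S"
  have f: "f \<in> bcontfun" using * S by blast
  have pos: "supn f > 0" using supn_nonneg[OF f] False by simp
  let ?c = "complex_of_real (1 / supn f)"
  have "supn (\<lambda>x. ?c * f x) \<le> 1" using supn_cmult[OF f, of ?c] pos by (simp add: norm_divide)
  then have "norm (\<phi> (\<lambda>x. ?c * f x)) \<le> dnorm S \<phi>"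
    by (intro norm_le_dnorm1 * csubspace_funD(3)[OF S(1)])
  then have "norm (?c * \<phi> f) \<le> dnorm S \<phi>" by (simp only: dual_spD(2)[OF *])
  then show ?thesis using pos by (simp add: norm_divide norm_mult field_simps)
qed

lemma dnorm_le: "0 \<le> K \<Longrightarrow> (\<And>f. f \<in> S \<Longrightarrow> supn f \<le> 1 \<Longrightarrow> norm (\<phi> f) \<le> K) \<Longrightarrow> dnorm S \<phi> \<le> K"
  unfolding dnorm_def using csubspace_funD(1)[OF S(1)] by (intro cSUP_least) (auto intro!: exI[of _ "\<lambda>x. 0"])

lemma dual_sp_add: "\<phi> \<in> dual_sp S \<Longrightarrow> \<psi> \<in> dual_sp S \<Longrightarrow> (\<lambda>f. \<phi> f + \<psi> f) \<in> dual_sp S"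
proof -
  assume *: "\<phi> \<in> dual_sp S" "\<psi> \<in> dual_sp S"
  have "norm (\<phi> f + \<psi> f) \<le> (dnorm S \<phi> + dnorm S \<psi>) * supn f" if "f \<in> S" for f
    using norm_triangle_ineq[of "\<phi> f" "\<psi> f"] norm_le_dnorm[OF *(1) that] norm_le_dnorm[OF *(2) that]
    by (simp add: distrib_right)
  then show ?thesis
    by (intro dual_spI[where K = "dnorm S \<phi> + dnorm S \<psi>"]) (use * in \<open>auto simp: dual_spD algebra_simps\<close>)
qed

lemma dual_sp_cmult: "\<phi> \<in> dual_sp S \<Longrightarrow> (\<lambda>f. c * \<phi> f) \<in> dual_sp S"
proof -
  assume *: "\<phi> \<in> dual_sp S"
  have "norm (c * \<phi> f) \<le> (norm c * dnorm S \<phi>) * supn f" if "f \<in> S" for f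
    using mult_left_mono[OF norm_le_dnorm[OF * that], of "norm c"] by (simp add: norm_mult mult.assoc)
  then show ?thesis by (intro dual_spI[where K = "norm c * dnorm S \<phi>"]) (use * in \<open>auto simp: dual_spD algebra_simps\<close>)
qed

lemma dual_sp_diff_fun: "\<phi> \<in> dual_sp S \<Longrightarrow> \<psi> \<in> dual_sp S \<Longrightarrow> (\<lambda>f. \<phi> f - \<psi> f) \<in> dual_sp S"
  using dual_sp_add[OF _ dual_sp_cmult[of \<psi> "-1"], of \<phi>] by simp

lemma dual_sp_zero: "(\<lambda>f. 0) \<in> dual_sp S"
  by (auto simp: dual_sp_def intro!: exI[of _ 0])

lemma dual_sp_sum: "(\<And>i. i \<in> I \<Longrightarrow> \<phi> i \<in> dual_sp S) \<Longrightarrow> (\<lambda>f. \<Sum>i\<in>I. \<phi> i f) \<in> dual_sp S"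
  by (induction I rule: infinite_finite_induct) (auto intro: dual_sp_add dual_sp_zero)

lemma pt_eval_dual_sp: "pt_eval S h \<in> dual_sp S"
proof -
  have "norm (pt_eval S h f) \<le> 1 * supn f" if "f \<in> S" for f
    using norm_le_supn[of f h] that S(2) by (auto simp: pt_eval_def)
  then show ?thesis
    by (intro dual_spI[where K = 1]) (auto simp: pt_eval_def csubspace_funD[OF S(1)])
qed

lemma dnorm_triangle: "\<phi> \<in> dual_sp S \<Longrightarrow> \<psi> \<in> dual_sp S \<Longrightarrow> dnorm S (\<lambda>f. \<phi> f + \<psi> f) \<le> dnorm S \<phi> + dnorm S \<psi>"
  by (intro dnorm_le add_nonneg_nonneg dnorm_nonneg) 
    (auto intro!: order_trans[OF norm_triangle_ineq] add_mono norm_le_dnorm1)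

lemma dnorm_cmult: assumes "\<phi> \<in> dual_sp S" shows "dnorm S (\<lambda>f. c * \<phi> f) = norm c * dnorm S \<phi>"
proof -
  have le: "dnorm S (\<lambda>f. c * \<psi> f) \<le> norm c * dnorm S \<psi>" if "\<psi> \<in> dual_sp S" for c \<psi>
    by (intro dnorm_le mult_nonneg_nonneg dnorm_nonneg that)
      (auto simp: norm_mult intro!: mult_left_mono norm_le_dnorm1 that)
  show ?thesis
  proof (cases "c = 0")
    case True
    then show ?thesis using le[OF assms, of c] dnorm_nonneg[OF dual_sp_cmult[OF assms, of c]] by simp
  next
    case False
    have "dnorm S (\<lambda>f. inverse c * (c * \<phi> f)) \<le> norm (inverse c) * dnorm S (\<lambda>f. c * \<phi> f)"
      by (rule le[OF dual_sp_cmult[OF assms]])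
    moreover have "(\<lambda>f. inverse c * (c * \<phi> f)) = \<phi>" using False by (simp add: fun_eq_iff)
    ultimately have "norm c * dnorm S \<phi> \<le> dnorm S (\<lambda>f. c * \<phi> f)"
      using False by (simp add: norm_divide field_simps)
    then show ?thesis using le[OF assms, of c] by simp
  qed
qed

text \<open>Bohnenblust--Sobczyk: a complex functional is determined by its real part \<open>w\<close>
  through \<open>f \<mapsto> w f - \<i> w (\<i> f)\<close>.\<close>

lemma complex_hahn_banach:
  assumes \<phi>: "\<phi> \<in> dual_sp S"
  obtains \<Phi> where "\<Phi> \<in> dual_sp bcontfun" "\<And>f. f \<in> S \<Longrightarrow> \<Phi> f = \<phi> f"
    "\<And>f. f \<in> bcontfun \<Longrightarrow> norm (\<Phi> f) \<le> dnorm S \<phi> * supn f"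
proof -
  define S' where "S' = {F. apply_bcontfun F \<in> S}"
  let ?C = "dnorm S \<phi>"
  have C: "0 \<le> ?C" by (rule dnorm_nonneg[OF \<phi>])
  have "sublinear (\<lambda>F :: ('x, complex) bcontfun. ?C * norm F)"
    using C unfolding sublinear_def
    by (auto simp: distrib_left[symmetric] intro!: mult_left_mono norm_triangle_ineq)
  moreover have "subspace S'"
    using csubspace_funD[OF S(1)] by (auto simp: subspace_def S'_def scaleR_conv_of_real)
  moreover have "Re (\<phi> (F + G)) = Re (\<phi> F) + Re (\<phi> G)" if "F \<in> S'" "G \<in> S'" for F G
    using dual_spD(1)[OF \<phi>, of F G] that by (simp add: S'_def plus_bcontfun.rep_eq)
  moreover have "Re (\<phi> (t *\<^sub>R F)) = t * Re (\<phi> F)" if "F \<in> S'" for F t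
    using dual_spD(2)[OF \<phi>, of F "of_real t"] that
    by (simp add: S'_def scaleR_bcontfun.rep_eq scaleR_conv_of_real)
  moreover have "Re (\<phi> F) \<le> ?C * norm F" if "F \<in> S'" for F
    using norm_le_dnorm[OF \<phi>, of F] that complex_Re_le_cmod[of "\<phi> F"] supn_eq_norm[of F]
    by (simp add: S'_def apply_bcontfun_inverse apply_bcontfun)
  ultimately obtain w where w: "linear w" "\<And>F. w F \<le> ?C * norm F" "\<And>F. F \<in> S' \<Longrightarrow> w F = Re (\<phi> F)"
    using hahn_banach[of "\<lambda>F. ?C * norm F" S' "\<lambda>F. Re (\<phi> F)"] by blast
  define v where "v f = w (Bcontfun f)" for f
  note bc = csubspace_funD[OF csubspace_fun_bcontfun]
  have v_add: "v (\<lambda>x. f x + g x) = v f + v g" if "f \<in> bcontfun" "g \<in> bcontfun" for f g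
  proof -
    have "Bcontfun (\<lambda>x. f x + g x) = Bcontfun f + Bcontfun g"
      using that by (auto intro!: bcontfun_eqI simp: Bcontfun_inverse plus_bcontfun.rep_eq bc)
    then show ?thesis by (simp add: v_def linear_add[OF w(1)])
  qed
  have v_scale: "v (\<lambda>x. of_real t * f x) = t * v f" if "f \<in> bcontfun" for t f
  proof -
    have "Bcontfun (\<lambda>x. of_real t * f x) = t *\<^sub>R Bcontfun f"
      using that by (auto intro!: bcontfun_eqI simp: Bcontfun_inverse scaleR_bcontfun.rep_eq bc scaleR_conv_of_real)
    then show ?thesis by (simp add: v_def linear_scale[OF w(1)])
  qed
  \<comment> \<open>Membership in \<open>dual_sp\<close> requires the value 0 outside the space,
    hence the conditional.\<close>
  define \<Phi> where "\<Phi> f = (if f \<in> bcontfun then Complex (v f) (- v (\<lambda>x. \<i> * f x)) else 0)" for f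
  have add: "\<Phi> (\<lambda>x. f x + g x) = \<Phi> f + \<Phi> g" if "f \<in> bcontfun" "g \<in> bcontfun" for f g
    using that bc(2)[OF that] v_add[OF that] v_add[OF bc(3)[OF that(1)] bc(3)[OF that(2)], of \<i> \<i>]
    by (simp add: \<Phi>_def complex_eq_iff distrib_left)
  have scale_real: "\<Phi> (\<lambda>x. of_real t * f x) = of_real t * \<Phi> f" if "f \<in> bcontfun" for f t
    using that bc(3)[OF that, of "of_real t"] v_scale[OF that] v_scale[OF bc(3)[OF that], of t \<i>]
    by (simp add: \<Phi>_def complex_eq_iff mult.left_commute)
  have scale_i: "\<Phi> (\<lambda>x. \<i> * f x) = \<i> * \<Phi> f" if "f \<in> bcontfun" for f
  proof -
    have "v (\<lambda>x. \<i> * (\<i> * f x)) = - v f"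
      using v_scale[OF that, of "-1"] by (simp add: mult.assoc[symmetric])
    then show ?thesis using that bc(3) by (auto simp: \<Phi>_def complex_eq_iff)
  qed
  have scale: "\<Phi> (\<lambda>x. c * f x) = c * \<Phi> f" if f: "f \<in> bcontfun" for f c
  proof -
    have "(\<lambda>x. c * f x) = (\<lambda>x. of_real (Re c) * f x + of_real (Im c) * (\<i> * f x))"
      by (simp add: fun_eq_iff complex_eq_iff algebra_simps)
    then have "\<Phi> (\<lambda>x. c * f x) = of_real (Re c) * \<Phi> f + of_real (Im c) * (\<i> * \<Phi> f)"
      using f by (simp add: add bc(3) scale_real scale_i)
    then show ?thesis by (simp add: complex_eq_iff algebra_simps)
  qed
  have norm: "norm (\<Phi> f) \<le> ?C * supn f" if f: "f \<in> bcontfun" for f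
  proof -
    \<comment> \<open>After rotation the value of \<open>\<Phi>\<close> is real, so it equals
      \<open>v\<close> of the rotated function, and the bound for the real functional
      applies.\<close>
    obtain c where c: "norm c = 1" "c * \<Phi> f = of_real (norm (\<Phi> f))" by (rule unimodular_factor)
    have "norm (\<Phi> f) = Re (\<Phi> (\<lambda>x. c * f x))" using scale[OF f, of c] c(2) by simp
    also have "\<dots> = v (\<lambda>x. c * f x)" using f bc(3) by (auto simp: \<Phi>_def)
    also have "\<dots> \<le> ?C * supn (\<lambda>x. c * f x)"
      unfolding v_def using w(2) supn_eq_norm[of "\<lambda>x. c * f x"] bc(3)[OF f] by simp
    finally show ?thesis using supn_cmult[OF f] c by simp
  qed
  have "\<Phi> f = \<phi> f" if f: "f \<in> S" for f
  proof -
    have "v g = Re (\<phi> g)" if "g \<in> S" for g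
      using that S(2) w(3)[of "Bcontfun g"] by (auto simp: v_def S'_def Bcontfun_inverse subset_iff)
    then show ?thesis using f csubspace_funD(3)[OF S(1)] S(2) dual_spD(2)[OF \<phi> f]
      by (auto simp: \<Phi>_def complex_eq_iff subset_iff)
  qed
  moreover have "\<Phi> \<in> dual_sp bcontfun"
    by (rule dual_spI[OF add scale norm]) (auto simp: \<Phi>_def)
  ultimately show ?thesis using that norm by blast
qed

end

section \<open>The Riesz--Markov theorem\<close>

lemma urysohn_compact_t2:
  fixes A B :: "'g::t2_space set"
  assumes "compact (UNIV :: 'g set)" "closed A" "closed B" "A \<inter> B = {}"
  obtains u :: "'g \<Rightarrow> real" where "continuous_on UNIV u" "\<And>x. 0 \<le> u x" "\<And>x. u x \<le> 1"
    "\<And>x. x \<in> A \<Longrightarrow> u x = 1" "\<And>x. x \<in> B \<Longrightarrow> u x = 0"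
proof -
  have "normal_space (euclidean :: 'g topology)"
    using assms(1) separation_t2
    by (intro compact_Hausdorff_or_regular_imp_normal_space disjI1)
      (auto simp: compact_space_def Hausdorff_space_def disjnt_def)
  then obtain u where u: "continuous_map euclidean (top_of_set {0..1::real}) u" "u ` B \<subseteq> {0}" "u ` A \<subseteq> {1}"
    using Urysohn_lemma[of "euclidean :: 'g topology" B A 0 1] assms by (auto simp: disjnt_def)
  have "\<And>x. u x \<in> {0..1}" "continuous_on UNIV u"
    using u(1) by (auto simp: continuous_map_in_subtopology)
  then show ?thesis using u that by (auto simp: image_subset_iff)
qed

locale positive_functional =
  fixes P :: "('g::t2_space \<Rightarrow> real) \<Rightarrow> real"
  assumes cpt: "compact (UNIV :: 'g set)"
    and P_add: "\<And>f g. continuous_on UNIV f \<Longrightarrow> continuous_on UNIV g \<Longrightarrow> P (\<lambda>x. f x + g x) = P f + P g"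
    and P_scale: "\<And>c f. continuous_on UNIV f \<Longrightarrow> P (\<lambda>x. c * f x) = c * P f"
    and P_pos: "\<And>f. continuous_on UNIV f \<Longrightarrow> (\<And>x. 0 \<le> f x) \<Longrightarrow> 0 \<le> P f"
begin

lemma P_diff: "continuous_on UNIV f \<Longrightarrow> continuous_on UNIV g \<Longrightarrow> P (\<lambda>x. f x - g x) = P f - P g"
  using P_add[of f "\<lambda>x. -1 * g x"] P_scale[of g "-1"] by (auto intro: continuous_intros)

lemma P_mono: "continuous_on UNIV f \<Longrightarrow> continuous_on UNIV g \<Longrightarrow> (\<And>x. f x \<le> g x) \<Longrightarrow> P f \<le> P g"
  using P_pos[of "\<lambda>x. g x - f x"] P_diff[of g f] by (auto intro: continuous_intros)

lemma P_sum: "finite I \<Longrightarrow> (\<And>i. i \<in> I \<Longrightarrow> continuous_on UNIV (f i)) \<Longrightarrow> P (\<lambda>x. \<Sum>i\<in>I. f i x) = (\<Sum>i\<in>I. P (f i))"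
proof (induction I rule: finite_induct)
  case empty
  then show ?case using P_scale[of "\<lambda>x. 0" 0] by simp
next
  case (insert i I)
  then show ?case using P_add[of "f i" "\<lambda>x. \<Sum>i\<in>I. f i x"] by (auto intro: continuous_intros)
qed

text \<open>Membership asks that \<open>f\<close> vanish off \<open>U\<close>, not that its support
  be compact in \<open>U\<close>; \<open>below_cut\<close> supplies a compact carrier at arbitrarily
  small cost.\<close>

definition below :: "'g set \<Rightarrow> ('g \<Rightarrow> real) set" where
  "below U = {f. continuous_on UNIV f \<and> (\<forall>x. 0 \<le> f x \<and> f x \<le> 1) \<and> (\<forall>x. x \<notin> U \<longrightarrow> f x = 0)}"

definition rho :: "'g set \<Rightarrow> ennreal" where "rho U = (SUP f\<in>below U. ennreal (P f))"

text \<open>On open sets the measure is forced to be Riesz's supremum \<open>rho\<close>; the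
  infimum over open supersets builds outer regularity into the definition.\<close>

definition mu :: "'g set \<Rightarrow> ennreal" where "mu A = (INF U\<in>{U. open U \<and> A \<subseteq> U}. rho U)"

lemma belowD: "f \<in> below U \<Longrightarrow> continuous_on UNIV f" "f \<in> below U \<Longrightarrow> 0 \<le> f x" "f \<in> below U \<Longrightarrow> f x \<le> 1"
  "f \<in> below U \<Longrightarrow> x \<notin> U \<Longrightarrow> f x = 0"
  by (auto simp: below_def)

lemma zero_below: "(\<lambda>x. 0) \<in> below U"
  by (auto simp: below_def)

lemma P_zero: "P (\<lambda>x. 0) = 0"
  using P_scale[of "\<lambda>x. 0" 0] by simp

lemma P_below_nonneg: "f \<in> below U \<Longrightarrow> 0 \<le> P f"
  by (auto intro: P_pos simp: below_def)

lemma le_rho: "f \<in> below U \<Longrightarrow> ennreal (P f) \<le> rho U"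
  unfolding rho_def by (rule SUP_upper)

lemma rho_mono: "U \<subseteq> V \<Longrightarrow> rho U \<le> rho V"
  unfolding rho_def by (rule SUP_subset_mono) (auto simp: below_def)

lemma rho_UNIV: "rho UNIV = ennreal (P (\<lambda>x. 1))"
proof (rule antisym)
  show "rho UNIV \<le> ennreal (P (\<lambda>x. 1))"
    unfolding rho_def by (intro SUP_least ennreal_leI P_mono) (auto simp: below_def)
qed (auto intro: le_rho simp: below_def)

lemma mu_open: "open U \<Longrightarrow> mu U = rho U"
  unfolding mu_def by (rule antisym) (auto intro: INF_lower INF_greatest rho_mono)

lemma mu_mono: "A \<subseteq> B \<Longrightarrow> mu A \<le> mu B"
  unfolding mu_def by (rule INF_superset_mono) auto

lemma mu_less_top: "mu A < top"
  using mu_mono[of A UNIV] rho_UNIV by (simp add: mu_open order.strict_trans1)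

lemma mu_approx:
  assumes "0 < e" shows "\<exists>U. open U \<and> A \<subseteq> U \<and> rho U < mu A + ennreal e"
  using INF_approx_ennreal[OF assms mu_def[of A]] mu_less_top[of A] by auto

text \<open>The truncation \<open>max (f - d) 0\<close> costs at most \<open>d * P 1\<close> and is carried by the
  compact set \<open>{f \<ge> d}\<close> inside \<open>U\<close>.\<close>

lemma below_cut:
  assumes f: "f \<in> below U" and e: "0 < e"
  obtains g K where "g \<in> below U" "closed K" "K \<subseteq> U" "\<And>x. x \<notin> K \<Longrightarrow> g x = 0" "P f \<le> P g + e"
proof -
  \<comment> \<open>The \<open>+ 1\<close> covers the case that \<open>P\<close> is 0 on the
    constant 1.\<close>
  define d where "d = e / (P (\<lambda>x. 1) + 1)"
  have P1: "0 \<le> P (\<lambda>x. 1)" by (rule P_pos) auto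
  have d: "0 < d" "d * P (\<lambda>x. 1) \<le> e" using e P1 by (auto simp: d_def field_simps)
  let ?g = "\<lambda>x. max (f x - d) 0"
  let ?K = "{x. d \<le> f x}"
  note cf = belowD(1)[OF f]
  have cg: "continuous_on UNIV ?g" by (intro continuous_intros cf)
  have "?g \<in> below U"
    unfolding below_def
  proof (intro CollectI conjI allI impI cg)
    fix x
    show "0 \<le> ?g x" by simp
    show "?g x \<le> 1" using belowD(3)[OF f, of x] d by simp
    show "?g x = 0" if "x \<notin> U" using belowD(4)[OF f that] d by simp
  qed
  moreover have "closed ?K" using cf by (intro closed_Collect_le) auto
  moreover have "?K \<subseteq> U" using belowD(4)[OF f] d by (force simp: not_le)
  moreover have "?g x = 0" if "x \<notin> ?K" for x using that by auto
  moreover have "P f \<le> P (\<lambda>x. ?g x + d * 1)"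
    using cf cg by (intro P_mono continuous_intros) auto
  then have "P f \<le> P ?g + e" using P_add[OF cg, of "\<lambda>x. d * 1"] P_scale[of "\<lambda>x. 1" d] d by auto
  ultimately show ?thesis using that by blast
qed

text \<open>A Urysohn function \<open>u\<close> splits a test function \<open>g\<close> into
  \<open>g u\<close> below \<open>U\<close> and \<open>g (1 - u)\<close> below \<open>V\<close>.
  Cutting first to a closed carrier \<open>K\<close> is what makes \<open>K - V\<close> and the
  complement of \<open>U\<close> disjoint closed sets.\<close>

lemma rho_Un:
  assumes "open U" "open V" shows "rho (U \<union> V) \<le> rho U + rho V"
  unfolding rho_def[of "U \<union> V"]
proof (rule SUP_least, rule ennreal_le_epsilon)
  fix f and e :: real assume "f \<in> below (U \<union> V)" and e: "0 < e"
  from below_cut[OF this] obtain g K where g: "g \<in> below (U \<union> V)" "closed K" "K \<subseteq> U \<union> V"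
    "\<And>x. x \<notin> K \<Longrightarrow> g x = 0" "P f \<le> P g + e" by blast
  obtain u where u: "continuous_on UNIV u" "\<And>x. 0 \<le> u x" "\<And>x. u x \<le> 1"
    "\<And>x. x \<in> K - V \<Longrightarrow> u x = 1" "\<And>x. x \<in> - U \<Longrightarrow> u x = (0::real)"
    using urysohn_compact_t2[of "K - V" "- U"] cpt g assms by (auto simp: closed_Diff)
  have c: "continuous_on UNIV (\<lambda>x. g x * u x)" "continuous_on UNIV (\<lambda>x. g x * (1 - u x))"
    by (intro continuous_intros belowD(1)[OF g(1)] u(1))+
  have 1: "(\<lambda>x. g x * u x) \<in> below U"
    using c belowD[OF g(1)] u by (auto simp: below_def intro: mult_le_one)
  have "g x * (1 - u x) = 0" if "x \<notin> V" for x
    using that g(4)[of x] u(4)[of x] by (cases "x \<in> K") auto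
  then have 2: "(\<lambda>x. g x * (1 - u x)) \<in> below V"
    using c belowD[OF g(1)] u(2,3) by (auto simp: below_def intro: mult_le_one)
  have "P g = P (\<lambda>x. g x * u x) + P (\<lambda>x. g x * (1 - u x))"
    using P_add[OF c] by (simp add: algebra_simps)
  then have "ennreal (P f) \<le> ennreal (P (\<lambda>x. g x * u x) + P (\<lambda>x. g x * (1 - u x)) + e)"
    using g(5) by (intro ennreal_leI) simp
  also have "\<dots> = ennreal (P (\<lambda>x. g x * u x)) + ennreal (P (\<lambda>x. g x * (1 - u x))) + ennreal e"
    using P_below_nonneg[OF 1] P_below_nonneg[OF 2] e by (simp add: ennreal_plus)
  also have "\<dots> \<le> rho U + rho V + ennreal e"
    by (intro add_mono le_rho 1 2) auto
  finally show "ennreal (P f) \<le> rho U + rho V + ennreal e" .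
qed

lemma rho_empty: "rho {} = 0"
proof -
  have "below {} = {\<lambda>x. 0}" by (auto simp: below_def)
  then show ?thesis by (simp add: rho_def P_zero)
qed

lemma rho_finite_UN:
  "finite I \<Longrightarrow> (\<And>i. i \<in> I \<Longrightarrow> open (U i)) \<Longrightarrow> rho (\<Union>i\<in>I. U i) \<le> (\<Sum>i\<in>I. rho (U i))"
proof (induction I rule: finite_induct)
  case (insert i I)
  then have "rho (\<Union>i\<in>insert i I. U i) \<le> rho (U i) + rho (\<Union>i\<in>I. U i)"
    using rho_Un[of "U i" "\<Union>i\<in>I. U i"] by auto
  also have "\<dots> \<le> rho (U i) + (\<Sum>i\<in>I. rho (U i))" using insert by (intro add_left_mono) auto
  finally show ?case using insert by simp
qed (simp add: rho_empty)

text \<open>A cut test function lives on a compact set, which finitely many of the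
  \<open>U i\<close> cover, so the finite case applies.\<close>

lemma rho_UN:
  fixes U :: "nat \<Rightarrow> 'g set"
  assumes op: "\<And>i. open (U i)" shows "rho (\<Union>i. U i) \<le> (\<Sum>i. rho (U i))"
  unfolding rho_def[of "\<Union>i. U i"]
proof (rule SUP_least, rule ennreal_le_epsilon)
  fix f and e :: real assume "f \<in> below (\<Union>i. U i)" and e: "0 < e"
  from below_cut[OF this] obtain g K where g: "g \<in> below (\<Union>i. U i)" "closed K" "K \<subseteq> (\<Union>i. U i)"
    "\<And>x. x \<notin> K \<Longrightarrow> g x = 0" "P f \<le> P g + e" by blast
  have "compact K" using cpt g(2) compact_Int_closed[of UNIV K] by simp
  then obtain I where I: "finite I" "K \<subseteq> (\<Union>i\<in>I. U i)"
    using compactE_image[of K UNIV U] g(3) op by metis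
  have "g x = 0" if "x \<notin> (\<Union>i\<in>I. U i)" for x using that I(2) g(4)[of x] by blast
  then have "g \<in> below (\<Union>i\<in>I. U i)" using belowD[OF g(1)] by (auto simp: below_def)
  then have "ennreal (P g) \<le> (\<Sum>i\<in>I. rho (U i))"
    by (rule order_trans[OF le_rho rho_finite_UN[OF I(1) op]])
  also have "\<dots> \<le> (\<Sum>i. rho (U i))" by (rule sum_le_suminf) (use I in auto)
  finally have "ennreal (P g) + ennreal e \<le> (\<Sum>i. rho (U i)) + ennreal e" by (rule add_right_mono)
  moreover have "ennreal (P f) \<le> ennreal (P g) + ennreal e"
    using g(5) e P_below_nonneg[OF g(1)] by (simp add: ennreal_plus[symmetric] ennreal_leI del: ennreal_plus)
  ultimately show "ennreal (P f) \<le> (\<Sum>i. rho (U i)) + ennreal e" by order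
qed

lemma mu_Un: "mu (A \<union> B) \<le> mu A + mu B"
proof (rule ennreal_le_epsilon)
  fix e :: real assume e: "0 < e"
  obtain U where U: "open U" "A \<subseteq> U" "rho U < mu A + ennreal (e/2)" using mu_approx[of "e/2" A] e by auto
  obtain V where V: "open V" "B \<subseteq> V" "rho V < mu B + ennreal (e/2)" using mu_approx[of "e/2" B] e by auto
  have "mu (A \<union> B) \<le> mu (U \<union> V)" using U V by (intro mu_mono) auto
  also have "\<dots> \<le> rho U + rho V" using rho_Un[OF U(1) V(1)] mu_open[OF open_Un[OF U(1) V(1)]] by simp
  also have "\<dots> \<le> (mu A + ennreal (e/2)) + (mu B + ennreal (e/2))"
    using U V by (intro add_mono less_imp_le)
  also have "\<dots> = mu A + mu B + (ennreal (e/2) + ennreal (e/2))" by (simp add: ac_simps)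
  also have "ennreal (e/2) + ennreal (e/2) = ennreal e" using e by (simp add: ennreal_plus[symmetric] del: ennreal_plus)
  finally show "mu (A \<union> B) \<le> mu A + mu B + ennreal e" .
qed

lemma mu_UN: "mu (\<Union>i::nat. A i) \<le> (\<Sum>i. mu (A i))"
proof (rule ennreal_le_epsilon)
  fix e :: real assume e: "0 < e"
  have "\<exists>U. open U \<and> A i \<subseteq> U \<and> rho U < mu (A i) + ennreal (e * (1/2) ^ Suc i)" for i
    using e by (intro mu_approx) auto
  then obtain U where U: "\<And>i. open (U i)" "\<And>i. A i \<subseteq> U i"
    "\<And>i. rho (U i) < mu (A i) + ennreal (e * (1/2) ^ Suc i)" by metis
  have "mu (\<Union>i. A i) \<le> mu (\<Union>i. U i)" using U by (intro mu_mono) auto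
  also have "\<dots> \<le> (\<Sum>i. rho (U i))" using rho_UN U by (simp add: mu_open open_UN)
  also have "\<dots> \<le> (\<Sum>i. mu (A i) + ennreal (e * (1/2) ^ Suc i))"
    using U by (intro suminf_le less_imp_le) auto
  also have "\<dots> = (\<Sum>i. mu (A i)) + (\<Sum>i. ennreal (e * (1/2) ^ Suc i))"
    by (rule suminf_add[symmetric]) auto
  also have "(\<Sum>i. ennreal (e * (1/2) ^ Suc i)) = ennreal e"
    using sums_mult[OF power_half_series, of e] e by (intro suminf_ennreal_eq) auto
  finally show "mu (\<Union>i. A i) \<le> (\<Sum>i. mu (A i)) + ennreal e" .
qed

lemma outer_measure_space_mu: "outer_measure_space (Pow UNIV) mu"
proof -
  have "mu {} = 0" using mu_open[of "{}"] rho_empty by simp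
  then show ?thesis unfolding outer_measure_space_def
    by (auto simp: positive_def increasing_def countably_subadditive_def mu_mono mu_UN)
qed

text \<open>Caratheodory's criterion. For open \<open>W\<close> containing \<open>X\<close>, a test
  function below \<open>W \<inter> U\<close> is cut to one carried by a closed \<open>K\<close>; it
  can then be added to any test function below \<open>W - K\<close> without exceeding 1, and
  \<open>W - K\<close> still contains the part of \<open>X\<close> outside \<open>U\<close>.\<close>

lemma open_lambda_system:
  assumes U: "open U" shows "U \<in> lambda_system UNIV (Pow UNIV) mu"
proof -
  have "mu (U \<inter> X) + mu ((UNIV - U) \<inter> X) \<le> mu X" for X
    unfolding mu_def[of X]
  proof (rule INF_greatest)
    fix W assume "W \<in> {W. open W \<and> X \<subseteq> W}"
    then have W: "open W" "X \<subseteq> W" by auto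
    have key: "ennreal (P f) + mu ((UNIV - U) \<inter> X) \<le> rho W" if f: "f \<in> below (W \<inter> U)" for f
    proof (rule ennreal_le_epsilon)
      fix e :: real assume e: "0 < e"
      from below_cut[OF f this] obtain g K where g: "g \<in> below (W \<inter> U)" "closed K" "K \<subseteq> W \<inter> U"
         "\<And>x. x \<notin> K \<Longrightarrow> g x = 0" "P f \<le> P g + e" by blast
      have le: "ennreal (P f) + ennreal (P h) \<le> rho W + ennreal e" if h: "h \<in> below (W - K)" for h
      proof -
        have c: "continuous_on UNIV (\<lambda>x. g x + h x)"
          using g(1) h by (intro continuous_intros belowD(1))
        have "g x + h x \<le> 1" for x
          using g(4)[of x] belowD(2,3)[OF g(1), of x] belowD(2-3)[OF h, of x] belowD(4)[OF h, of x] by (cases "x \<in> K") auto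
        then have "(\<lambda>x. g x + h x) \<in> below W"
          using c belowD[OF g(1)] belowD[OF h] by (auto simp: below_def)
        then have "ennreal (P g + P h) \<le> rho W"
          using le_rho[of "\<lambda>x. g x + h x" W] P_add[OF belowD(1)[OF g(1)] belowD(1)[OF h]] by simp
        moreover have "ennreal (P f) + ennreal (P h) \<le> ennreal (P g + P h) + ennreal e"
          using g(5) e P_below_nonneg[OF f] P_below_nonneg[OF g(1)] P_below_nonneg[OF h]
          by (simp add: ennreal_plus[symmetric] ennreal_leI del: ennreal_plus)
        ultimately show ?thesis by (meson add_right_mono order_trans)
      qed
      have "mu ((UNIV - U) \<inter> X) \<le> mu (W - K)" using W g by (intro mu_mono) auto
      also have "\<dots> = rho (W - K)" using W g by (intro mu_open open_Diff)
      finally have "ennreal (P f) + mu ((UNIV - U) \<inter> X) \<le> ennreal (P f) + rho (W - K)"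
        by (rule add_left_mono)
      also have "\<dots> = (SUP h\<in>below (W - K). ennreal (P f) + ennreal (P h))"
        unfolding rho_def using zero_below by (intro ennreal_SUP_add_right) auto
      also have "\<dots> \<le> rho W + ennreal e" by (intro SUP_least le)
      finally show "ennreal (P f) + mu ((UNIV - U) \<inter> X) \<le> rho W + ennreal e" .
    qed
    have "mu (U \<inter> X) \<le> mu (W \<inter> U)" using W by (intro mu_mono) auto
    also have "\<dots> = rho (W \<inter> U)" using W U by (intro mu_open) auto
    finally have "mu (U \<inter> X) + mu ((UNIV - U) \<inter> X) \<le> rho (W \<inter> U) + mu ((UNIV - U) \<inter> X)"
      by (rule add_right_mono)
    also have "\<dots> = (SUP f\<in>below (W \<inter> U). ennreal (P f) + mu ((UNIV - U) \<inter> X))"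
      unfolding rho_def using zero_below by (intro ennreal_SUP_add_left[symmetric]) auto
    also have "\<dots> \<le> rho W" by (intro SUP_least key)
    finally show "mu (U \<inter> X) + mu ((UNIV - U) \<inter> X) \<le> rho W" .
  qed
  moreover have "mu X \<le> mu (U \<inter> X) + mu ((UNIV - U) \<inter> X)" for X
    using mu_Un[of "U \<inter> X" "(UNIV - U) \<inter> X"] by (simp add: Un_Diff Int_Un_distrib2[symmetric])
  ultimately show ?thesis by (auto simp: lambda_system_def intro!: antisym)
qed

section \<open>The Radon measure obtained from the outer measure\<close>

definition M :: "'g measure" where "M = measure_of UNIV (sets borel) mu"

lemma sets_M [simp, measurable_cong]: "sets M = sets borel" and space_M [simp]: "space M = UNIV"
  using sets.sigma_sets_eq[of "borel :: 'g measure"] by (auto simp: M_def)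

lemma continuous_measurable_M: "continuous_on UNIV f \<Longrightarrow> f \<in> borel_measurable M"
  using borel_measurable_continuous_onI[of f] by (simp add: measurable_cong_sets[OF sets_M refl])

lemma emeasure_M: "A \<in> sets borel \<Longrightarrow> emeasure M A = mu A"
proof -
  let ?L = "lambda_system UNIV (Pow UNIV) mu"
  have L: "measure_space UNIV ?L mu"
    by (rule sigma_algebra.caratheodory_lemma[OF sigma_algebra_Pow outer_measure_space_mu])
  have "sigma_algebra UNIV ?L" using L by (simp add: measure_space_def)
  then have sub: "sets (borel :: 'g measure) \<subseteq> ?L"
    using sigma_algebra.sigma_sets_subset[of UNIV ?L "Collect open"] open_lambda_system
    by (auto simp: borel_def)
  have "positive (sets borel) mu" "countably_additive (sets borel) mu"
    using L sub unfolding measure_space_def positive_def countably_additive_def by blast+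
  then show "A \<in> sets borel \<Longrightarrow> emeasure M A = mu A"
    by (intro emeasure_measure_of[OF M_def]) auto
qed

lemma finite_measure_M: "finite_measure M"
  by (rule finite_measureI) (use mu_less_top[of UNIV] in \<open>auto simp: emeasure_M\<close>)

lemma measure_M_UNIV: "measure M UNIV = P (\<lambda>x. 1)"
  using P_pos[of "\<lambda>x. 1"] by (simp add: measure_def emeasure_M mu_open rho_UNIV)

text \<open>Slice \<open>f\<close> into \<open>n\<close> horizontal layers. Layer \<open>k\<close>
  lies between 1/n times the indicators of f > (k+1)/n and f > k/n. The upper indicator bounds
  \<open>P\<close> of the layer through \<open>rho\<close>, the lower one bounds its integral, and
  the two sums differ by O(1/n).\<close>

lemma P_le_integral_unit:
  assumes f: "continuous_on UNIV f" "\<And>x. 0 \<le> f x" "\<And>x. f x \<le> 1"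
  shows "P f \<le> (\<integral>x. f x \<partial>M)"
proof -
  interpret finite_measure M by (rule finite_measure_M)
  have int: "integrable M h" if "continuous_on UNIV h" "\<And>x. \<bar>h x\<bar> \<le> B" for h :: "'g \<Rightarrow> real" and B
    using that by (intro integrable_const_bound[of _ B]) (auto intro: continuous_measurable_M)
  have bound: "P f \<le> (\<integral>x. f x \<partial>M) + measure M UNIV / n" if n: "n > 0" for n :: nat
  proof -
    define g where "g k x = min (f x) (real k / n)" for k x
    define a where "a k = measure M {x. real k / n < f x}" for k :: nat
    have cg: "continuous_on UNIV (g k)" for k unfolding g_def by (intro continuous_intros f)
    have cd: "continuous_on UNIV (\<lambda>x. g (Suc k) x - g k x)" for k by (intro continuous_intros cg)
    have sum: "f x = (\<Sum>k<n. g (Suc k) x - g k x)" for x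
      unfolding sum_lessThan_telescope[of "\<lambda>k. g k x"] using n f(2,3)[of x] by (simp add: g_def)
    have op: "open {x. real k / n < f x}" for k :: nat using f by (intro open_Collect_less) auto
    have step: "real (Suc k) / n = real k / n + 1 / n" for k :: nat by (simp add: add_divide_distrib)
    have nn: "0 \<le> 1 / real n" by simp
    have mono_step: "real k / n \<le> real (Suc k) / n" for k by (intro divide_right_mono) auto
    have "P (\<lambda>x. g (Suc k) x - g k x) \<le> a k / n" for k
    proof -
      have "(\<lambda>x. real n * (g (Suc k) x - g k x)) \<in> below {x. real k / n < f x}"
        unfolding below_def
      proof (intro CollectI conjI allI impI)
        show "continuous_on UNIV (\<lambda>x. real n * (g (Suc k) x - g k x))" by (intro continuous_intros cg)
        fix x
        show "0 \<le> real n * (g (Suc k) x - g k x)"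
          using min.mono[OF order_refl mono_step, of "f x" k] by (simp add: g_def)
        have "g (Suc k) x - g k x \<le> 1 / n" unfolding g_def step using nn by linarith
        then show "real n * (g (Suc k) x - g k x) \<le> 1" using n by (simp add: field_simps)
        show "real n * (g (Suc k) x - g k x) = 0" if "x \<notin> {x. real k / n < f x}"
        proof -
          have "f x \<le> real k / n" "real k / n \<le> real (Suc k) / n" using that mono_step by auto
          then show ?thesis by (simp add: g_def min_def del: of_nat_Suc)
        qed
      qed
      from le_rho[OF this] P_below_nonneg[OF this]
      have "P (\<lambda>x. real n * (g (Suc k) x - g k x)) \<le> a k"
        using op[of k] by (simp add: mu_open[symmetric] emeasure_M[symmetric] emeasure_eq_measure a_def)
      then show ?thesis using P_scale[OF cd, of "real n" k] n by (simp add: field_simps)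
    qed
    then have "(\<Sum>k<n. P (\<lambda>x. g (Suc k) x - g k x)) \<le> (\<Sum>k<n. a k / n)" by (intro sum_mono)
    moreover have "P f = P (\<lambda>x. \<Sum>k<n. g (Suc k) x - g k x)" by (intro arg_cong[of _ _ P] ext sum)
    ultimately have "P f \<le> (\<Sum>k<n. a k / n)"
      using P_sum[of "{..<n}" "\<lambda>k x. g (Suc k) x - g k x"] cd by simp
    moreover have "(\<Sum>k<n. a (Suc k) / n) \<le> (\<integral>x. f x \<partial>M)"
    proof -
      have intd: "integrable M (\<lambda>x. g (Suc k) x - g k x)" for k
      proof (rule int[OF cd, of _ 1])
        fix x
        have "0 \<le> g k x" "g k x \<le> 1" for k using f(2,3)[of x] by (auto simp: g_def)
        then show "\<bar>g (Suc k) x - g k x\<bar> \<le> 1" by (smt (verit))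
      qed
      have "a (Suc k) / n \<le> (\<integral>x. g (Suc k) x - g k x \<partial>M)" for k
      proof -
        have [measurable]: "{x. real (Suc k) / n < f x} \<in> sets borel" using op[of "Suc k"] by simp
        have "(\<integral>x. indicator {x. real (Suc k) / n < f x} x / n \<partial>M) \<le> (\<integral>x. g (Suc k) x - g k x \<partial>M)"
        proof (rule integral_mono[OF _ intd])
          show "integrable M (\<lambda>x. indicator {x. real (Suc k) / real n < f x} x / real n)"
            using op[of "Suc k"]
            by (intro integrable_divide_zero integrable_real_indicator) (auto simp: less_top[symmetric])
          show "indicator {x. real (Suc k) / real n < f x} x / real n \<le> g (Suc k) x - g k x" for x
          proof (cases "real (Suc k) / n < f x")
            case True
            then have "g (Suc k) x = real (Suc k) / n" "g k x = real k / n"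
              using mono_step[of k] by (auto simp: g_def simp del: of_nat_Suc)
            moreover have "indicator {x. real (Suc k) / real n < f x} x / real n = 1 / n"
              using True by simp
            ultimately show ?thesis using step[of k] by linarith
          next
            case False
            then show ?thesis
              using min.mono[OF order_refl mono_step, of "f x" k] by (simp add: g_def del: of_nat_Suc)
          qed
        qed
        then show ?thesis by (simp add: a_def)
      qed
      then have "(\<Sum>k<n. a (Suc k) / n) \<le> (\<Sum>k<n. \<integral>x. g (Suc k) x - g k x \<partial>M)" by (intro sum_mono)
      also have "\<dots> = (\<integral>x. (\<Sum>k<n. g (Suc k) x - g k x) \<partial>M)"
        by (rule Bochner_Integration.integral_sum[symmetric]) (rule intd)
      finally show ?thesis by (simp only: sum[symmetric])
    qed
    \<comment> \<open>The upper and the lower layer sum differ by a shift of the index, so only the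
      two end terms survive.\<close>
    moreover have "(\<Sum>k<n. a k / n) = (\<Sum>k<n. a (Suc k) / n) + (a 0 - a n) / n"
    proof -
      have "(\<Sum>k<n. a k) = (\<Sum>k<n. a (Suc k)) + (a 0 - a n)"
        using sum_lessThan_telescope'[of a n] by (simp add: sum_subtractf)
      then have "(\<Sum>k<n. a k) / n = (\<Sum>k<n. a (Suc k)) / n + (a 0 - a n) / n"
        by (simp only: add_divide_distrib)
      then show ?thesis by (simp only: sum_divide_distrib)
    qed
    moreover have "(a 0 - a n) / n \<le> measure M UNIV / n"
    proof (rule divide_right_mono)
      have "a 0 \<le> measure M UNIV" using bounded_measure[of "{x. real 0 / n < f x}"] by (simp add: a_def)
      moreover have "0 \<le> a n" by (simp add: a_def)
      ultimately show "a 0 - a n \<le> measure M UNIV" by simp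
    qed simp
    ultimately show ?thesis by linarith
  qed
  have "(\<lambda>n. (\<integral>x. f x \<partial>M) + measure M UNIV / real (Suc n)) \<longlonglongrightarrow> (\<integral>x. f x \<partial>M) + 0"
    by (intro tendsto_intros LIMSEQ_Suc[OF lim_const_over_n])
  then show ?thesis
    by (intro LIMSEQ_le_const) (auto intro!: exI[of _ 0] bound simp del: of_nat_Suc)
qed

text \<open>The one-sided inequality for \<open>g\<close> and for \<open>1 - g\<close> gives
  equality, because \<open>P\<close> and the integral agree on the constant 1.\<close>

lemma integral_M:
  assumes f: "continuous_on UNIV f" shows "(\<integral>x. f x \<partial>M) = P f"
proof -
  interpret finite_measure M by (rule finite_measure_M)
  have "bounded (range f)" using compact_continuous_image[OF f cpt] by (rule compact_imp_bounded)
  then obtain B where B: "B > 0" "\<And>x. \<bar>f x\<bar> \<le> B" by (auto simp: bounded_pos)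
  \<comment> \<open>An affine image of \<open>f\<close> with values in [0, 1].\<close>
  define g where "g x = 1/2 + (1/(2*B)) * f x" for x
  have g: "continuous_on UNIV g" "0 \<le> g x" "g x \<le> 1" for x
    using f B(1) B(2)[of x] by (auto simp: g_def abs_le_iff field_simps intro!: continuous_intros)
  have int: "integrable M g"
    using g by (intro integrable_const_bound[of _ 1]) (auto intro: continuous_measurable_M)
  have "P (\<lambda>x. 1 - g x) \<le> (\<integral>x. 1 - g x \<partial>M)"
    using g by (intro P_le_integral_unit continuous_intros) auto
  then have "P (\<lambda>x. 1) - P g \<le> P (\<lambda>x. 1) - (\<integral>x. g x \<partial>M)"
    using P_diff[of "\<lambda>x. 1" g] g(1) int measure_M_UNIV by simp
  moreover have "P g \<le> (\<integral>x. g x \<partial>M)" using g by (intro P_le_integral_unit) auto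
  ultimately have eq: "(\<integral>x. g x \<partial>M) = P g" by simp
  have "f x = 2 * B * g x - B * 1" for x using B by (simp add: g_def field_simps)
  then have f_eq: "f = (\<lambda>x. 2 * B * g x - B * 1)" by auto
  have "P f = 2 * B * P g - B * P (\<lambda>x. 1)"
    unfolding f_eq using g(1) P_diff[of "\<lambda>x. 2 * B * g x" "\<lambda>x. B * 1"] P_scale[of g "2 * B"] P_scale[of "\<lambda>x. 1" B]
    by (simp add: continuous_intros)
  moreover have "(\<integral>x. f x \<partial>M) = 2 * B * (\<integral>x. g x \<partial>M) - B * P (\<lambda>x. 1)"
    unfolding f_eq using int measure_M_UNIV by simp
  ultimately show ?thesis using eq by simp
qed

lemma radon_M: "radon M"
  unfolding radon_def
proof (intro conjI ballI)
  interpret finite_measure M by (rule finite_measure_M)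
  show "finite_measure M" by (rule finite_measure_M)
  show "sets M = sets borel" by simp
  fix A :: "'g set" assume A: "A \<in> sets borel"
  show "emeasure M A = (INF U\<in>{U. open U \<and> A \<subseteq> U}. emeasure M U)"
    using A by (simp add: emeasure_M mu_open) (simp add: mu_def)
  show "emeasure M A = (SUP K\<in>{K. compact K \<and> K \<subseteq> A}. emeasure M K)"
  proof (rule antisym)
    show "(SUP K\<in>{K. compact K \<and> K \<subseteq> A}. emeasure M K) \<le> emeasure M A"
      using A by (intro SUP_least emeasure_mono) auto
    show "emeasure M A \<le> (SUP K\<in>{K. compact K \<and> K \<subseteq> A}. emeasure M K)"
    proof (rule ennreal_le_epsilon)
      fix e :: real assume e: "0 < e"
      \<comment> \<open>Inner regularity at \<open>A\<close> is outer regularity at its complement: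
        the complement of \<open>U\<close> is a compact subset of \<open>A\<close>, and it misses
        only \<open>A \<inter> U\<close>, of measure at most \<open>e\<close>.\<close>
      obtain U where U: "open U" "- A \<subseteq> U" "rho U < mu (- A) + ennreal e" using mu_approx[OF e] by blast
      have "compact (- U)" using cpt U(1) compact_Int_closed[of UNIV "- U"] by (simp add: closed_Compl)
      then have K: "compact (- U)" "- U \<subseteq> A" "- U \<in> sets borel" using U by auto
      have "emeasure M A = emeasure M (- U) + emeasure M (A \<inter> U)"
        using A U K by (subst plus_emeasure) (auto intro!: arg_cong[of _ _ "emeasure M"])
      also have "emeasure M (A \<inter> U) \<le> ennreal e"
      proof -
        have "mu U = emeasure M (- A) + emeasure M (A \<inter> U)"
          using A U by (subst plus_emeasure) (auto simp: emeasure_M intro!: arg_cong[of _ _ mu])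
        then have "emeasure M (- A) + emeasure M (A \<inter> U) \<le> emeasure M (- A) + ennreal e"
          using U A by (simp add: mu_open emeasure_M less_imp_le)
        then show ?thesis by (simp add: ennreal_add_left_cancel_le emeasure_finite)
      qed
      also have "emeasure M (- U) \<le> (SUP K\<in>{K. compact K \<and> K \<subseteq> A}. emeasure M K)"
        using K by (intro SUP_upper) auto
      finally show "emeasure M A \<le> (SUP K\<in>{K. compact K \<and> K \<subseteq> A}. emeasure M K) + ennreal e"
        by (simp add: add_mono)
    qed
  qed
qed

end

theorem riesz_markov:
  fixes P :: "('g::t2_space \<Rightarrow> real) \<Rightarrow> real"
  assumes "compact (UNIV :: 'g set)"
    and "\<And>f g. continuous_on UNIV f \<Longrightarrow> continuous_on UNIV g \<Longrightarrow> P (\<lambda>x. f x + g x) = P f + P g"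
    and "\<And>c f. continuous_on UNIV f \<Longrightarrow> P (\<lambda>x. c * f x) = c * P f"
    and "\<And>f. continuous_on UNIV f \<Longrightarrow> (\<And>x. 0 \<le> f x) \<Longrightarrow> 0 \<le> P f"
  obtains M where "radon M" "\<And>f. continuous_on UNIV f \<Longrightarrow> (\<integral>x. f x \<partial>M) = P f"
proof -
  interpret positive_functional P by (rule positive_functional.intro[OF assms])
  show ?thesis using that radon_M integral_M by blast
qed

section \<open>Complex measures as functionals\<close>

lemma bcontfun_compact_eq:
  assumes "compact (UNIV :: 'g::topological_space set)"
  shows "f \<in> bcontfun \<longleftrightarrow> continuous_on (UNIV :: 'g set) f"
  using compact_imp_bounded[OF compact_continuous_image[OF _ assms]] by (auto simp: bcontfun_iff)

lemma radon_jordan_decomposition: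
  fixes u :: "('g::t2_space \<Rightarrow> real) \<Rightarrow> real"
  assumes cpt: "compact (UNIV :: 'g set)"
    and add: "\<And>f g. continuous_on UNIV f \<Longrightarrow> continuous_on UNIV g \<Longrightarrow> u (\<lambda>x. f x + g x) = u f + u g"
    and scale: "\<And>c f. continuous_on UNIV f \<Longrightarrow> u (\<lambda>x. c * f x) = c * u f"
    and bound: "\<And>f b. continuous_on UNIV f \<Longrightarrow> (\<And>x. \<bar>f x\<bar> \<le> b) \<Longrightarrow> u f \<le> C * b"
    and C: "0 \<le> C"
  obtains M N where "radon M" "radon N"
    "\<And>f. continuous_on UNIV f \<Longrightarrow> u f = (\<integral>x. f x \<partial>M) - (\<integral>x. f x \<partial>N)"
proof -
  \<comment> \<open>Extending \<open>(f, -f) \<mapsto> u f\<close> to pairs, dominated by the sup of positive parts,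
    yields a pair of positive functionals.\<close>
  define q where "q X = max 0 (max (SUP x. apply_bcontfun (fst X) x) (SUP x. apply_bcontfun (snd X) x))"
    for X :: "('g \<Rightarrow>\<^sub>C real) \<times> ('g \<Rightarrow>\<^sub>C real)"
  have sup_le: "(SUP x. apply_bcontfun F x) \<le> b \<longleftrightarrow> (\<forall>x. apply_bcontfun F x \<le> b)" for F :: "'g \<Rightarrow>\<^sub>C real" and b
  proof -
    have "bdd_above (range (apply_bcontfun F))"
      using bounded_imp_bdd_above[of "range (apply_bcontfun F)"] apply_bcontfun[of F] by (auto simp: bcontfun_iff)
    then show ?thesis by (subst cSUP_le_iff) auto
  qed
  have q_le: "q X \<le> b \<longleftrightarrow> 0 \<le> b \<and> (\<forall>x. apply_bcontfun (fst X) x \<le> b \<and> apply_bcontfun (snd X) x \<le> b)" for X b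
    by (auto simp: q_def sup_le)
  have qD: "0 \<le> q X" "apply_bcontfun (fst X) x \<le> q X" "apply_bcontfun (snd X) x \<le> q X" for X x
    using q_le[of X "q X"] by auto
  have q_scale_le: "q (t *\<^sub>R X) \<le> t * q X" if "0 \<le> t" for t X
    unfolding q_le using that by (auto intro!: mult_left_mono mult_nonneg_nonneg qD)
  have sl: "sublinear (\<lambda>X. C * q X)"
    unfolding sublinear_def
  proof (intro conjI allI impI)
    fix X Y
    have "q (X + Y) \<le> q X + q Y" unfolding q_le by (auto intro!: add_mono add_nonneg_nonneg qD)
    then show "C * q (X + Y) \<le> C * q X + C * q Y" using C by (simp add: distrib_left[symmetric] mult_left_mono)
  next
    fix t :: real and X assume t: "0 \<le> t"
    have "q (t *\<^sub>R X) = t * q X"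
    proof (cases "t = 0")
      case True
      then show ?thesis using q_scale_le[of 0 X] qD(1)[of "0 *\<^sub>R X"] by simp
    next
      case False
      then have "q ((1/t) *\<^sub>R (t *\<^sub>R X)) \<le> (1/t) * q (t *\<^sub>R X)" using t by (intro q_scale_le) auto
      then have "t * q X \<le> q (t *\<^sub>R X)" using False t by (simp add: field_simps)
      then show ?thesis using q_scale_le[OF t, of X] by simp
    qed
    then show "C * q (t *\<^sub>R X) = t * (C * q X)" by simp
  qed
  have ss: "subspace (range (\<lambda>F :: 'g \<Rightarrow>\<^sub>C real. (F, - F)))"
    by (intro linear_subspace_image subspace_UNIV linearI) auto
  have au: "u (fst (X + Y)) = u (fst X) + u (fst Y)" for X Y :: "('g \<Rightarrow>\<^sub>C real) \<times> ('g \<Rightarrow>\<^sub>C real)"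
    using add by (simp add: plus_bcontfun.rep_eq)
  have su: "u (fst (t *\<^sub>R X)) = t * u (fst X)" for t and X :: "('g \<Rightarrow>\<^sub>C real) \<times> ('g \<Rightarrow>\<^sub>C real)"
    using scale by (simp add: scaleR_bcontfun.rep_eq)
  \<comment> \<open>At \<open>(F, - F)\<close> the value of \<open>q\<close> dominates both
    \<open>F\<close> and \<open>- F\<close>, hence the modulus of \<open>F\<close>, so
    \<open>bound\<close> becomes domination by \<open>C * q\<close>.\<close>
  have lu: "u (fst X) \<le> C * q X" if X: "X \<in> range (\<lambda>F :: 'g \<Rightarrow>\<^sub>C real. (F, - F))" for X
  proof (rule bound)
    obtain F where "X = (F, - F)" using X by blast
    then show "\<bar>apply_bcontfun (fst X) x\<bar> \<le> q X" for x using qD(2,3)[of X x] by (auto simp: abs_le_iff)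
  qed simp
  obtain w where w: "linear w" "\<And>X. w X \<le> C * q X"
    "\<And>X. X \<in> range (\<lambda>F. (F, - F)) \<Longrightarrow> w X = u (apply_bcontfun (fst X))"
    using hahn_banach[OF sl ss, of "\<lambda>X. u (apply_bcontfun (fst X))", OF au su lu] by metis
  have bc: "apply_bcontfun (Bcontfun f) = f" if "continuous_on UNIV f" for f :: "'g \<Rightarrow> real"
    using that by (simp add: Bcontfun_inverse bcontfun_compact_eq[OF cpt])
  \<comment> \<open>Since \<open>C * q\<close> is at most 0 at pairs of nonpositive functions, so is
    \<open>w\<close>; hence each component of \<open>w\<close> is a positive functional.\<close>
  have rep: "\<exists>M. radon M \<and> (\<forall>f. continuous_on UNIV f \<longrightarrow> (\<integral>x. f x \<partial>M) = w (j (Bcontfun f)))"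
    if j: "linear j" and neg: "\<And>F. (\<And>x. apply_bcontfun F x \<le> 0) \<Longrightarrow> q (j F) \<le> 0" for j :: "('g \<Rightarrow>\<^sub>C real) \<Rightarrow> _"
  proof -
    note lin = linear_compose[OF j w(1), unfolded o_def]
    obtain M where "radon M" "\<And>f. continuous_on UNIV f \<Longrightarrow> (\<integral>x. f x \<partial>M) = w (j (Bcontfun f))"
    proof (rule riesz_markov[OF cpt, of "\<lambda>f. w (j (Bcontfun f))"])
      fix f g :: "'g \<Rightarrow> real" assume f: "continuous_on UNIV f" and g: "continuous_on UNIV g"
      have "Bcontfun (\<lambda>x. f x + g x) = Bcontfun f + Bcontfun g"
        using f g by (intro bcontfun_eqI) (simp add: bc continuous_on_add)
      then show "w (j (Bcontfun (\<lambda>x. f x + g x))) = w (j (Bcontfun f)) + w (j (Bcontfun g))"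
        by (simp add: linear_add[OF lin])
    next
      fix c and f :: "'g \<Rightarrow> real" assume f: "continuous_on UNIV f"
      have "Bcontfun (\<lambda>x. c * f x) = c *\<^sub>R Bcontfun f"
        using f by (intro bcontfun_eqI) (simp add: bc continuous_on_mult_left)
      then show "w (j (Bcontfun (\<lambda>x. c * f x))) = c * w (j (Bcontfun f))"
        by (simp add: linear_scale[OF lin])
    next
      fix f :: "'g \<Rightarrow> real" assume f: "continuous_on UNIV f" "\<And>x. 0 \<le> f x"
      have "w (j (- Bcontfun f)) \<le> C * q (j (- Bcontfun f))" by (rule w(2))
      also have "\<dots> \<le> C * 0" using f C by (intro mult_left_mono neg) (auto simp: bc)
      finally show "0 \<le> w (j (Bcontfun f))" by (simp add: linear_neg[OF lin])
    next
      fix M assume "radon M" "\<And>f. continuous_on UNIV f \<Longrightarrow> (\<integral>x. f x \<partial>M) = w (j (Bcontfun f))"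
      then show thesis by (rule that)
    qed
    then show ?thesis by blast
  qed
  have "linear (\<lambda>F :: 'g \<Rightarrow>\<^sub>C real. (F, 0 :: 'g \<Rightarrow>\<^sub>C real))" "linear (\<lambda>F :: 'g \<Rightarrow>\<^sub>C real. (0 :: 'g \<Rightarrow>\<^sub>C real, F))"
    by (auto intro!: linearI)
  then obtain M N where MN: "radon M" "radon N"
    "\<And>f. continuous_on UNIV f \<Longrightarrow> (\<integral>x. f x \<partial>M) = w (Bcontfun f, 0)"
    "\<And>f. continuous_on UNIV f \<Longrightarrow> (\<integral>x. f x \<partial>N) = w (0, Bcontfun f)"
    using rep[of "\<lambda>F. (F, 0)"] rep[of "\<lambda>F. (0, F)"] by (auto simp: q_le)
  have "u f = (\<integral>x. f x \<partial>M) - (\<integral>x. f x \<partial>N)" if f: "continuous_on UNIV f" for f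
  proof -
    have "u f = w (Bcontfun f, - Bcontfun f)" using w(3)[of "(Bcontfun f, - Bcontfun f)"] bc[OF f] by simp
    also have "(Bcontfun f, - Bcontfun f) = (Bcontfun f, 0) - (0, Bcontfun f)" by simp
    finally show ?thesis using MN f by (simp only: linear_diff[OF w(1)])
  qed
  then show ?thesis using that MN by blast
qed

lemma radonD: "radon M \<Longrightarrow> sets M = sets borel" "radon M \<Longrightarrow> finite_measure M" "radon M \<Longrightarrow> space M = UNIV"
  using sets_eq_imp_space_eq[of M borel] by (auto simp: radon_def)

lemma radon_integrable:
  fixes f :: "'g::topological_space \<Rightarrow> 'b::{banach, second_countable_topology}"
  assumes "compact (UNIV :: 'g set)" "radon M" "continuous_on UNIV f"
  shows "integrable M f"
proof -
  interpret finite_measure M by (rule radonD[OF assms(2)])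
  obtain B where "\<And>x. norm (f x) \<le> B"
    using compact_imp_bounded[OF compact_continuous_image[OF assms(3,1)]] by (auto simp: bounded_iff)
  moreover have "f \<in> borel_measurable M"
    using borel_measurable_continuous_onI[OF assms(3)] by (simp add: measurable_cong_sets[OF radonD(1)[OF assms(2)] refl])
  ultimately show ?thesis by (intro integrable_const_bound[of _ B]) auto
qed

lemma cm_int_linear:
  fixes f g :: "'g::topological_space \<Rightarrow> complex"
  assumes "compact (UNIV :: 'g set)" "is_cmeasure \<mu>"
  shows "continuous_on UNIV f \<Longrightarrow> continuous_on UNIV g \<Longrightarrow> cm_int \<mu> (\<lambda>x. f x + g x) = cm_int \<mu> f + cm_int \<mu> g"
    and "cm_int \<mu> (\<lambda>x. c * f x) = c * cm_int \<mu> f"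
  using assms(2) by (auto simp: cm_int_def is_cmeasure_def radon_integrable[OF assms(1)] algebra_simps split: prod.splits)

text \<open>The real and the imaginary part of \<open>\<Phi>\<close> on real functions are each a
  difference of two positive measures, which gives the four components; complex linearity carries
  the formula to complex functions.\<close>

theorem cmeasure_representation:
  fixes \<Phi> :: "('g::t2_space \<Rightarrow> complex) \<Rightarrow> complex"
  assumes cpt: "compact (UNIV :: 'g set)" and \<Phi>: "\<Phi> \<in> dual_sp bcontfun"
  obtains \<mu> where "is_cmeasure \<mu>" "\<And>f. continuous_on UNIV f \<Longrightarrow> \<Phi> f = cm_int \<mu> f"
proof -
  note bc = bcontfun_compact_eq[OF cpt]
  let ?C = "dnorm bcontfun \<Phi>"
  note C = dnorm_nonneg[OF csubspace_fun_bcontfun subset_refl \<Phi>]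
  have cr: "continuous_on UNIV (\<lambda>x. complex_of_real (f x))" if "continuous_on UNIV f" for f :: "'g \<Rightarrow> real"
    using that by (intro continuous_intros)
  have add: "\<Phi> (\<lambda>x. complex_of_real (f x + g x)) = \<Phi> (\<lambda>x. of_real (f x)) + \<Phi> (\<lambda>x. of_real (g x))"
    if "continuous_on UNIV f" "continuous_on UNIV g" for f g
    using dual_spD(1)[OF \<Phi>, of "\<lambda>x. of_real (f x)" "\<lambda>x. of_real (g x)"] that cr by (simp add: bc)
  have scale: "\<Phi> (\<lambda>x. complex_of_real (c * f x)) = of_real c * \<Phi> (\<lambda>x. of_real (f x))"
    if "continuous_on UNIV f" for c f
    using dual_spD(2)[OF \<Phi>, of "\<lambda>x. of_real (f x)" "of_real c"] that cr by (simp add: bc)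
  have bound: "norm (\<Phi> (\<lambda>x. complex_of_real (f x))) \<le> ?C * b" if "continuous_on UNIV f" "\<And>x. \<bar>f x\<bar> \<le> b" for f b
  proof -
    have "norm (\<Phi> (\<lambda>x. complex_of_real (f x))) \<le> ?C * supn (\<lambda>x. complex_of_real (f x))"
      using that cr by (intro norm_le_dnorm[OF csubspace_fun_bcontfun subset_refl \<Phi>]) (simp add: bc)
    also have "\<dots> \<le> ?C * b" using that(2) by (intro mult_left_mono C supn_le) simp
    finally show ?thesis .
  qed
  obtain m1 m2 where m12: "radon m1" "radon m2"
    "\<And>f. continuous_on UNIV f \<Longrightarrow> Re (\<Phi> (\<lambda>x. of_real (f x))) = (\<integral>x. f x \<partial>m1) - (\<integral>x. f x \<partial>m2)"
    by (rule radon_jordan_decomposition[OF cpt, of "\<lambda>f. Re (\<Phi> (\<lambda>x. of_real (f x)))" ?C])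
      (auto simp del: of_real_add of_real_mult simp: add scale C intro!: order_trans[OF complex_Re_le_cmod bound])
  obtain m3 m4 where m34: "radon m3" "radon m4"
    "\<And>f. continuous_on UNIV f \<Longrightarrow> Im (\<Phi> (\<lambda>x. of_real (f x))) = (\<integral>x. f x \<partial>m3) - (\<integral>x. f x \<partial>m4)"
    by (rule radon_jordan_decomposition[OF cpt, of "\<lambda>f. Im (\<Phi> (\<lambda>x. of_real (f x)))" ?C])
      (auto simp del: of_real_add of_real_mult simp: add scale C intro!: order_trans[OF order_trans[OF abs_ge_self abs_Im_le_cmod] bound])
  define \<mu> where "\<mu> = (m1, m2, m3, m4)"
  have \<mu>: "is_cmeasure \<mu>" using m12 m34 by (simp add: \<mu>_def is_cmeasure_def)
  have real: "\<Phi> (\<lambda>x. of_real (f x)) = cm_int \<mu> (\<lambda>x. of_real (f x))" if "continuous_on UNIV f" for f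
    using m12(3)[OF that] m34(3)[OF that] by (simp add: \<mu>_def cm_int_def complex_eq_iff)
  have "\<Phi> f = cm_int \<mu> f" if f: "continuous_on UNIV f" for f
  proof -
    have c: "continuous_on UNIV (\<lambda>x. Re (f x))" "continuous_on UNIV (\<lambda>x. Im (f x))"
      using f by (auto intro: continuous_intros)
    note c' = cr[OF c(1)] cr[OF c(2)]
    have ci: "continuous_on UNIV (\<lambda>x. \<i> * complex_of_real (Im (f x)))" by (intro continuous_intros c)
    have eq: "f = (\<lambda>x. complex_of_real (Re (f x)) + \<i> * complex_of_real (Im (f x)))"
      by (simp add: complex_eq fun_eq_iff)
    have "\<Phi> f = \<Phi> (\<lambda>x. of_real (Re (f x))) + \<i> * \<Phi> (\<lambda>x. of_real (Im (f x)))"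
      using dual_spD(1)[OF \<Phi>, of "\<lambda>x. of_real (Re (f x))" "\<lambda>x. \<i> * of_real (Im (f x))"]
        dual_spD(2)[OF \<Phi>, of "\<lambda>x. of_real (Im (f x))" \<i>] c' ci eq by (simp add: bc)
    also have "\<dots> = cm_int \<mu> (\<lambda>x. of_real (Re (f x))) + \<i> * cm_int \<mu> (\<lambda>x. of_real (Im (f x)))"
      using real c by simp
    also have "\<dots> = cm_int \<mu> f"
      using cm_int_linear(1)[OF cpt \<mu> c'(1) ci] cm_int_linear(2)[OF cpt \<mu>, of \<i> "\<lambda>x. of_real (Im (f x))"] eq by simp
    finally show ?thesis .
  qed
  then show ?thesis using that \<mu> by blast
qed

section \<open>Atoms of functionals\<close>

definition bump :: "'g::topological_space \<Rightarrow> 'g set \<Rightarrow> ('g \<Rightarrow> real) set" where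
  "bump h V = {u. continuous_on UNIV u \<and> (\<forall>x. 0 \<le> u x \<and> u x \<le> 1) \<and> u h = 1 \<and> (\<forall>x. x \<notin> V \<longrightarrow> u x = 0)}"

lemma bumpD:
  assumes "u \<in> bump h V"
  shows "continuous_on UNIV u" "0 \<le> u x" "u x \<le> 1" "u h = 1" "x \<notin> V \<Longrightarrow> u x = 0"
  using assms by (auto simp: bump_def)

lemma bump_mono: "V \<subseteq> W \<Longrightarrow> bump h V \<subseteq> bump h W"
  by (auto simp: bump_def)

lemma bump_nonempty:
  fixes h :: "'g::t2_space"
  assumes "compact (UNIV :: 'g set)" "open V" "h \<in> V"
  shows "bump h V \<noteq> {}"
proof -
  obtain u where "continuous_on UNIV u" "\<And>x. 0 \<le> u x" "\<And>x. u x \<le> (1::real)"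
    "\<And>x. x \<in> {h} \<Longrightarrow> u x = 1" "\<And>x. x \<in> - V \<Longrightarrow> u x = 0"
    using urysohn_compact_t2[OF assms(1), of "{h}" "- V"] assms by auto
  then have "u \<in> bump h V" by (auto simp: bump_def)
  then show ?thesis by blast
qed

text \<open>The point mass at \<open>h\<close> of the measure representing \<open>\<Phi>\<close>, read off from \<open>\<Phi>\<close> alone.\<close>

definition has_atom :: "(('g::topological_space \<Rightarrow> complex) \<Rightarrow> complex) \<Rightarrow> 'g \<Rightarrow> complex \<Rightarrow> bool" where
  "has_atom \<Phi> h c \<longleftrightarrow> (\<forall>e>0. \<exists>V. open V \<and> h \<in> V \<and> (\<forall>u\<in>bump h V. norm (\<Phi> (\<lambda>x. of_real (u x)) - c) < e))"

text \<open>Outer regularity at \<open>{h}\<close> gives an open \<open>V\<close> of hardly larger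
  measure, and the integral of a bump in \<open>V\<close> is squeezed between the measures of
  \<open>{h}\<close> and \<open>V\<close>.\<close>

lemma radon_atom:
  fixes h :: "'g::t2_space"
  assumes "compact (UNIV :: 'g set)" "radon M" "e > 0"
  obtains V where "open V" "h \<in> V" "\<And>u. u \<in> bump h V \<Longrightarrow> \<bar>(\<integral>x. u x \<partial>M) - measure M {h}\<bar> < e"
proof -
  interpret finite_measure M by (rule radonD[OF assms(2)])
  note sets = radonD(1)[OF assms(2)]
  have "emeasure M {h} = (INF U\<in>{U. open U \<and> {h} \<subseteq> U}. emeasure M U)"
    using assms(2) by (auto simp: radon_def)
  from INF_approx_ennreal[OF assms(3) this] obtain V where V: "open V" "h \<in> V"
    "emeasure M V < emeasure M {h} + ennreal e" using emeasure_finite by auto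
  then have less: "measure M V < measure M {h} + e"
    using assms(3) by (simp add: emeasure_eq_measure ennreal_plus[symmetric] ennreal_less_iff del: ennreal_plus)
  have "\<bar>(\<integral>x. u x \<partial>M) - measure M {h}\<bar> < e" if u: "u \<in> bump h V" for u
  proof -
    have int: "integrable M u" by (rule radon_integrable[OF assms(1,2) bumpD(1)[OF u]])
    have "(\<integral>x. indicator {h} x \<partial>M) \<le> (\<integral>x. u x \<partial>M)"
      using bumpD[OF u] by (intro integral_mono int integrable_real_indicator)
        (auto simp: sets indicator_def less_top[symmetric] emeasure_finite)
    moreover have "(\<integral>x. u x \<partial>M) \<le> (\<integral>x. indicator V x \<partial>M)"
      using bumpD[OF u] V by (intro integral_mono int integrable_real_indicator)
        (auto simp: sets indicator_def less_top[symmetric] emeasure_finite)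
    ultimately show ?thesis using less radonD(3)[OF assms(2)] by simp
  qed
  then show ?thesis using that V by blast
qed

text \<open>Together with \<open>cmeasure_representation\<close> this provides an atom, possibly 0,
  at every point for every bounded functional on the continuous functions.\<close>

lemma has_atom_cmeasure:
  fixes h :: "'g::t2_space"
  assumes cpt: "compact (UNIV :: 'g set)" and \<mu>: "is_cmeasure \<mu>"
    and eq: "\<And>f. continuous_on UNIV f \<Longrightarrow> \<Phi> f = cm_int \<mu> f"
  shows "has_atom \<Phi> h (cm_val \<mu> {h})"
  unfolding has_atom_def
proof (intro allI impI)
  fix e :: real assume e: "0 < e"
  obtain m1 m2 m3 m4 where m: "\<mu> = (m1, m2, m3, m4)" by (cases \<mu>)
  then have r: "radon m1" "radon m2" "radon m3" "radon m4" using \<mu> by (auto simp: is_cmeasure_def)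
  have e4: "e / 4 > 0" using e by simp
  obtain V1 where V1: "open V1" "h \<in> V1" "\<And>u. u \<in> bump h V1 \<Longrightarrow> \<bar>(\<integral>x. u x \<partial>m1) - measure m1 {h}\<bar> < e/4"
    using radon_atom[OF cpt r(1) e4] by metis
  obtain V2 where V2: "open V2" "h \<in> V2" "\<And>u. u \<in> bump h V2 \<Longrightarrow> \<bar>(\<integral>x. u x \<partial>m2) - measure m2 {h}\<bar> < e/4"
    using radon_atom[OF cpt r(2) e4] by metis
  obtain V3 where V3: "open V3" "h \<in> V3" "\<And>u. u \<in> bump h V3 \<Longrightarrow> \<bar>(\<integral>x. u x \<partial>m3) - measure m3 {h}\<bar> < e/4"
    using radon_atom[OF cpt r(3) e4] by metis
  obtain V4 where V4: "open V4" "h \<in> V4" "\<And>u. u \<in> bump h V4 \<Longrightarrow> \<bar>(\<integral>x. u x \<partial>m4) - measure m4 {h}\<bar> < e/4"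
    using radon_atom[OF cpt r(4) e4] by metis
  let ?V = "V1 \<inter> V2 \<inter> V3 \<inter> V4"
  show "\<exists>V. open V \<and> h \<in> V \<and> (\<forall>u\<in>bump h V. norm (\<Phi> (\<lambda>x. of_real (u x)) - cm_val \<mu> {h}) < e)"
  proof (intro exI[of _ ?V] conjI ballI)
    show "open ?V" "h \<in> ?V" using V1 V2 V3 V4 by auto
    fix u assume u: "u \<in> bump h ?V"
    have u1: "u \<in> bump h V1" "u \<in> bump h V2" "u \<in> bump h V3" "u \<in> bump h V4"
      using u bump_mono[of ?V V1 h] bump_mono[of ?V V2 h] bump_mono[of ?V V3 h] bump_mono[of ?V V4 h] by auto
    have "continuous_on UNIV (\<lambda>x. complex_of_real (u x))" using bumpD(1)[OF u] by (intro continuous_intros)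
    then have "\<Phi> (\<lambda>x. of_real (u x)) - cm_val \<mu> {h} =
      Complex (((\<integral>x. u x \<partial>m1) - measure m1 {h}) - ((\<integral>x. u x \<partial>m2) - measure m2 {h}))
              (((\<integral>x. u x \<partial>m3) - measure m3 {h}) - ((\<integral>x. u x \<partial>m4) - measure m4 {h}))"
      by (simp add: eq m cm_int_def cm_val_def complex_eq_iff)
    then have "norm (\<Phi> (\<lambda>x. of_real (u x)) - cm_val \<mu> {h}) \<le>
      \<bar>((\<integral>x. u x \<partial>m1) - measure m1 {h}) - ((\<integral>x. u x \<partial>m2) - measure m2 {h})\<bar> +
      \<bar>((\<integral>x. u x \<partial>m3) - measure m3 {h}) - ((\<integral>x. u x \<partial>m4) - measure m4 {h})\<bar>"
      using cmod_le[of "\<Phi> (\<lambda>x. of_real (u x)) - cm_val \<mu> {h}"] by simp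
    then show "norm (\<Phi> (\<lambda>x. of_real (u x)) - cm_val \<mu> {h}) < e"
      using V1(3)[OF u1(1)] V2(3)[OF u1(2)] V3(3)[OF u1(3)] V4(3)[OF u1(4)] by linarith
  qed
qed

lemma has_atom_unique:
  fixes h :: "'g::t2_space"
  assumes cpt: "compact (UNIV :: 'g set)" and "has_atom \<Phi> h c" "has_atom \<Phi> h d"
  shows "c = d"
proof (rule ccontr)
  assume "c \<noteq> d"
  then have e: "norm (c - d) / 2 > 0" by simp
  obtain V where V: "open V" "h \<in> V" "\<And>u. u \<in> bump h V \<Longrightarrow> norm (\<Phi> (\<lambda>x. of_real (u x)) - c) < norm (c - d) / 2"
    using assms(2) e unfolding has_atom_def by metis
  obtain W where W: "open W" "h \<in> W" "\<And>u. u \<in> bump h W \<Longrightarrow> norm (\<Phi> (\<lambda>x. of_real (u x)) - d) < norm (c - d) / 2"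
    using assms(3) e unfolding has_atom_def by metis
  obtain u where "u \<in> bump h (V \<inter> W)" using bump_nonempty[OF cpt, of "V \<inter> W" h] V W by auto
  then have u: "u \<in> bump h V" "u \<in> bump h W" using bump_mono[of "V \<inter> W"] by auto
  have "norm (c - d) \<le> norm (\<Phi> (\<lambda>x. of_real (u x)) - d) + norm (\<Phi> (\<lambda>x. of_real (u x)) - c)"
    using norm_triangle_ineq4[of "\<Phi> (\<lambda>x. of_real (u x)) - d" "\<Phi> (\<lambda>x. of_real (u x)) - c"] by simp
  then show False using V(3)[OF u(1)] W(3)[OF u(2)] by simp
qed

lemma has_atom_add:
  assumes "has_atom \<Phi> h c" "has_atom \<Psi> h d"
  shows "has_atom (\<lambda>f. \<Phi> f + \<Psi> f) h (c + d)"
  unfolding has_atom_def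
proof (intro allI impI)
  fix e :: real assume "0 < e"
  then have e: "e / 2 > 0" by simp
  obtain V where V: "open V" "h \<in> V" "\<And>u. u \<in> bump h V \<Longrightarrow> norm (\<Phi> (\<lambda>x. of_real (u x)) - c) < e / 2"
    using assms(1) e unfolding has_atom_def by metis
  obtain W where W: "open W" "h \<in> W" "\<And>u. u \<in> bump h W \<Longrightarrow> norm (\<Psi> (\<lambda>x. of_real (u x)) - d) < e / 2"
    using assms(2) e unfolding has_atom_def by metis
  have "norm (\<Phi> (\<lambda>x. of_real (u x)) + \<Psi> (\<lambda>x. of_real (u x)) - (c + d)) < e" if "u \<in> bump h (V \<inter> W)" for u
  proof -
    have u: "u \<in> bump h V" "u \<in> bump h W" using that bump_mono[of "V \<inter> W"] by auto
    show ?thesis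
      using norm_diff_triangle_ineq[of "\<Phi> (\<lambda>x. of_real (u x))" "\<Psi> (\<lambda>x. of_real (u x))" c d] V(3)[OF u(1)] W(3)[OF u(2)]
      by simp
  qed
  then show "\<exists>V. open V \<and> h \<in> V \<and> (\<forall>u\<in>bump h V. norm (\<Phi> (\<lambda>x. of_real (u x)) + \<Psi> (\<lambda>x. of_real (u x)) - (c + d)) < e)"
    using V W by (intro exI[of _ "V \<inter> W"]) auto
qed

lemma has_atom_cmult:
  assumes "has_atom \<Phi> h c" shows "has_atom (\<lambda>f. a * \<Phi> f) h (a * c)"
  unfolding has_atom_def
proof (intro allI impI)
  fix e :: real assume e: "0 < e"
  have pos: "0 < norm a + 1" using norm_ge_zero[of a] by linarith
  have "e / (norm a + 1) > 0" using e pos by simp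
  then obtain V where V: "open V" "h \<in> V"
    "\<And>u. u \<in> bump h V \<Longrightarrow> norm (\<Phi> (\<lambda>x. of_real (u x)) - c) < e / (norm a + 1)"
    using assms unfolding has_atom_def by metis
  have "norm (a * \<Phi> (\<lambda>x. of_real (u x)) - a * c) < e" if "u \<in> bump h V" for u
  proof -
    have "norm (a * \<Phi> (\<lambda>x. of_real (u x)) - a * c) = norm a * norm (\<Phi> (\<lambda>x. of_real (u x)) - c)"
      by (simp add: norm_mult[symmetric] right_diff_distrib)
    also have "\<dots> \<le> norm a * (e / (norm a + 1))" using V(3)[OF that] by (intro mult_left_mono) auto
    also have "\<dots> < e" using e pos by (simp add: field_simps)
    finally show ?thesis .
  qed
  then show "\<exists>V. open V \<and> h \<in> V \<and> (\<forall>u\<in>bump h V. norm (a * \<Phi> (\<lambda>x. of_real (u x)) - a * c) < e)"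
    using V by blast
qed

lemma has_atom_pt_eval:
  fixes h :: "'g::t2_space"
  assumes "compact (UNIV :: 'g set)"
  shows "has_atom (pt_eval bcontfun h) h 1"
  unfolding has_atom_def
proof (intro allI impI exI[of _ UNIV] conjI ballI)
  fix e :: real and u assume "0 < e" and u: "u \<in> bump h UNIV"
  have "continuous_on UNIV (\<lambda>x. complex_of_real (u x))" using bumpD(1)[OF u] by (intro continuous_intros)
  then show "norm (pt_eval bcontfun h (\<lambda>x. of_real (u x)) - 1) < e"
    using \<open>0 < e\<close> bumpD(4)[OF u] by (simp add: pt_eval_def bcontfun_compact_eq[OF assms])
qed auto

lemma disjoint_neighbourhoods:
  fixes F :: "'g::t2_space set"
  assumes "finite F"
  obtains W where "\<And>t. t \<in> F \<Longrightarrow> open (W t)" "\<And>t. t \<in> F \<Longrightarrow> t \<in> W t"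
    "\<And>s t. s \<in> F \<Longrightarrow> t \<in> F \<Longrightarrow> s \<noteq> t \<Longrightarrow> W s \<inter> W t = {}"
proof -
  define Q where "Q s t = (SOME (A, B). open A \<and> open B \<and> s \<in> A \<and> t \<in> B \<and> A \<inter> B = {})" for s t :: 'g
  have Q: "case Q s t of (A, B) \<Rightarrow> open A \<and> open B \<and> s \<in> A \<and> t \<in> B \<and> A \<inter> B = {}" if "s \<noteq> t" for s t
    unfolding Q_def by (rule someI_ex) (use hausdorff[OF that] in auto)
  define A B where "A s t = fst (Q s t)" and "B s t = snd (Q s t)" for s t
  have AB: "open (A s t)" "open (B s t)" "s \<in> A s t" "t \<in> B s t" "A s t \<inter> B s t = {}" if "s \<noteq> t" for s t
    using Q[OF that] by (auto simp: A_def B_def split: prod.splits)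
  define W where "W t = (\<Inter>s\<in>F - {t}. A t s \<inter> B s t)" for t
  show ?thesis
  proof (rule that[of W])
    show "open (W t)" for t unfolding W_def using assms AB(1,2) by (intro open_INT open_Int ballI) auto
    show "t \<in> W t" for t unfolding W_def by (auto intro!: AB(3,4))
    show "W s \<inter> W t = {}" if "s \<in> F" "t \<in> F" "s \<noteq> t" for s t
    proof -
      have "W s \<subseteq> A s t" "W t \<subseteq> B s t" using that by (auto simp: W_def)
      then show ?thesis using AB(5)[OF that(3)] by blast
    qed
  qed
qed

lemma dual_sp_sum_arg:
  assumes "\<phi> \<in> dual_sp S" "csubspace_fun S" "finite I" "\<And>i. i \<in> I \<Longrightarrow> f i \<in> S"
  shows "(\<lambda>x. \<Sum>i\<in>I. f i x) \<in> S \<and> \<phi> (\<lambda>x. \<Sum>i\<in>I. f i x) = (\<Sum>i\<in>I. \<phi> (f i))"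
  using assms(3,4)
proof (induction I rule: finite_induct)
  case empty
  then show ?case using csubspace_funD(1)[OF assms(2)] dual_spD(2)[OF assms(1), of "\<lambda>x. 0" 0] by simp
next
  case (insert i I)
  then show ?case
    using csubspace_funD(2)[OF assms(2), of "f i" "\<lambda>x. \<Sum>i\<in>I. f i x"]
      dual_spD(1)[OF assms(1), of "f i" "\<lambda>x. \<Sum>i\<in>I. f i x"] by simp
qed

text \<open>Splitting off finitely many atoms is \<open>\<ell>\<^sub>1\<close>-additive: test \<open>\<Phi>\<close> against
  \<open>c\<^sub>0 f (1 - \<Sum> u\<^sub>t) + \<Sum> c\<^sub>t u\<^sub>t\<close> with disjoint narrow bumps \<open>u\<^sub>t\<close> and unimodular \<open>c\<^sub>t\<close>.\<close>

lemma atoms_l1: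
  fixes \<Phi> :: "('g::t2_space \<Rightarrow> complex) \<Rightarrow> complex"
  assumes cpt: "compact (UNIV :: 'g set)" and \<Phi>: "\<Phi> \<in> dual_sp bcontfun"
    and bound: "\<And>f. f \<in> bcontfun \<Longrightarrow> norm (\<Phi> f) \<le> C * supn f" and C: "0 \<le> C"
    and F: "finite F" and atoms: "\<And>t. t \<in> F \<Longrightarrow> has_atom \<Phi> t (a t)"
    and f: "f \<in> bcontfun" "supn f \<le> 1"
  shows "norm (\<Phi> f - (\<Sum>t\<in>F. a t * f t)) + (\<Sum>t\<in>F. norm (a t)) \<le> C"
proof (rule field_le_epsilon)
  fix \<epsilon> :: real assume \<epsilon>: "0 < \<epsilon>"
  define n where "n = real (card F)"
  \<comment> \<open>Each point of \<open>F\<close> will contribute an error of at most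
    \<open>(C + 2) * e\<close>; the \<open>+ 1\<close> keeps the denominator positive for empty
    \<open>F\<close>.\<close>
  define e where "e = \<epsilon> / ((n + 1) * (C + 2))"
  have n: "0 \<le> n" by (simp add: n_def)
  have e: "0 < e" using \<epsilon> C n by (simp add: e_def)
  have ne: "n * ((C + 2) * e) \<le> \<epsilon>"
  proof -
    have "(C + 2) * e = \<epsilon> / (n + 1)" using C by (simp add: e_def)
    moreover have "n * \<epsilon> \<le> \<epsilon> * (n + 1)" using \<epsilon> by (simp add: algebra_simps)
    ultimately show ?thesis using n by (simp add: pos_divide_le_eq)
  qed
  note bc = bcontfun_compact_eq[OF cpt]
  have cf: "continuous_on UNIV f" using f by (simp add: bc)
  obtain W where W: "\<And>t. t \<in> F \<Longrightarrow> open (W t)" "\<And>t. t \<in> F \<Longrightarrow> t \<in> W t"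
    "\<And>s t. s \<in> F \<Longrightarrow> t \<in> F \<Longrightarrow> s \<noteq> t \<Longrightarrow> W s \<inter> W t = {}"
    using disjoint_neighbourhoods[OF F] by blast
  \<comment> \<open>Each bump serves three purposes: disjointness from the other bumps,
    near-constancy of \<open>f\<close> where the bump is nonzero, and a value of
    \<open>\<Phi>\<close> close to the atom.\<close>
  have "\<exists>u. u \<in> bump t (W t) \<and> (\<forall>x. u x \<noteq> 0 \<longrightarrow> norm (f x - f t) \<le> e) \<and> norm (\<Phi> (\<lambda>x. of_real (u x)) - a t) < e"
    if t: "t \<in> F" for t
  proof -
    obtain V where V: "open V" "t \<in> V" "\<And>u. u \<in> bump t V \<Longrightarrow> norm (\<Phi> (\<lambda>x. of_real (u x)) - a t) < e"
      using atoms[OF t] e unfolding has_atom_def by metis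
    have "open {x. norm (f x - f t) < e}" by (intro open_Collect_less continuous_intros cf)
    then have "open (V \<inter> W t \<inter> {x. norm (f x - f t) < e})" using V W t by auto
    then obtain u where u: "u \<in> bump t (V \<inter> W t \<inter> {x. norm (f x - f t) < e})"
      using bump_nonempty[OF cpt, of "V \<inter> W t \<inter> {x. norm (f x - f t) < e}" t] V W t e by auto
    have "u \<in> bump t V" "u \<in> bump t (W t)" using u by (auto simp: bump_def)
    moreover have "norm (f x - f t) \<le> e" if "u x \<noteq> 0" for x
    proof -
      have "x \<in> V \<inter> W t \<inter> {x. norm (f x - f t) < e}" using bumpD(5)[OF u, of x] that by blast
      then show ?thesis by simp
    qed
    ultimately show ?thesis using V(3) by blast
  qed
  then obtain u where u: "\<And>t. t \<in> F \<Longrightarrow> u t \<in> bump t (W t)"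
    "\<And>t x. t \<in> F \<Longrightarrow> u t x \<noteq> 0 \<Longrightarrow> norm (f x - f t) \<le> e"
    "\<And>t. t \<in> F \<Longrightarrow> norm (\<Phi> (\<lambda>x. of_real (u t x)) - a t) < e" by metis
  have sum_u: "(\<Sum>t\<in>F. u t x) \<le> 1" for x
  proof (cases "\<exists>s\<in>F. x \<in> W s")
    case True
    then obtain s where s: "s \<in> F" "x \<in> W s" by blast
    have "u t x = 0" if "t \<in> F - {s}" for t
      using that s W(3)[of s t] bumpD(5)[OF u(1), of t x] by blast
    then have "(\<Sum>t\<in>F. u t x) = u s x" using F s by (simp add: sum.remove)
    then show ?thesis using bumpD(3)[OF u(1)[OF s(1)]] by simp
  next
    case False
    then have "u t x = 0" if "t \<in> F" for t using bumpD(5)[OF u(1)[OF that]] that by blast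
    then show ?thesis by simp
  qed
  define D where "D = \<Phi> f - (\<Sum>t\<in>F. a t * f t)"
  obtain c0 where c0: "norm c0 = 1" "c0 * D = of_real (norm D)" by (rule unimodular_factor)
  have "\<exists>c. norm c = 1 \<and> c * a t = of_real (norm (a t))" for t using unimodular_factor by metis
  then obtain c where c: "\<And>t. norm (c t) = 1" "\<And>t. c t * a t = of_real (norm (a t))" by metis
  have cu: "(\<lambda>x. complex_of_real (u t x)) \<in> bcontfun" if "t \<in> F" for t
    unfolding bc by (intro continuous_intros bumpD(1)[OF u(1)[OF that]])
  have cfu: "(\<lambda>x. f x * of_real (u t x)) \<in> bcontfun" if "t \<in> F" for t
    unfolding bc by (intro continuous_intros cf bumpD(1)[OF u(1)[OF that]])
  note lin = csubspace_funD[OF csubspace_fun_bcontfun] and cdiff = csubspace_fun_diff[OF csubspace_fun_bcontfun]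
  note sm = dual_sp_sum_arg[OF \<Phi> csubspace_fun_bcontfun F]
  define H where "H x = c0 * (f x - (\<Sum>t\<in>F. f x * of_real (u t x))) + (\<Sum>t\<in>F. c t * of_real (u t x))" for x
  have s1: "(\<lambda>x. \<Sum>t\<in>F. f x * of_real (u t x)) \<in> bcontfun"
    "\<Phi> (\<lambda>x. \<Sum>t\<in>F. f x * of_real (u t x)) = (\<Sum>t\<in>F. \<Phi> (\<lambda>x. f x * of_real (u t x)))"
    using sm[of "\<lambda>t x. f x * of_real (u t x)"] cfu by auto
  have s2: "(\<lambda>x. \<Sum>t\<in>F. c t * of_real (u t x)) \<in> bcontfun"
    "\<Phi> (\<lambda>x. \<Sum>t\<in>F. c t * of_real (u t x)) = (\<Sum>t\<in>F. c t * \<Phi> (\<lambda>x. of_real (u t x)))"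
    using sm[of "\<lambda>t x. c t * of_real (u t x)"] cu lin(3) dual_spD(2)[OF \<Phi>] by auto
  note d = cdiff[OF f(1) s1(1)]
  have Hb: "H \<in> bcontfun" unfolding H_def by (rule lin(2)[OF lin(3)[OF d] s2(1)])
  have \<Phi>H: "\<Phi> H = c0 * (\<Phi> f - (\<Sum>t\<in>F. \<Phi> (\<lambda>x. f x * of_real (u t x)))) + (\<Sum>t\<in>F. c t * \<Phi> (\<lambda>x. of_real (u t x)))"
    unfolding H_def dual_spD(1)[OF \<Phi> lin(3)[OF d] s2(1)] dual_spD(2)[OF \<Phi> d]
      dual_sp_diff[OF \<Phi> csubspace_fun_bcontfun f(1) s1(1)] s1(2) s2(2) ..
  \<comment> \<open>With s the sum of the bumps at \<open>x\<close>, the modulus of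
    \<open>H x\<close> is at most (1 - s) |f x| + s, a convex combination of numbers not exceeding
    1.\<close>
  have "norm (H x) \<le> 1" for x
  proof -
    let ?s = "\<Sum>t\<in>F. u t x"
    have "f x - (\<Sum>t\<in>F. f x * of_real (u t x)) = f x * of_real (1 - ?s)"
      by (simp add: sum_distrib_left[symmetric] algebra_simps)
    then have "norm (c0 * (f x - (\<Sum>t\<in>F. f x * of_real (u t x)))) = norm (f x) * (1 - ?s)"
      using c0 sum_u[of x] by (simp add: norm_mult del: of_real_diff)
    also have "\<dots> \<le> 1 * (1 - ?s)"
      using sum_u[of x] order_trans[OF norm_le_supn[OF f(1)] f(2)] by (intro mult_right_mono) auto
    finally have 1: "norm (c0 * (f x - (\<Sum>t\<in>F. f x * of_real (u t x)))) \<le> 1 - ?s" by simp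
    have "norm (\<Sum>t\<in>F. c t * of_real (u t x)) \<le> ?s"
      using bumpD(2)[OF u(1)] c(1) by (intro sum_norm_le) (simp add: norm_mult)
    then show ?thesis unfolding H_def using 1 by (intro order_trans[OF norm_triangle_ineq]) simp
  qed
  then have "supn H \<le> 1" by (rule supn_le)
  then have H_le: "norm (\<Phi> H) \<le> C"
    using bound[OF Hb] mult_left_mono[of "supn H" 1 C] C by simp
  \<comment> \<open>The error \<open>C * e\<close> comes from replacing \<open>f\<close> by
    \<open>f t\<close> on the bump, the error \<open>e\<close> from replacing the value of
    \<open>\<Phi>\<close> at the bump by the atom.\<close>
  have est1: "norm (\<Phi> (\<lambda>x. f x * of_real (u t x)) - a t * f t) \<le> C * e + e" if t: "t \<in> F" for t
  proof -
    have g: "(\<lambda>x. f x * of_real (u t x) - f t * of_real (u t x)) \<in> bcontfun" (is "?g \<in> _")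
      by (rule cdiff[OF cfu[OF t] lin(3)[OF cu[OF t]]])
    have "norm (?g x) \<le> e" for x
    proof (cases "u t x = 0")
      case False
      have "norm (?g x) = norm (f x - f t) * u t x"
        using bumpD(2)[OF u(1)[OF t], of x] by (simp add: left_diff_distrib[symmetric] norm_mult)
      also have "\<dots> \<le> e * 1"
        using bumpD(2,3)[OF u(1)[OF t], of x] u(2)[OF t False] e by (intro mult_mono) auto
      finally show ?thesis by simp
    qed (use e in simp)
    then have "supn ?g \<le> e" by (rule supn_le)
    then have "norm (\<Phi> ?g) \<le> C * e" using bound[OF g] mult_left_mono[of "supn ?g" e C] C by simp
    moreover have "norm (f t * (\<Phi> (\<lambda>x. of_real (u t x)) - a t)) \<le> 1 * e"
      unfolding norm_mult using u(3)[OF t] order_trans[OF norm_le_supn[OF f(1)] f(2)] by (intro mult_mono) auto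
    moreover have eq: "\<Phi> (\<lambda>x. f x * of_real (u t x)) - a t * f t = \<Phi> ?g + f t * (\<Phi> (\<lambda>x. of_real (u t x)) - a t)"
      using dual_sp_diff[OF \<Phi> csubspace_fun_bcontfun cfu[OF t] lin(3)[OF cu[OF t]]] dual_spD(2)[OF \<Phi> cu[OF t]]
      by (simp add: algebra_simps)
    ultimately show ?thesis unfolding eq
      using norm_triangle_ineq[of "\<Phi> ?g" "f t * (\<Phi> (\<lambda>x. of_real (u t x)) - a t)"] by linarith
  qed
  have "c0 * D + (\<Sum>t\<in>F. c t * a t) - \<Phi> H =
     (\<Sum>t\<in>F. c0 * (\<Phi> (\<lambda>x. f x * of_real (u t x)) - a t * f t) - c t * (\<Phi> (\<lambda>x. of_real (u t x)) - a t))"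
    by (simp add: \<Phi>H D_def sum_subtractf sum.distrib sum_distrib_left algebra_simps)
  moreover have "norm \<dots> \<le> n * ((C + 2) * e)"
    unfolding n_def
  proof (rule sum_norm_bound)
    fix t assume t: "t \<in> F"
    have "norm (c0 * (\<Phi> (\<lambda>x. f x * of_real (u t x)) - a t * f t) - c t * (\<Phi> (\<lambda>x. of_real (u t x)) - a t))
      \<le> norm (c0 * (\<Phi> (\<lambda>x. f x * of_real (u t x)) - a t * f t)) + norm (c t * (\<Phi> (\<lambda>x. of_real (u t x)) - a t))"
      by (rule norm_triangle_ineq4)
    also have "\<dots> \<le> (C * e + e) + e" using est1[OF t] u(3)[OF t] c0 c by (simp add: norm_mult)
    finally show "norm (c0 * (\<Phi> (\<lambda>x. f x * of_real (u t x)) - a t * f t) - c t * (\<Phi> (\<lambda>x. of_real (u t x)) - a t)) \<le> (C + 2) * e"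
      by (simp add: algebra_simps)
  qed
  ultimately have "norm (c0 * D + (\<Sum>t\<in>F. c t * a t) - \<Phi> H) \<le> \<epsilon>" using ne by simp
  moreover have "c0 * D + (\<Sum>t\<in>F. c t * a t) = of_real (norm D + (\<Sum>t\<in>F. norm (a t)))"
    using c0 c by simp
  moreover have "norm (of_real (norm D + (\<Sum>t\<in>F. norm (a t))) :: complex) = norm D + (\<Sum>t\<in>F. norm (a t))"
    by (simp only: norm_of_real abs_of_nonneg add_nonneg_nonneg norm_ge_zero sum_nonneg)
  ultimately show "norm (\<Phi> f - (\<Sum>t\<in>F. a t * f t)) + (\<Sum>t\<in>F. norm (a t)) \<le> C + \<epsilon>"
    using H_le norm_triangle_ineq2[of "c0 * D + (\<Sum>t\<in>F. c t * a t)" "\<Phi> H"] unfolding D_def by simp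
qed

section \<open>The point-mass functionals\<close>

text \<open>The hypothesis \<open>null\<close> is the form in which the group and the semi-Riesz
  property enter the theory of point masses; it makes the atoms of a functional on \<open>S\<close>
  independent of how it is extended.\<close>

locale atomless_annihilator =
  fixes S :: "('g::t2_space \<Rightarrow> complex) set"
  assumes cpt: "compact (UNIV :: 'g set)"
    and S: "csubspace_fun S" "S \<subseteq> bcontfun"
    and null: "\<And>\<Phi> h. \<Phi> \<in> dual_sp bcontfun \<Longrightarrow> (\<And>f. f \<in> S \<Longrightarrow> \<Phi> f = 0) \<Longrightarrow> has_atom \<Phi> h 0"
begin

text \<open>Later identified with \<open>pi_fun\<close>. Any bounded extension, norm-preserving or
  not, can be used to compute it, which is what makes it linear.\<close>

definition pmass :: "'g \<Rightarrow> (('g \<Rightarrow> complex) \<Rightarrow> complex) \<Rightarrow> complex" where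
  "pmass h \<phi> = (THE c. \<exists>\<Phi>\<in>dual_sp bcontfun. (\<forall>f\<in>S. \<Phi> f = \<phi> f) \<and> has_atom \<Phi> h c)"

lemma pmass_eq:
  assumes "\<Phi> \<in> dual_sp bcontfun" "\<And>f. f \<in> S \<Longrightarrow> \<Phi> f = \<phi> f" "has_atom \<Phi> h c"
  shows "pmass h \<phi> = c"
  unfolding pmass_def
proof (rule the_equality)
  show "\<exists>\<Phi>\<in>dual_sp bcontfun. (\<forall>f\<in>S. \<Phi> f = \<phi> f) \<and> has_atom \<Phi> h c" using assms by blast
  fix c' assume "\<exists>\<Phi>\<in>dual_sp bcontfun. (\<forall>f\<in>S. \<Phi> f = \<phi> f) \<and> has_atom \<Phi> h c'"
  then obtain \<Psi> where \<Psi>: "\<Psi> \<in> dual_sp bcontfun" "\<And>f. f \<in> S \<Longrightarrow> \<Psi> f = \<phi> f" "has_atom \<Psi> h c'" by blast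
  let ?D = "\<lambda>f. \<Phi> f + (-1) * \<Psi> f"
  have "?D \<in> dual_sp bcontfun"
    by (intro dual_sp_add dual_sp_cmult csubspace_fun_bcontfun subset_refl assms(1) \<Psi>(1))
  then have "has_atom ?D h 0" using assms(2) \<Psi>(2) by (intro null) auto
  moreover have "has_atom ?D h (c + (-1) * c')" by (rule has_atom_add[OF assms(3) has_atom_cmult[OF \<Psi>(3)]])
  ultimately show "c' = c" using has_atom_unique[OF cpt] by fastforce
qed

lemma pmass_extension:
  assumes "\<phi> \<in> dual_sp S"
  obtains \<Phi> where "\<Phi> \<in> dual_sp bcontfun" "\<And>f. f \<in> S \<Longrightarrow> \<Phi> f = \<phi> f"
    "\<And>f. f \<in> bcontfun \<Longrightarrow> norm (\<Phi> f) \<le> dnorm S \<phi> * supn f" "\<And>h. has_atom \<Phi> h (pmass h \<phi>)"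
proof -
  obtain \<Phi> where \<Phi>: "\<Phi> \<in> dual_sp bcontfun" "\<And>f. f \<in> S \<Longrightarrow> \<Phi> f = \<phi> f"
    "\<And>f. f \<in> bcontfun \<Longrightarrow> norm (\<Phi> f) \<le> dnorm S \<phi> * supn f" using complex_hahn_banach[OF S assms] by metis
  obtain \<mu> where \<mu>: "is_cmeasure \<mu>" "\<And>f. continuous_on UNIV f \<Longrightarrow> \<Phi> f = cm_int \<mu> f"
    using cmeasure_representation[OF cpt \<Phi>(1)] by metis
  have at: "has_atom \<Phi> h (cm_val \<mu> {h})" for h by (rule has_atom_cmeasure[OF cpt \<mu>])
  have "pmass h \<phi> = cm_val \<mu> {h}" for h by (rule pmass_eq[OF \<Phi>(1,2) at])
  then show ?thesis using that \<Phi> at by metis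
qed

lemma pmass_add:
  assumes "\<phi> \<in> dual_sp S" "\<psi> \<in> dual_sp S"
  shows "pmass h (\<lambda>f. \<phi> f + \<psi> f) = pmass h \<phi> + pmass h \<psi>"
proof -
  obtain \<Phi> where \<Phi>: "\<Phi> \<in> dual_sp bcontfun" "\<And>f. f \<in> S \<Longrightarrow> \<Phi> f = \<phi> f" "\<And>h. has_atom \<Phi> h (pmass h \<phi>)"
    using pmass_extension[OF assms(1)] by metis
  obtain \<Psi> where \<Psi>: "\<Psi> \<in> dual_sp bcontfun" "\<And>f. f \<in> S \<Longrightarrow> \<Psi> f = \<psi> f" "\<And>h. has_atom \<Psi> h (pmass h \<psi>)"
    using pmass_extension[OF assms(2)] by metis
  show ?thesis
    by (rule pmass_eq[OF dual_sp_add[OF csubspace_fun_bcontfun subset_refl \<Phi>(1) \<Psi>(1)] _ has_atom_add[OF \<Phi>(3) \<Psi>(3)]])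
      (simp add: \<Phi> \<Psi>)
qed

lemma pmass_cmult:
  assumes "\<phi> \<in> dual_sp S"
  shows "pmass h (\<lambda>f. c * \<phi> f) = c * pmass h \<phi>"
proof -
  obtain \<Phi> where \<Phi>: "\<Phi> \<in> dual_sp bcontfun" "\<And>f. f \<in> S \<Longrightarrow> \<Phi> f = \<phi> f" "\<And>h. has_atom \<Phi> h (pmass h \<phi>)"
    using pmass_extension[OF assms(1)] by metis
  show ?thesis
    by (rule pmass_eq[OF dual_sp_cmult[OF csubspace_fun_bcontfun subset_refl \<Phi>(1)] _ has_atom_cmult[OF \<Phi>(3)]])
      (simp add: \<Phi>)
qed

lemma pmass_zero: "pmass h (\<lambda>f. 0) = 0"
  using pmass_cmult[OF dual_sp_zero[OF S], of h 0] by simp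

lemma pmass_sum:
  "finite I \<Longrightarrow> (\<And>i. i \<in> I \<Longrightarrow> \<phi> i \<in> dual_sp S) \<Longrightarrow> pmass h (\<lambda>f. \<Sum>i\<in>I. \<phi> i f) = (\<Sum>i\<in>I. pmass h (\<phi> i))"
proof (induction I rule: finite_induct)
  case (insert i I)
  then show ?case using pmass_add[of "\<phi> i" "\<lambda>f. \<Sum>i\<in>I. \<phi> i f"] dual_sp_sum[OF S, of I \<phi>] by simp
qed (simp add: pmass_zero)

lemma pmass_pt_eval: "pmass h (pt_eval S h) = 1"
  by (rule pmass_eq[OF pt_eval_dual_sp[OF csubspace_fun_bcontfun subset_refl] _ has_atom_pt_eval[OF cpt]])
    (use S(2) in \<open>auto simp: pt_eval_def\<close>)

text \<open>This is \<open>atoms_l1\<close> for a norm-preserving extension, with the supremum taken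
  over test functions in \<open>S\<close>. The masses do not depend on the test function, so they
  stay outside the supremum.\<close>

lemma pmass_l1:
  assumes "\<phi> \<in> dual_sp S" "finite F"
  shows "(\<Sum>t\<in>F. norm (pmass t \<phi>)) + dnorm S (\<lambda>f. \<phi> f - (\<Sum>t\<in>F. pmass t \<phi> * pt_eval S t f)) \<le> dnorm S \<phi>"
proof -
  obtain \<Phi> where \<Phi>: "\<Phi> \<in> dual_sp bcontfun" "\<And>f. f \<in> S \<Longrightarrow> \<Phi> f = \<phi> f"
    "\<And>f. f \<in> bcontfun \<Longrightarrow> norm (\<Phi> f) \<le> dnorm S \<phi> * supn f" "\<And>h. has_atom \<Phi> h (pmass h \<phi>)"
    using pmass_extension[OF assms(1)] by metis
  have *: "norm (\<phi> f - (\<Sum>t\<in>F. pmass t \<phi> * pt_eval S t f)) \<le> dnorm S \<phi> - (\<Sum>t\<in>F. norm (pmass t \<phi>))"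
    if f: "f \<in> S" "supn f \<le> 1" for f
    using atoms_l1[OF cpt \<Phi>(1,3) dnorm_nonneg[OF S assms(1)] assms(2) \<Phi>(4), of f] f S(2) \<Phi>(2)[OF f(1)]
    by (auto simp: pt_eval_def)
  have "0 \<le> dnorm S \<phi> - (\<Sum>t\<in>F. norm (pmass t \<phi>))"
    using *[of "\<lambda>x. 0"] csubspace_funD(1)[OF S(1)] order_trans[OF norm_ge_zero] by fastforce
  then have "dnorm S (\<lambda>f. \<phi> f - (\<Sum>t\<in>F. pmass t \<phi> * pt_eval S t f)) \<le> dnorm S \<phi> - (\<Sum>t\<in>F. norm (pmass t \<phi>))"
    using * by (intro dnorm_le[OF S])
  then show ?thesis by simp
qed

lemma sum_pmass_le:
  assumes "\<phi> \<in> dual_sp S" "finite F"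
  shows "(\<Sum>t\<in>F. norm (pmass t \<phi>)) \<le> dnorm S \<phi>"
proof -
  have "0 \<le> dnorm S (\<lambda>f. \<phi> f - (\<Sum>t\<in>F. pmass t \<phi> * pt_eval S t f))"
    by (intro dnorm_nonneg[OF S] dual_sp_diff_fun[OF S] dual_sp_sum[OF S] dual_sp_cmult[OF S] pt_eval_dual_sp[OF S] assms)
  then show ?thesis using pmass_l1[OF assms] by simp
qed

lemma pmass_le: "\<phi> \<in> dual_sp S \<Longrightarrow> norm (pmass t \<phi>) \<le> dnorm S \<phi>"
  using sum_pmass_le[of \<phi> "{t}"] by simp

lemma dnorm_pt_eval: "dnorm S (pt_eval S h) = 1"
proof (rule antisym)
  show "dnorm S (pt_eval S h) \<le> 1"
    using S(2) by (intro dnorm_le[OF S]) (auto simp: pt_eval_def intro: order_trans[OF norm_le_supn])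
  \<comment> \<open>No norming function in \<open>S\<close> is exhibited; the atom of mass 1 bounds
    the norm from below.\<close>
  show "1 \<le> dnorm S (pt_eval S h)"
    using pmass_le[OF pt_eval_dual_sp[OF S], of h h] by (simp add: pmass_pt_eval)
qed

lemma dnorm_L:
  assumes \<phi>: "\<phi> \<in> dual_sp S"
  shows "dnorm S \<phi> = norm (pmass h \<phi>) + dnorm S (\<lambda>f. \<phi> f - pmass h \<phi> * pt_eval S h f)"
proof (rule antisym)
  note d = dual_sp_cmult[OF S pt_eval_dual_sp[OF S, of h], of "pmass h \<phi>"]
  have "dnorm S (\<lambda>f. pmass h \<phi> * pt_eval S h f + (\<phi> f - pmass h \<phi> * pt_eval S h f))
    \<le> dnorm S (\<lambda>f. pmass h \<phi> * pt_eval S h f) + dnorm S (\<lambda>f. \<phi> f - pmass h \<phi> * pt_eval S h f)"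
    by (intro dnorm_triangle[OF S] d dual_sp_diff_fun[OF S] \<phi>)
  then show "dnorm S \<phi> \<le> norm (pmass h \<phi>) + dnorm S (\<lambda>f. \<phi> f - pmass h \<phi> * pt_eval S h f)"
    by (simp add: dnorm_cmult[OF S pt_eval_dual_sp[OF S]] dnorm_pt_eval)
  show "norm (pmass h \<phi>) + dnorm S (\<lambda>f. \<phi> f - pmass h \<phi> * pt_eval S h f) \<le> dnorm S \<phi>"
    using pmass_l1[OF \<phi>, of "{h}"] by simp
qed

lemma L_proj_pmass: "L_proj S h (\<lambda>\<phi> f. pmass h \<phi> * pt_eval S h f)"
  unfolding L_proj_def
proof (intro conjI ballI allI)
  note p = pt_eval_dual_sp[OF S, of h]
  fix \<phi> \<psi> assume \<phi>: "\<phi> \<in> dual_sp S"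
  show "(\<lambda>f. pmass h (\<lambda>f. pmass h \<phi> * pt_eval S h f) * pt_eval S h f) = (\<lambda>f. pmass h \<phi> * pt_eval S h f)"
    by (simp add: pmass_cmult[OF p] pmass_pt_eval)
  show "dnorm S \<phi> = dnorm S (\<lambda>f. pmass h \<phi> * pt_eval S h f) + dnorm S (\<lambda>f. \<phi> f - pmass h \<phi> * pt_eval S h f)"
    using dnorm_L[OF \<phi>, of h] by (simp add: dnorm_cmult[OF S p] dnorm_pt_eval)
  show "(\<lambda>f. pmass h (\<lambda>f. c * \<phi> f) * pt_eval S h f) = (\<lambda>f. c * (pmass h \<phi> * pt_eval S h f))" for c
    by (simp add: pmass_cmult[OF \<phi>] mult.assoc)
  assume \<psi>: "\<psi> \<in> dual_sp S"
  show "(\<lambda>f. pmass h (\<lambda>f. \<phi> f + \<psi> f) * pt_eval S h f) = (\<lambda>f. pmass h \<phi> * pt_eval S h f + pmass h \<psi> * pt_eval S h f)"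
    by (simp add: pmass_add[OF \<phi> \<psi>] distrib_right)
next
  note p = pt_eval_dual_sp[OF S, of h]
  have "(\<lambda>f. c * pt_eval S h f) \<in> (\<lambda>\<phi> f. pmass h \<phi> * pt_eval S h f) ` dual_sp S" for c
    using dual_sp_cmult[OF S p, of c] by (intro image_eqI[of _ _ "\<lambda>f. c * pt_eval S h f"]) (auto simp: pmass_cmult[OF p] pmass_pt_eval)
  then show "(\<lambda>\<phi> f. pmass h \<phi> * pt_eval S h f) ` dual_sp S = {\<lambda>f. c * pt_eval S h f |c. True}"
    by auto
qed

text \<open>An \<open>L\<close>-projection is determined by its range: if \<open>Q z = 0\<close>, then
  \<open>\<parallel>z - P z\<parallel> = \<parallel>z\<parallel> + \<parallel>P z\<parallel>\<close> and \<open>\<parallel>z\<parallel> = \<parallel>P z\<parallel> + \<parallel>z - P z\<parallel>\<close>, so \<open>P z = 0\<close>.\<close>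

lemma L_proj_unique:
  assumes P: "L_proj S h P" and \<phi>: "\<phi> \<in> dual_sp S"
  shows "P \<phi> = (\<lambda>f. pmass h \<phi> * pt_eval S h f)"
proof -
  note p = pt_eval_dual_sp[OF S, of h]
  let ?y = "\<lambda>f. pmass h \<phi> * pt_eval S h f"
  define z where "z = (\<lambda>f. \<phi> f - ?y f)"
  have y: "?y \<in> dual_sp S" by (rule dual_sp_cmult[OF S p])
  have z: "z \<in> dual_sp S" unfolding z_def by (rule dual_sp_diff_fun[OF S \<phi> y])
  have P_add: "\<And>\<phi> \<psi>. \<phi> \<in> dual_sp S \<Longrightarrow> \<psi> \<in> dual_sp S \<Longrightarrow> P (\<lambda>f. \<phi> f + \<psi> f) = (\<lambda>f. P \<phi> f + P \<psi> f)"
    and P_idem: "\<And>\<phi>. \<phi> \<in> dual_sp S \<Longrightarrow> P (P \<phi>) = P \<phi>"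
    and P_range: "P ` dual_sp S = {(\<lambda>f. c * pt_eval S h f) | c. True}"
    and P_norm: "\<And>\<phi>. \<phi> \<in> dual_sp S \<Longrightarrow> dnorm S \<phi> = dnorm S (P \<phi>) + dnorm S (\<lambda>f. \<phi> f - P \<phi> f)"
    using P unfolding L_proj_def by auto
  have "?y \<in> P ` dual_sp S" unfolding P_range by blast
  then obtain \<psi> where "\<psi> \<in> dual_sp S" "P \<psi> = ?y" by (metis imageE)
  then have Py: "P ?y = ?y" using P_idem by metis
  have "P z \<in> P ` dual_sp S" using z by blast
  then obtain c where c: "P z = (\<lambda>f. c * pt_eval S h f)" unfolding P_range by blast
  have "pmass h z = 0"
    using pmass_add[OF \<phi> dual_sp_cmult[OF S y], of h "-1"] pmass_cmult[OF y, of h "-1"] pmass_cmult[OF p, of h "pmass h \<phi>"]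
    by (simp add: z_def pmass_pt_eval)
  moreover have zc: "(\<lambda>f. z f + (- c) * pt_eval S h f) \<in> dual_sp S"
    by (intro dual_sp_add[OF S] z dual_sp_cmult[OF S] p)
  ultimately have "pmass h (\<lambda>f. z f + (- c) * pt_eval S h f) = - c"
    using pmass_add[OF z dual_sp_cmult[OF S p], of h "- c"] pmass_cmult[OF p, of h "- c"] by (simp add: pmass_pt_eval)
  \<comment> \<open>This is \<open>dnorm_L\<close> applied to \<open>z - P z\<close>, whose mass at
    \<open>h\<close> is \<open>- c\<close>; removing that mass gives back \<open>z\<close>.\<close>
  then have "dnorm S (\<lambda>f. z f - P z f) = norm c + dnorm S z"
    using dnorm_L[OF zc, of h] by (simp add: c)
  moreover have "dnorm S z = norm c + dnorm S (\<lambda>f. z f - P z f)"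
    using P_norm[OF z] dnorm_cmult[OF S p, of c] by (simp add: c dnorm_pt_eval)
  ultimately have "c = 0" by simp
  then have "P z = (\<lambda>f. 0)" using c by simp
  moreover have "\<phi> = (\<lambda>f. z f + ?y f)" by (simp add: z_def)
  ultimately show ?thesis using P_add[OF z y] Py by simp
qed

text \<open>Two choices hide in \<open>pi_fun\<close>: the projection, settled by uniqueness of
  L-projections, and the coefficient, settled because \<open>pmass h\<close> recovers it from a
  multiple of \<open>pt_eval S h\<close>.\<close>

lemma pi_fun_eq: "\<phi> \<in> dual_sp S \<Longrightarrow> pi_fun S h \<phi> = pmass h \<phi>"
proof -
  assume \<phi>: "\<phi> \<in> dual_sp S"
  have "L_proj S h (Pi_proj S h)" unfolding Pi_proj_def by (rule someI[where P = "L_proj S h", OF L_proj_pmass])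
  then have *: "Pi_proj S h \<phi> = (\<lambda>f. pmass h \<phi> * pt_eval S h f)" using \<phi> by (rule L_proj_unique)
  have "c = pmass h \<phi>" if "Pi_proj S h \<phi> = (\<lambda>f. c * pt_eval S h f)" for c
    using that pmass_cmult[OF pt_eval_dual_sp[OF S], of h c h] pmass_cmult[OF pt_eval_dual_sp[OF S], of h "pmass h \<phi>" h]
    by (simp add: * pmass_pt_eval)
  then show ?thesis unfolding pi_fun_def using * by (intro some_equality) auto
qed

end

section \<open>The Daugavet equation\<close>

lemma bdd_clinD:
  assumes "bdd_clin A nA B nB T"
  shows "f \<in> A \<Longrightarrow> T f \<in> B" "f \<in> A \<Longrightarrow> g \<in> A \<Longrightarrow> T (\<lambda>x. f x + g x) = (\<lambda>y. T f y + T g y)"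
    "f \<in> A \<Longrightarrow> T (\<lambda>x. c * f x) = (\<lambda>y. c * T f y)"
  using assms by (auto simp: bdd_clin_def)

locale atomless_annihilator_operator = atomless_annihilator S for S :: "('g::t2_space \<Rightarrow> complex) set" +
  fixes T K
  assumes T: "bdd_clin S supn S supn T"
    and K: "\<And>f. f \<in> S \<Longrightarrow> supn (T f) \<le> K * supn f" "0 \<le> K"
begin

lemma T_bound: "f \<in> S \<Longrightarrow> norm (T f x) \<le> K * supn f"
  using norm_le_supn[of "T f" x] K(1) bdd_clinD(1)[OF T] S(2) by fastforce

lemma T_bound1: "f \<in> S \<Longrightarrow> supn f \<le> 1 \<Longrightarrow> norm (T f x) \<le> K"
  using T_bound[of f x] mult_left_mono[of "supn f" 1 K] K(2) by simp

lemma adj_pt_dual_sp: "adj_pt S T s \<in> dual_sp S"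
  by (rule dual_spI[where K = K])
    (auto simp: adj_pt_def bdd_clinD[OF T] csubspace_funD[OF S(1)] T_bound)

lemma dnorm_adj_pt_le: "dnorm S (adj_pt S T s) \<le> K"
  by (rule dnorm_le[OF S K(2)]) (simp add: adj_pt_def T_bound1)

lemma daugavet_of_small_atoms:
  assumes small: "\<And>U e. open U \<Longrightarrow> U \<noteq> {} \<Longrightarrow> 0 < e \<Longrightarrow> \<exists>s\<in>U. norm (pmass s (adj_pt S T s)) \<le> e"
  shows "opnorm_on S (\<lambda>f x. f x + T f x) = 1 + opnorm_on S T"
proof (rule antisym)
  let ?B = "{f \<in> S. supn f \<le> 1}"
  have z: "(\<lambda>x. 0) \<in> ?B" using csubspace_funD(1)[OF S(1)] by simp
  have bddT: "bdd_above ((\<lambda>f. supn (T f)) ` ?B)"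
    by (rule bdd_aboveI[of _ K]) (auto intro!: supn_le T_bound1)
  have leT: "norm (T f x) \<le> opnorm_on S T" if "f \<in> ?B" for f x
  proof -
    have "T f \<in> bcontfun" using that bdd_clinD(1)[OF T] S(2) by blast
    then have "norm (T f x) \<le> supn (T f)" by (rule norm_le_supn)
    also have "\<dots> \<le> opnorm_on S T" unfolding opnorm_on_def by (rule cSUP_upper[OF that bddT])
    finally show ?thesis .
  qed
  have le1: "norm (f x) \<le> 1" if "f \<in> ?B" for f x
    using norm_le_supn[of f x] that S(2) by fastforce
  show "opnorm_on S (\<lambda>f x. f x + T f x) \<le> 1 + opnorm_on S T"
    unfolding opnorm_on_def[of S "\<lambda>f x. f x + T f x"]
  proof (rule cSUP_least)
    show "?B \<noteq> {}" using z by blast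
    show "supn (\<lambda>x. f x + T f x) \<le> 1 + opnorm_on S T" if "f \<in> ?B" for f
      by (intro supn_le order_trans[OF norm_triangle_ineq] add_mono le1[OF that] leT[OF that])
  qed
  show "1 + opnorm_on S T \<le> opnorm_on S (\<lambda>f x. f x + T f x)"
  proof (rule field_le_epsilon)
    fix \<epsilon> :: real assume "0 < \<epsilon>"
    \<comment> \<open>Three losses of \<open>e\<close> occur: in choosing \<open>f0\<close>, in
      removing the atom from the adjoint functional, and in bounding the modulus of
      \<open>1 + ?p\<close> from below.\<close>
    define e where "e = \<epsilon> / 4"
    have e: "0 < e" using \<open>0 < \<epsilon>\<close> by (simp add: e_def)
    have "\<exists>f0\<in>?B. opnorm_on S T - e < supn (T f0)"
      unfolding opnorm_on_def by (subst less_cSUP_iff[symmetric, OF _ bddT]) (use z e in auto)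
    then obtain f0 where f0: "f0 \<in> ?B" "opnorm_on S T - e < supn (T f0)" by blast
    have T0: "T f0 \<in> bcontfun" using f0 bdd_clinD(1)[OF T] S(2) by blast
    have "\<exists>x. opnorm_on S T - e < norm (T f0 x)"
      using f0(2) supn_le[of "T f0" "opnorm_on S T - e"] by (meson not_le)
    \<comment> \<open>Every point of \<open>U\<close> witnesses the near-maximality of
      \<open>f0\<close>, so \<open>s\<close> may be chosen in \<open>U\<close> for the sake of its
      small atom.\<close>
    moreover define U where "U = {x. opnorm_on S T - e < norm (T f0 x)}"
    ultimately have "U \<noteq> {}" by blast
    moreover have "open U" unfolding U_def
      using T0 by (intro open_Collect_less continuous_intros) (auto simp: bcontfun_iff)
    ultimately obtain s where s: "s \<in> U" "norm (pmass s (adj_pt S T s)) \<le> e" using small[OF _ _ e] by blast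
    let ?\<phi> = "adj_pt S T s"
    let ?p = "pmass s ?\<phi>"
    note p = pt_eval_dual_sp[OF S, of s]
    have "opnorm_on S T - e < norm (?\<phi> f0)" using s(1) f0 by (simp add: U_def adj_pt_def)
    also have "\<dots> \<le> dnorm S ?\<phi>" using f0 by (intro norm_le_dnorm1[OF S adj_pt_dual_sp]) auto
    also have "\<dots> = norm ?p + dnorm S (\<lambda>f. ?\<phi> f - ?p * pt_eval S s f)"
      by (rule dnorm_L[OF adj_pt_dual_sp])
    finally have 1: "opnorm_on S T - e - e < dnorm S (\<lambda>f. ?\<phi> f - ?p * pt_eval S s f)" using s(2) by simp
    let ?\<psi> = "\<lambda>f. pt_eval S s f + ?\<phi> f"
    have \<psi>: "?\<psi> \<in> dual_sp S" by (rule dual_sp_add[OF S p adj_pt_dual_sp])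
    have "pmass s ?\<psi> = 1 + ?p" by (simp add: pmass_add[OF p adj_pt_dual_sp] pmass_pt_eval)
    \<comment> \<open>Removing the atom \<open>1 + ?p\<close> from \<open>?\<psi>\<close> leaves the
      same remainder as removing \<open>?p\<close> from \<open>?\<phi>\<close>.\<close>
    then have "dnorm S ?\<psi> = norm (1 + ?p) + dnorm S (\<lambda>f. ?\<phi> f - ?p * pt_eval S s f)"
      using dnorm_L[OF \<psi>, of s] by (simp add: algebra_simps)
    moreover have "1 - e \<le> norm (1 + ?p)"
      using norm_triangle_ineq2[of 1 "- ?p"] s(2) by simp
    ultimately have big: "1 + opnorm_on S T - \<epsilon> < dnorm S ?\<psi>" using 1 e by (simp add: e_def)
    have "dnorm S ?\<psi> \<le> opnorm_on S (\<lambda>f x. f x + T f x)"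
    proof (rule dnorm_le[OF S])
      have bdd: "bdd_above ((\<lambda>f. supn (\<lambda>x. f x + T f x)) ` ?B)"
        by (rule bdd_aboveI[of _ "1 + K"])
          (auto intro!: supn_le order_trans[OF norm_triangle_ineq] add_mono T_bound1 le1)
      have *: "norm (f s + T f s) \<le> opnorm_on S (\<lambda>f x. f x + T f x)" if "f \<in> ?B" for f
      proof -
        have "(\<lambda>x. f x + T f x) \<in> bcontfun"
          using that bdd_clinD(1)[OF T] S(2) by (intro plus_cont) auto
        then have "norm (f s + T f s) \<le> supn (\<lambda>x. f x + T f x)" by (rule norm_le_supn)
        also have "\<dots> \<le> opnorm_on S (\<lambda>f x. f x + T f x)"
          unfolding opnorm_on_def by (rule cSUP_upper[OF that bdd])
        finally show ?thesis .
      qed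
      show "norm (?\<psi> f) \<le> opnorm_on S (\<lambda>f x. f x + T f x)" if "f \<in> S" "supn f \<le> 1" for f
        using *[of f] that by (simp add: pt_eval_def adj_pt_def)
      show "0 \<le> opnorm_on S (\<lambda>f x. f x + T f x)" using order_trans[OF norm_ge_zero *[OF z]] .
    qed
    then show "1 + opnorm_on S T \<le> opnorm_on S (\<lambda>f x. f x + T f x) + \<epsilon>" using big by simp
  qed
qed

text \<open>If all atoms \<open>pmass s (T* p\<^sub>s)\<close>, \<open>s \<in> U\<close>, were larger than \<open>e\<close>, continuity would let one
  collect arbitrarily many points \<open>t\<close> with \<open>|pmass t (T* p\<^sub>s)| > e\<close> for one and the same \<open>s\<close>.\<close>

lemma small_atoms_continuous:
  assumes cont: "\<And>t. continuous_on UNIV (\<lambda>s. pmass t (adj_pt S T s))"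
    and inf: "\<And>U :: 'g set. open U \<Longrightarrow> U \<noteq> {} \<Longrightarrow> infinite U"
    and U: "open U" "U \<noteq> {}" and e: "0 < e"
  shows "\<exists>s\<in>U. norm (pmass s (adj_pt S T s)) \<le> e"
proof (rule ccontr)
  assume "\<not> ?thesis"
  then have big: "\<And>s. s \<in> U \<Longrightarrow> e < norm (pmass s (adj_pt S T s))" by force
  have ex: "\<exists>F W. finite F \<and> card F = n \<and> open W \<and> W \<noteq> {} \<and> W \<subseteq> U \<and>
      (\<forall>s\<in>W. \<forall>t\<in>F. e < norm (pmass t (adj_pt S T s)))" for n
  proof (induction n)
    case 0
    show ?case using U by (intro exI[of _ "{}"] exI[of _ U]) auto
  next
    case (Suc n)
    then obtain F W where FW: "finite F" "card F = n" "open W" "W \<noteq> {}" "W \<subseteq> U"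
      "\<And>s t. s \<in> W \<Longrightarrow> t \<in> F \<Longrightarrow> e < norm (pmass t (adj_pt S T s))" by blast
    \<comment> \<open>A new point \<open>r\<close> exists because \<open>W\<close> is infinite. As
      \<open>r\<close> lies in \<open>U\<close>, its mass in the functional at s = r exceeds
      \<open>e\<close>, and continuity in \<open>s\<close> preserves this on a smaller open
      set.\<close>
    obtain r where r: "r \<in> W" "r \<notin> F" using inf[OF FW(3,4)] FW(1) finite_subset[of W F] by blast
    define W' where "W' = W \<inter> {s. e < norm (pmass r (adj_pt S T s))}"
    have "open W'" unfolding W'_def by (intro open_Int FW(3) open_Collect_less continuous_intros cont)
    moreover have "r \<in> W'" using r big FW(5) by (auto simp: W'_def)
    ultimately show ?case
      using FW r by (intro exI[of _ "insert r F"] exI[of _ W']) (auto simp: W'_def)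
  qed
  obtain F W where FW: "finite F" "card F = nat \<lceil>K / e\<rceil> + 1" "W \<noteq> {}"
    "\<And>s t. s \<in> W \<Longrightarrow> t \<in> F \<Longrightarrow> e < norm (pmass t (adj_pt S T s))"
    using ex[of "nat \<lceil>K / e\<rceil> + 1"] by blast
  then obtain s where s: "s \<in> W" by blast
  have "real (card F) * e \<le> (\<Sum>t\<in>F. norm (pmass t (adj_pt S T s)))"
    using FW(4)[OF s] by (intro sum_bounded_below) (simp add: less_imp_le)
  also have "\<dots> \<le> dnorm S (adj_pt S T s)" by (rule sum_pmass_le[OF adj_pt_dual_sp FW(1)])
  also have "\<dots> \<le> K" by (rule dnorm_adj_pt_le)
  finally have "real (card F) \<le> K / e" using e by (simp add: field_simps)
  moreover have "K / e < real (nat \<lceil>K / e\<rceil> + 1)" by linarith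
  ultimately show False using FW(2) by simp
qed

text \<open>Finite sums of masses are bounded by the norm, so for each n only finitely many masses
  exceed 1/(n+1).\<close>

lemma countable_atoms:
  assumes "\<phi> \<in> dual_sp S" shows "countable {t. pmass t \<phi> \<noteq> 0}"
proof -
  have fin: "finite {t. 1 / real (Suc n) < norm (pmass t \<phi>)}" (is "finite ?A") for n
  proof (rule ccontr)
    assume "infinite ?A"
    then obtain F where F: "F \<subseteq> ?A" "finite F" "card F = nat \<lceil>dnorm S \<phi> * Suc n\<rceil> + 1"
      using infinite_arbitrarily_large by metis
    have "real (card F) * (1 / real (Suc n)) \<le> (\<Sum>t\<in>F. norm (pmass t \<phi>))"
      using F(1) by (intro sum_bounded_below) (auto intro: less_imp_le simp del: of_nat_Suc)
    also have "\<dots> \<le> dnorm S \<phi>" by (rule sum_pmass_le[OF assms F(2)])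
    finally have "real (card F) \<le> dnorm S \<phi> * Suc n" by (simp add: field_simps del: of_nat_Suc)
    then show False unfolding F(3) by linarith
  qed
  have "{t. pmass t \<phi> \<noteq> 0} \<subseteq> (\<Union>n. {t. 1 / real (Suc n) < norm (pmass t \<phi>)})"
    using reals_Archimedean[of "norm (pmass _ \<phi>)"] by (fastforce simp: inverse_eq_divide)
  then show ?thesis by (rule countable_subset) (intro countable_UN countableI_type countable_finite fin)
qed

text \<open>Goldstine's theorem for \<open>pmass t\<close>, by least squares: at a near-minimiser \<open>f\<close> of
  \<open>\<Sum>s\<in>A. |v\<^sub>s - T f s|\<^sup>2\<close> over the unit ball, the functional \<open>\<Sum>s\<in>A. cnj (v\<^sub>s - T f s) T* p\<^sub>s\<close>
  nearly attains its norm at \<open>f\<close>.\<close>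

lemma goldstine_pmass:
  assumes A: "finite A" and \<epsilon>: "0 < \<epsilon>"
  shows "\<exists>f\<in>S. supn f \<le> 1 \<and> (\<forall>s\<in>A. norm (T f s - pmass t (adj_pt S T s)) \<le> \<epsilon>)"
proof -
  let ?B = "{f \<in> S. supn f \<le> 1}"
  define v where "v s = pmass t (adj_pt S T s)" for s
  define q where "q f = (\<Sum>s\<in>A. (norm (v s - T f s))\<^sup>2)" for f
  define d where "d = (INF f\<in>?B. q f)"
  have z: "(\<lambda>x. 0) \<in> ?B" using csubspace_funD(1)[OF S(1)] by simp
  have bdd: "bdd_below (q ` ?B)" by (rule bdd_belowI[of _ 0]) (auto simp: q_def intro: sum_nonneg)
  have d_le: "d \<le> q f" if "f \<in> ?B" for f unfolding d_def by (rule cINF_lower[OF bdd that])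
  \<comment> \<open>An upper bound for the sum over \<open>A\<close> of the squared distances
    between \<open>T f\<close> and \<open>T f0\<close>, for \<open>f\<close> and \<open>f0\<close>
    in the unit ball.\<close>
  define C where "C = real (card A) * (2 * K)\<^sup>2"
  have C0: "0 \<le> C" by (simp add: C_def)
  \<comment> \<open>Here \<open>l\<close> is the length of a step from a near-minimiser towards a
    competitor; since it can be arbitrarily small, the infimum \<open>d\<close> cannot be
    positive.\<close>
  have key: "d \<le> l * (1 + C)" if l: "0 < l" "l \<le> 1" for l
  proof -
    \<comment> \<open>The tolerance is quadratic in \<open>l\<close>, so that it is still of order
      \<open>l\<close> after division by the step length.\<close>
    have "\<exists>f\<in>?B. q f < d + l\<^sup>2"
      unfolding d_def by (subst cINF_less_iff[symmetric, OF _ bdd]) (use z l in auto)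
    then obtain f0 where f0: "f0 \<in> ?B" "q f0 < d + l\<^sup>2" by blast
    define w where "w s = v s - T f0 s" for s
    define \<phi> where "\<phi> = (\<lambda>f. \<Sum>s\<in>A. cnj (w s) * adj_pt S T s f)"
    have \<phi>: "\<phi> \<in> dual_sp S" unfolding \<phi>_def by (intro dual_sp_sum[OF S] dual_sp_cmult[OF S] adj_pt_dual_sp)
    \<comment> \<open>First-order optimality: along the segment from \<open>f0\<close> to
      \<open>f\<close> the linear coefficient of \<open>q\<close> is
      \<open>-2 * (Re (\<phi> f) - Re (\<phi> f0))\<close>, and near-minimality keeps it from being
      very negative.\<close>
    have step: "Re (\<phi> f) \<le> Re (\<phi> f0) + l * (1 + C)" if f: "f \<in> ?B" for f
    proof -
      define g where "g x = of_real (1 - l) * f0 x + of_real l * f x" for x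
      have gS: "g \<in> S" unfolding g_def using f f0 by (intro csubspace_funD(2,3)[OF S(1)]) auto
      have "norm (g x) \<le> 1" for x
      proof -
        have "norm (f0 x) \<le> 1" "norm (f x) \<le> 1"
          using f f0 norm_le_supn[of f0 x] norm_le_supn[of f x] S(2) by fastforce+
        then have "norm (g x) \<le> (1 - l) * 1 + l * 1"
          unfolding g_def using l
          by (intro order_trans[OF norm_triangle_ineq] add_mono) (simp_all add: norm_mult mult_left_le del: of_real_diff)
        then show ?thesis by simp
      qed
      then have gB: "g \<in> ?B" using gS supn_le[of g 1] by simp
      have Tg: "T g x = of_real (1 - l) * T f0 x + of_real l * T f x" for x
      proof -
        have a: "f0 \<in> S" "f \<in> S" using f f0 by auto
        show ?thesis
          unfolding g_def
          by (simp only: bdd_clinD(2)[OF T csubspace_funD(3)[OF S(1) a(1)] csubspace_funD(3)[OF S(1) a(2)]] bdd_clinD(3)[OF T a(1)] bdd_clinD(3)[OF T a(2)])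
      qed
      define b where "b s = T f s - T f0 s" for s
      have b: "(norm (b s))\<^sup>2 \<le> (2 * K)\<^sup>2" for s
      proof (rule power_mono)
        show "norm (b s) \<le> 2 * K"
          using norm_triangle_ineq4[of "T f s" "T f0 s"] T_bound1[of f s] T_bound1[of f0 s] f f0 by (simp add: b_def)
      qed simp
      have pt: "(norm (v s - T g s))\<^sup>2 = (norm (w s))\<^sup>2 - 2 * l * Re (cnj (w s) * b s) + l\<^sup>2 * (norm (b s))\<^sup>2" for s
      proof -
        have eq: "v s - T g s = w s - of_real l * b s" by (simp add: Tg w_def b_def algebra_simps)
        show ?thesis unfolding eq cmod_power2 by (simp add: power2_eq_square algebra_simps)
      qed
      have "d \<le> q g" by (rule d_le[OF gB])
      also have "q g = q f0 - 2 * l * (\<Sum>s\<in>A. Re (cnj (w s) * b s)) + l\<^sup>2 * (\<Sum>s\<in>A. (norm (b s))\<^sup>2)"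
        by (simp only: q_def pt w_def[symmetric] sum.distrib sum_subtractf sum_distrib_left)
      also have "(\<Sum>s\<in>A. (norm (b s))\<^sup>2) \<le> C" unfolding C_def using b by (rule sum_bounded_above)
      also have "(\<Sum>s\<in>A. Re (cnj (w s) * b s)) = Re (\<phi> f) - Re (\<phi> f0)"
        using f f0 by (simp add: \<phi>_def adj_pt_def b_def Re_sum sum_subtractf[symmetric] right_diff_distrib)
      finally have "2 * l * (Re (\<phi> f) - Re (\<phi> f0)) \<le> l\<^sup>2 + l\<^sup>2 * C"
        using f0(2) by (simp add: mult_left_mono)
      then have "l * (2 * (Re (\<phi> f) - Re (\<phi> f0))) \<le> l * (l * (1 + C))" by (simp add: power2_eq_square algebra_simps)
      then have "2 * (Re (\<phi> f) - Re (\<phi> f0)) \<le> l * (1 + C)" using l by simp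
      moreover have "0 \<le> l * (1 + C)" using l C0 by simp
      ultimately show ?thesis by argo
    qed
    have le: "norm (\<phi> f) \<le> Re (\<phi> f0) + l * (1 + C)" if f: "f \<in> ?B" for f
    proof -
      obtain c where c: "norm c = 1" "c * \<phi> f = of_real (norm (\<phi> f))" by (rule unimodular_factor)
      have fb: "f \<in> S" "f \<in> bcontfun" using f S(2) by auto
      have "(\<lambda>x. c * f x) \<in> ?B" using f csubspace_funD(3)[OF S(1) fb(1)] c supn_cmult[OF fb(2)] by simp
      from step[OF this] show ?thesis using dual_spD(2)[OF \<phi> fb(1), of c] c by simp
    qed
    have "0 \<le> Re (\<phi> f0) + l * (1 + C)" by (rule order_trans[OF norm_ge_zero le[OF z]])
    then have "dnorm S \<phi> \<le> Re (\<phi> f0) + l * (1 + C)" using le by (intro dnorm_le[OF S]) auto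
    moreover have "pmass t \<phi> = (\<Sum>s\<in>A. cnj (w s) * v s)"
      unfolding \<phi>_def v_def
      by (subst pmass_sum[OF A]) (auto intro: dual_sp_cmult[OF S] adj_pt_dual_sp simp: pmass_cmult[OF adj_pt_dual_sp])
    moreover have "Re (pmass t \<phi>) \<le> dnorm S \<phi>"
      using complex_Re_le_cmod[of "pmass t \<phi>"] pmass_le[OF \<phi>, of t] by simp
    moreover have "\<phi> f0 = (\<Sum>s\<in>A. cnj (w s) * T f0 s)" using f0 by (simp add: \<phi>_def adj_pt_def)
    \<comment> \<open>Expanding one factor \<open>w = v - T f0\<close> writes \<open>q f0\<close> as
      the gap between the real parts of \<open>pmass t \<phi>\<close> and \<open>\<phi> f0\<close>.
      The first is at most the norm of \<open>\<phi>\<close>, which the second nearly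
      attains.\<close>
    moreover have "q f0 = Re (\<Sum>s\<in>A. cnj (w s) * v s) - Re (\<Sum>s\<in>A. cnj (w s) * T f0 s)"
      unfolding q_def Re_sum sum_subtractf[symmetric] cmod_power2
      by (intro sum.cong refl) (simp add: w_def power2_eq_square algebra_simps)
    ultimately have "q f0 \<le> l * (1 + C)" by simp
    then show ?thesis using d_le[OF f0(1)] by simp
  qed
  define l where "l = min 1 (\<epsilon>\<^sup>2 / (2 * (1 + C)))"
  have l: "0 < l" "l \<le> 1" using \<epsilon> C0 by (auto simp: l_def)
  have "l * (1 + C) \<le> (\<epsilon>\<^sup>2 / (2 * (1 + C))) * (1 + C)" using C0 by (intro mult_right_mono) (auto simp: l_def)
  also have "\<dots> = \<epsilon>\<^sup>2 / 2" using C0 by (simp add: field_simps)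
  also have "\<dots> < \<epsilon>\<^sup>2" using \<epsilon> by simp
  finally have "d < \<epsilon>\<^sup>2" using key[OF l] by simp
  then have "\<exists>f\<in>?B. q f < \<epsilon>\<^sup>2" unfolding d_def by (subst cINF_less_iff[symmetric, OF _ bdd]) (use z in auto)
  then obtain f where f: "f \<in> ?B" "q f < \<epsilon>\<^sup>2" by blast
  have "norm (T f s - v s) \<le> \<epsilon>" if "s \<in> A" for s
  proof -
    have "(norm (v s - T f s))\<^sup>2 \<le> q f" unfolding q_def using A that by (intro member_le_sum) auto
    then have "(norm (v s - T f s))\<^sup>2 \<le> \<epsilon>\<^sup>2" using f by simp
    then show ?thesis using \<epsilon> by (simp add: norm_minus_commute power2_le_iff_abs_le abs_le_square_iff[symmetric])
  qed
  then show ?thesis using f by (auto simp: v_def)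
qed

text \<open>The conditions |g s - v s| \<le> 1/(n+1) define weakly closed sets. By
  \<open>goldstine_pmass\<close> any finitely many are met by one \<open>T f\<close> with
  \<open>f\<close> in the unit ball, so weak compactness yields a \<open>g\<close> in
  \<open>S\<close> meeting all of them. Thus the function in question is a member of
  \<open>S\<close>.\<close>

lemma weakly_compact_continuous:
  assumes wc: "weakly_compact_op S T"
  shows "continuous_on UNIV (\<lambda>s. pmass t (adj_pt S T s))"
proof -
  let ?B = "{f \<in> S. supn f \<le> 1}"
  let ?X = "weak_top S"
  have top: "topspace ?X = S"
    unfolding weak_top_def topology_generated_by_topspace using dual_sp_zero[OF S] by auto
  have "T ` ?B \<subseteq> S" using bdd_clinD(1)[OF T] by blast
  define R where "R = ?X closure_of (T ` ?B)"
  have TR: "T ` ?B \<subseteq> R" unfolding R_def by (rule closure_of_subset) (simp add: top \<open>T ` ?B \<subseteq> S\<close>)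
  have R: "compactin ?X R" using wc by (simp add: R_def weakly_compact_op_def)
  define v where "v s = pmass t (adj_pt S T s)" for s
  define Z where "Z s n = {f \<in> S. norm (f s - v s) \<le> 1 / real (Suc n)}" for s n
  have closed: "closedin ?X (Z s n)" for s n
  proof -
    define O' where "O' = {y :: complex. 1 / real (Suc n) < norm (y - v s)}"
    have op: "open O'" unfolding O'_def by (intro open_Collect_less continuous_intros)
    have "S - Z s n = S \<inter> pt_eval S s -` O'" by (auto simp: Z_def O'_def pt_eval_def)
    moreover have "openin ?X (S \<inter> pt_eval S s -` O')"
      unfolding weak_top_def using op pt_eval_dual_sp[OF S] by (intro topology_generated_by_Basis) auto
    ultimately show ?thesis unfolding closedin_def top by (auto simp: Z_def)
  qed
  have "R \<inter> \<Inter>\<F> \<noteq> {}" if fin: "finite \<F>" "\<F> \<subseteq> range (\<lambda>(s, n). Z s n)" for \<F>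
  proof -
    obtain I where I: "finite I" "\<F> = (\<lambda>(s, n). Z s n) ` I"
      using finite_subset_image[OF fin] by blast
    define N where "N = Max (insert 0 (snd ` I))"
    obtain f where f: "f \<in> S" "supn f \<le> 1" "\<And>s. s \<in> fst ` I \<Longrightarrow> norm (T f s - v s) \<le> 1 / real (Suc N)"
      using goldstine_pmass[of "fst ` I" "1 / real (Suc N)" t] I(1) by (auto simp: v_def simp del: of_nat_Suc)
    have "T f \<in> Z s n" if "(s, n) \<in> I" for s n
    proof -
      have "n \<le> N" unfolding N_def using I(1) that by (intro Max_ge) force+
      then have "1 / real (Suc N) \<le> 1 / real (Suc n)" by (intro divide_left_mono) auto
      moreover have "norm (T f s - v s) \<le> 1 / real (Suc N)" using f(3) that by force
      ultimately show ?thesis using bdd_clinD(1)[OF T f(1)] unfolding Z_def by (auto simp del: of_nat_Suc)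
    qed
    moreover have "T f \<in> R" using TR f by blast
    ultimately show ?thesis unfolding I(2) by blast
  qed
  then have "R \<inter> \<Inter>(range (\<lambda>(s, n). Z s n)) \<noteq> {}"
    using R[unfolded compactin_fip] closed by (auto simp del: Int_iff)
  then obtain g where g: "\<And>s n. g \<in> Z s n" by auto
  have "g s = v s" for s
  proof -
    have "norm (g s - v s) \<le> 1 / real (Suc n)" for n using g[of s n] by (simp add: Z_def)
    then have "norm (g s - v s) \<le> 0"
      by (intro LIMSEQ_le_const[OF LIMSEQ_Suc[OF lim_const_over_n[of 1]]]) (auto simp del: of_nat_Suc)
    then show ?thesis by simp
  qed
  then have "(\<lambda>s. v s) = g" by auto
  moreover have "g \<in> S" using g by (simp add: Z_def)
  ultimately show ?thesis using S(2) by (auto simp: v_def bcontfun_iff)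
qed

end

section \<open>Functionals on null sequences as absolutely summable series\<close>

lemma c0_subset_bcontfun: "c0 \<subseteq> bcontfun"
  by (auto simp: c0_def bcontfun_iff intro: convergent_imp_bounded continuous_on_discrete)

text \<open>Test against finitely supported sequences of unimodular numbers that rotate each
  coefficient to its modulus.\<close>

lemma bcontfun_dual_summable:
  fixes \<Psi> :: "(nat \<Rightarrow> complex) \<Rightarrow> complex"
  assumes \<Psi>: "\<Psi> \<in> dual_sp bcontfun"
  shows "summable (\<lambda>n. norm (\<Psi> (\<lambda>k. of_bool (k = n))))"
proof (rule summableI_nonneg_bounded)
  note bc = csubspace_fun_bcontfun subset_refl
  fix N
  define e :: "nat \<Rightarrow> nat \<Rightarrow> complex" where "e n k = of_bool (k = n)" for n k
  have e: "e n \<in> bcontfun" for n by (rule bcontfun_normI[where b = 1]) (auto simp: e_def intro: continuous_on_discrete)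
  have "\<exists>c. norm c = 1 \<and> c * \<Psi> (e n) = of_real (norm (\<Psi> (e n)))" for n using unimodular_factor by metis
  then obtain c where c: "\<And>n. norm (c n) = 1" "\<And>n. c n * \<Psi> (e n) = of_real (norm (\<Psi> (e n)))" by metis
  have sm: "(\<lambda>k. \<Sum>n<N. c n * e n k) \<in> bcontfun" "\<Psi> (\<lambda>k. \<Sum>n<N. c n * e n k) = (\<Sum>n<N. \<Psi> (\<lambda>k. c n * e n k))"
    using dual_sp_sum_arg[OF \<Psi> csubspace_fun_bcontfun, of "{..<N}" "\<lambda>n k. c n * e n k"]
      csubspace_funD(3)[OF csubspace_fun_bcontfun e] by auto
  have "(\<Sum>n<N. c n * e n k) = (if k < N then c k else 0)" for k
    by (simp add: e_def of_bool_def if_distrib cong: if_cong)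
  then have "norm (\<Sum>n<N. c n * e n k) \<le> 1" for k using c(1) by simp
  then have "supn (\<lambda>k. \<Sum>n<N. c n * e n k) \<le> 1" by (rule supn_le)
  then have "norm (\<Psi> (\<lambda>k. \<Sum>n<N. c n * e n k)) \<le> dnorm bcontfun \<Psi>" by (rule norm_le_dnorm1[OF bc \<Psi> sm(1)])
  moreover have "\<Psi> (\<lambda>k. \<Sum>n<N. c n * e n k) = of_real (\<Sum>n<N. norm (\<Psi> (e n)))"
    unfolding sm(2) by (simp add: dual_spD(2)[OF \<Psi> e] c)
  ultimately show "(\<Sum>n<N. norm (\<Psi> (\<lambda>k. of_bool (k = n)))) \<le> dnorm bcontfun \<Psi>"
    unfolding e_def by (simp add: sum_nonneg abs_of_nonneg del: of_real_sum)
qed simp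

text \<open>The truncations of \<open>x\<close> converge to it in sup norm exactly because
  \<open>x\<close> tends to 0, so the finite expansion passes to the limit.\<close>

lemma bcontfun_dual_sums_c0:
  fixes \<Psi> :: "(nat \<Rightarrow> complex) \<Rightarrow> complex"
  assumes \<Psi>: "\<Psi> \<in> dual_sp bcontfun" and x: "x \<in> c0"
  shows "(\<lambda>n. \<Psi> (\<lambda>k. of_bool (k = n)) * x n) sums \<Psi> x"
  unfolding sums_def
proof (rule LIMSEQ_I)
  note bc = csubspace_fun_bcontfun subset_refl
  fix r :: real assume r: "0 < r"
  let ?C = "dnorm bcontfun \<Psi>"
  have C: "0 \<le> ?C" by (rule dnorm_nonneg[OF bc \<Psi>])
  define e :: "nat \<Rightarrow> nat \<Rightarrow> complex" where "e n k = of_bool (k = n)" for n k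
  have e: "e n \<in> bcontfun" for n by (rule bcontfun_normI[where b = 1]) (auto simp: e_def intro: continuous_on_discrete)
  have "0 < r / (?C + 1)" using r C by simp
  then obtain N where N: "\<And>k. N \<le> k \<Longrightarrow> norm (x k) < r / (?C + 1)"
    using x LIMSEQ_D[of x 0] by (auto simp: c0_def)
  have xb: "x \<in> bcontfun" using x c0_subset_bcontfun by blast
  have "norm ((\<Sum>n<M. \<Psi> (e n) * x n) - \<Psi> x) < r" if M: "N \<le> M" for M
  proof -
    have sm: "(\<lambda>k. \<Sum>n<M. x n * e n k) \<in> bcontfun" "\<Psi> (\<lambda>k. \<Sum>n<M. x n * e n k) = (\<Sum>n<M. \<Psi> (\<lambda>k. x n * e n k))"
      using dual_sp_sum_arg[OF \<Psi> csubspace_fun_bcontfun, of "{..<M}" "\<lambda>n k. x n * e n k"]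
        csubspace_funD(3)[OF csubspace_fun_bcontfun e] by auto
    let ?g = "\<lambda>k. (\<Sum>n<M. x n * e n k) - x k"
    have g: "?g \<in> bcontfun" by (rule csubspace_fun_diff[OF csubspace_fun_bcontfun sm(1) xb])
    have "(\<Sum>n<M. x n * e n k) = (if k < M then x k else 0)" for k
      by (simp add: e_def of_bool_def if_distrib cong: if_cong)
    then have "norm (?g k) \<le> r / (?C + 1)" for k
      using N[of k] M r C by (auto simp: less_imp_le)
    then have "supn ?g \<le> r / (?C + 1)" by (rule supn_le)
    then have "norm (\<Psi> ?g) \<le> ?C * (r / (?C + 1))"
      using norm_le_dnorm[OF bc \<Psi> g] C by (meson mult_left_mono order_trans)
    also have "\<dots> < r" using r C by (simp add: field_simps)
    finally have "norm (\<Psi> ?g) < r" .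
    moreover have "\<Psi> ?g = (\<Sum>n<M. \<Psi> (e n) * x n) - \<Psi> x"
      using dual_sp_diff[OF \<Psi> csubspace_fun_bcontfun sm(1) xb] sm(2) by (simp add: dual_spD(2)[OF \<Psi> e] mult.commute)
    ultimately show ?thesis by simp
  qed
  then show "\<exists>N. \<forall>M\<ge>N. norm ((\<Sum>n<M. \<Psi> (\<lambda>k. of_bool (k = n)) * x n) - \<Psi> x) < r"
    unfolding e_def by blast
qed

lemma bdd_clin_boundE:
  assumes "bdd_clin A supn B nB T" "A \<subseteq> bcontfun"
  obtains K where "0 \<le> K" "\<And>f. f \<in> A \<Longrightarrow> nB (T f) \<le> K * supn f"
proof -
  obtain K where K: "\<And>f. f \<in> A \<Longrightarrow> nB (T f) \<le> K * supn f" using assms(1) unfolding bdd_clin_def by blast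
  show ?thesis
  proof (rule that[of "\<bar>K\<bar>"])
    show "nB (T f) \<le> \<bar>K\<bar> * supn f" if "f \<in> A" for f
      using K[OF that] mult_right_mono[of K "\<bar>K\<bar>" "supn f"] supn_nonneg[of f] that assms(2) by fastforce
  qed simp
qed

context atomless_annihilator_operator
begin

text \<open>Each \<open>T* p\<^sub>s\<close> is a norm-convergent series in the countably many coordinate functionals
  \<open>\<phi>\<^sub>n\<close> of the first factor, so its atoms lie among theirs.\<close>

lemma factors_c0_countable_atoms:
  assumes "factors_c0 S T"
  shows "\<exists>D. countable D \<and> (\<forall>t. t \<notin> D \<longrightarrow> (\<forall>s. pmass t (adj_pt S T s) = 0))"
proof -
  obtain E T1 T2 where E: "closed_subspace_c0 E" and T1: "bdd_clin S supn E supn T1"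
    and T2: "bdd_clin E supn S supn T2" and T12: "\<And>f. f \<in> S \<Longrightarrow> T f = T2 (T1 f)"
    using assms unfolding factors_c0_def by blast
  have Es: "csubspace_fun E" "E \<subseteq> c0" using E by (auto simp: closed_subspace_c0_def csubspace_fun_def)
  then have Eb: "E \<subseteq> bcontfun" using c0_subset_bcontfun by blast
  obtain K1 where K1: "0 \<le> K1" "\<And>f. f \<in> S \<Longrightarrow> supn (T1 f) \<le> K1 * supn f" using bdd_clin_boundE[OF T1 S(2)] by blast
  obtain K2 where K2: "0 \<le> K2" "\<And>x. x \<in> E \<Longrightarrow> supn (T2 x) \<le> K2 * supn x" using bdd_clin_boundE[OF T2 Eb] by blast
  have T1b: "norm (T1 f n) \<le> K1 * supn f" if "f \<in> S" for f n
    using norm_le_supn[of "T1 f" n] K1(2)[OF that] bdd_clinD(1)[OF T1 that] Eb by fastforce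
  define \<phi> where "\<phi> n f = (if f \<in> S then T1 f n else 0)" for n f
  have \<phi>: "\<phi> n \<in> dual_sp S" for n
    by (rule dual_spI[where K = K1])
      (auto simp: \<phi>_def bdd_clinD[OF T1] csubspace_funD[OF S(1)] T1b)
  \<comment> \<open>The functionals \<open>\<phi> n\<close> are the coordinates of
    \<open>T1\<close>, so \<open>D\<close> does not depend on \<open>s\<close>; the point
    \<open>s\<close> affects only the coefficients of the series.\<close>
  define D where "D = (\<Union>n. {t. pmass t (\<phi> n) \<noteq> 0})"
  have "countable D" unfolding D_def by (intro countable_UN countableI_type countable_atoms \<phi>)
  moreover have "pmass t (adj_pt S T s) = 0" if t: "t \<notin> D" for t s
  proof -
    define \<psi> where "\<psi> x = (if x \<in> E then T2 x s else 0)" for x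
    have T2b: "norm (T2 x s) \<le> K2 * supn x" if "x \<in> E" for x
      using norm_le_supn[of "T2 x" s] K2(2)[OF that] bdd_clinD(1)[OF T2 that] S(2) by fastforce
    have \<psi>: "\<psi> \<in> dual_sp E"
      by (rule dual_spI[where K = K2])
        (auto simp: \<psi>_def bdd_clinD[OF T2] csubspace_funD[OF Es(1)] T2b)
    \<comment> \<open>The subspace \<open>E\<close> may fail to contain the unit sequences; the
      extension to all bounded sequences makes the coefficients \<open>y n\<close>
      available.\<close>
    obtain \<Psi> where \<Psi>: "\<Psi> \<in> dual_sp bcontfun" "\<And>x. x \<in> E \<Longrightarrow> \<Psi> x = \<psi> x"
      using complex_hahn_banach[OF Es(1) Eb \<psi>] by metis
    define y where "y n = \<Psi> (\<lambda>k. of_bool (k = n))" for n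
    have sy: "summable (\<lambda>n. norm (y n))" unfolding y_def by (rule bcontfun_dual_summable[OF \<Psi>(1)])
    have "norm (pmass t (adj_pt S T s)) \<le> e" if e: "0 < e" for e
    proof -
      \<comment> \<open>The \<open>+ 1\<close> allows for \<open>K1 = 0\<close>.\<close>
      have "0 < e / (K1 + 1)" using e K1 by simp
      then obtain N where N: "(\<Sum>i. norm (y (i + N))) < e / (K1 + 1)"
        using suminf_exist_split[OF _ sy, of "e / (K1 + 1)"] by (auto simp: abs_less_iff)
      have syN: "summable (\<lambda>i. norm (y (i + N)))" using sy summable_iff_shift[of "\<lambda>n. norm (y n)" N] by simp
      \<comment> \<open>Subtracting a partial sum does not change the mass at \<open>t\<close>, as
        no \<open>\<phi> n\<close> has mass there, but leaves a tail of norm at most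
        \<open>e\<close>.\<close>
      define \<rho> where "\<rho> = (\<lambda>f. adj_pt S T s f + (\<Sum>n<N. (- y n) * \<phi> n f))"
      have d: "(\<lambda>f. \<Sum>n<N. (- y n) * \<phi> n f) \<in> dual_sp S"
        by (intro dual_sp_sum[OF S] dual_sp_cmult[OF S] \<phi>)
      have \<rho>: "\<rho> \<in> dual_sp S" unfolding \<rho>_def by (rule dual_sp_add[OF S adj_pt_dual_sp d])
      have "pmass t (\<lambda>f. \<Sum>n<N. (- y n) * \<phi> n f) = (\<Sum>n<N. pmass t (\<lambda>f. (- y n) * \<phi> n f))"
        by (intro pmass_sum dual_sp_cmult[OF S] \<phi>) simp
      also have "\<dots> = 0" using t by (intro sum.neutral ballI) (simp only: pmass_cmult[OF \<phi>], simp add: D_def)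
      finally have "pmass t \<rho> = pmass t (adj_pt S T s)"
        unfolding \<rho>_def by (simp only: pmass_add[OF adj_pt_dual_sp d]) simp
      moreover have "norm (pmass t \<rho>) \<le> dnorm S \<rho>" by (rule pmass_le[OF \<rho>])
      moreover have "dnorm S \<rho> \<le> e"
      proof (rule dnorm_le[OF S])
        fix f assume f: "f \<in> S" "supn f \<le> 1"
        have T1f: "T1 f \<in> E" by (rule bdd_clinD(1)[OF T1 f(1)])
        have b: "norm (T1 f n) \<le> K1" for n
          using T1b[OF f(1), of n] mult_left_mono[OF f(2) K1(1)] by simp
        have "(\<lambda>n. y n * T1 f n) sums \<Psi> (T1 f)"
          unfolding y_def using T1f Es(2) by (intro bcontfun_dual_sums_c0[OF \<Psi>(1)]) auto
        then have "(\<lambda>i. y (i + N) * T1 f (i + N)) sums (\<Psi> (T1 f) - (\<Sum>n<N. y n * T1 f n))"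
          by (rule sums_split_initial_segment)
        moreover have "\<rho> f = \<Psi> (T1 f) - (\<Sum>n<N. y n * T1 f n)"
          using f T1f by (simp add: \<rho>_def adj_pt_def \<phi>_def \<Psi>(2) \<psi>_def T12 sum_negf)
        ultimately have \<rho>f: "\<rho> f = (\<Sum>i. y (i + N) * T1 f (i + N))" by (simp add: sums_iff)
        have bnd: "norm (y (i + N) * T1 f (i + N)) \<le> norm (y (i + N)) * K1" for i
          unfolding norm_mult using b by (intro mult_left_mono) auto
        have sK: "summable (\<lambda>i. norm (y (i + N)) * K1)" by (rule summable_mult2[OF syN])
        have "norm (\<rho> f) \<le> (\<Sum>i. norm (y (i + N)) * K1)"
          unfolding \<rho>f using bnd
          by (intro order_trans[OF summable_norm suminf_le] summable_comparison_test'[OF sK] sK) auto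
        also have "\<dots> = (\<Sum>i. norm (y (i + N))) * K1" by (rule suminf_mult2[OF syN, symmetric])
        also have "\<dots> \<le> (e / (K1 + 1)) * K1" using N K1 by (intro mult_right_mono) auto
        also have "\<dots> \<le> e" using e K1 by (simp add: field_simps)
        finally show "norm (\<rho> f) \<le> e" .
      qed (use e in simp)
      ultimately show ?thesis by simp
    qed
    then have "norm (pmass t (adj_pt S T s)) \<le> 0" by (rule field_le_epsilon[of _ 0, simplified])
    then show ?thesis by simp
  qed
  ultimately show ?thesis by blast
qed

end

section \<open>Compact abelian groups\<close>

lemma haar_radon: "haar m \<Longrightarrow> radon m" and haar_total: "haar m \<Longrightarrow> emeasure m UNIV = 1"
  and haar_image: "haar m \<Longrightarrow> A \<in> sets borel \<Longrightarrow> emeasure m ((\<lambda>y. x + y) ` A) = emeasure m A"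
  using radonD(3)[of m] by (auto simp: haar_def)

text \<open>Invariance in \<open>haar\<close> is phrased with images of sets, whereas image measures
  are computed with preimages.\<close>

lemma vimage_translation:
  fixes x :: "'g::group_add"
  shows "(\<lambda>y. x + y) -` A = (\<lambda>y. - x + y) ` A"
proof (rule set_eqI)
  fix z
  have "z = - x + (x + z)" by (simp add: add.assoc[symmetric])
  then show "z \<in> (\<lambda>y. x + y) -` A \<longleftrightarrow> z \<in> (\<lambda>y. - x + y) ` A"
    by (auto simp: add.assoc[symmetric] intro: image_eqI[of _ _ "x + z"])
qed

lemma haar_distr:
  fixes m :: "'g::topological_ab_group_add measure"
  assumes m: "haar m" shows "distr m m (\<lambda>y. x + y) = m"
proof (rule measure_eqI)
  note s = radonD(1,3)[OF haar_radon[OF m]]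
  have meas: "(\<lambda>y. x + y) \<in> measurable m m"
    by (simp add: measurable_cong_sets[OF s(1) s(1)]) (intro borel_measurable_continuous_onI continuous_intros)
  fix A assume "A \<in> sets (distr m m (\<lambda>y. x + y))"
  then have A: "A \<in> sets borel" "A \<in> sets m" using s by auto
  have "emeasure (distr m m (\<lambda>y. x + y)) A = emeasure m ((\<lambda>y. x + y) -` A)"
    using emeasure_distr[OF meas A(2)] s by simp
  then show "emeasure (distr m m (\<lambda>y. x + y)) A = emeasure m A"
    using haar_image[OF m A(1), of "- x"] by (simp add: vimage_translation)
qed simp

lemma dual_groupD:
  assumes "\<gamma> \<in> dual_group"
  shows "continuous_on UNIV \<gamma>" "\<gamma> (x + y) = \<gamma> x * \<gamma> y" "norm (\<gamma> x) = 1" "\<gamma> x * cnj (\<gamma> x) = 1"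
  using assms complex_norm_square[of "\<gamma> x"] by (auto simp: dual_group_def)

text \<open>Translation by a point \<open>x0\<close> where the characters differ multiplies the
  integral of their quotient by a number other than 1, yet leaves it invariant.\<close>

lemma fourier_character_orthogonal:
  fixes m :: "'g::topological_ab_group_add measure"
  assumes m: "haar m" and \<gamma>: "\<gamma> \<in> dual_group" and \<gamma>': "\<gamma>' \<in> dual_group" and ne: "\<gamma> \<noteq> \<gamma>'"
  shows "fourier m \<gamma> \<gamma>' = 0"
proof -
  define \<xi> where "\<xi> x = \<gamma> x * cnj (\<gamma>' x)" for x
  obtain x0 where x0: "\<gamma> x0 \<noteq> \<gamma>' x0" using ne by blast
  have "\<xi> x0 \<noteq> 1"
  proof
    assume "\<xi> x0 = 1"
    then have "\<gamma> x0 * (\<gamma>' x0 * cnj (\<gamma>' x0)) = \<gamma>' x0" by (simp add: \<xi>_def mult.left_commute)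
    then show False using x0 dual_groupD(4)[OF \<gamma>'] by simp
  qed
  have \<xi>: "\<xi> (x + y) = \<xi> x * \<xi> y" for x y by (simp add: \<xi>_def dual_groupD(2)[OF \<gamma>] dual_groupD(2)[OF \<gamma>'])
  note s = radonD(1,3)[OF haar_radon[OF m]]
  have "\<xi> \<in> borel_measurable m" unfolding \<xi>_def measurable_cong_sets[OF s(1) refl]
    by (intro borel_measurable_continuous_onI continuous_intros dual_groupD(1) \<gamma> \<gamma>')
  moreover have "(\<lambda>y. x0 + y) \<in> measurable m m"
    by (simp add: measurable_cong_sets[OF s(1) s(1)]) (intro borel_measurable_continuous_onI continuous_intros)
  ultimately have "(\<integral>x. \<xi> x \<partial>distr m m (\<lambda>y. x0 + y)) = (\<integral>x. \<xi> (x0 + x) \<partial>m)" by (intro integral_distr)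
  then have "(\<integral>x. \<xi> x \<partial>m) = \<xi> x0 * (\<integral>x. \<xi> x \<partial>m)" by (simp add: haar_distr[OF m] \<xi>)
  then have "(1 - \<xi> x0) * (\<integral>x. \<xi> x \<partial>m) = 0" by (simp add: left_diff_distrib)
  then show ?thesis using \<open>\<xi> x0 \<noteq> 1\<close> by (simp add: fourier_def \<xi>_def)
qed

text \<open>All singletons have the same mass, which must be 0 since infinitely many of them fit
  into total mass 1.\<close>

lemma haar_countable_null:
  fixes m :: "'g::{topological_ab_group_add, t2_space} measure"
  assumes m: "haar m" and inf: "infinite (UNIV :: 'g set)" and D: "countable D"
  shows "emeasure m D = 0"
proof -
  interpret finite_measure m by (rule radonD[OF haar_radon[OF m]])
  note s = radonD(1,3)[OF haar_radon[OF m]]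
  have pt: "measure m {x} = measure m {0}" for x
    using haar_image[OF m, of "{0}" x] by (simp add: measure_def)
  have "measure m {0} = 0"
  proof (rule ccontr)
    assume "measure m {0} \<noteq> 0"
    then have c: "0 < measure m {0}" using measure_nonneg[of m "{0}"] by linarith
    obtain F :: "'g set" where F: "finite F" "card F = nat \<lceil>1 / measure m {0}\<rceil> + 1"
      using infinite_arbitrarily_large[OF inf, of "nat \<lceil>1 / measure m {0}\<rceil> + 1"] by blast
    have "(\<Sum>x\<in>F. measure m {x}) = (\<Sum>x\<in>F. measure m {0})" by (intro sum.cong refl pt)
    then have "real (card F) * measure m {0} = measure m F"
      using finite_measure_eq_sum_singleton[OF F(1)] s by simp
    also have "\<dots> \<le> measure m UNIV" using bounded_measure[of F] s by simp
    also have "\<dots> = 1" using haar_total[OF m] by (simp add: measure_def)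
    finally have "real (card F) \<le> 1 / measure m {0}" using c by (simp add: field_simps)
    then show False unfolding F(2) by linarith
  qed
  then have "{x} \<in> null_sets m" for x
    using pt[of x] s by (auto simp: null_sets_def emeasure_eq_measure)
  then have "(\<Union>x\<in>D. {x}) \<in> null_sets m" by (intro null_sets_UN' D)
  then show ?thesis by (simp add: null_sets_def)
qed

text \<open>By compactness finitely many translates of \<open>U\<close> cover the group, and they
  all have the measure of \<open>U\<close>.\<close>

lemma haar_open_pos:
  fixes m :: "'g::topological_ab_group_add measure"
  assumes cpt: "compact (UNIV :: 'g set)" and m: "haar m" and U: "open U" "U \<noteq> {}"
  shows "emeasure m U \<noteq> 0"
proof
  assume 0: "emeasure m U = 0"
  note s = radonD(1,3)[OF haar_radon[OF m]]
  obtain u where u: "u \<in> U" using U by blast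
  have op: "open ((\<lambda>y. x + y) ` U)" for x
  proof -
    have "open ((\<lambda>y. - x + y) -` U)" by (intro open_vimage U continuous_intros)
    then show ?thesis using vimage_translation[of "- x" U] by simp
  qed
  have "UNIV \<subseteq> (\<Union>x. (\<lambda>y. x + y) ` U)"
  proof
    fix z
    have "z = (z - u) + u" by simp
    then show "z \<in> (\<Union>x. (\<lambda>y. x + y) ` U)" using u by blast
  qed
  then obtain I where I: "finite I" "UNIV \<subseteq> (\<Union>x\<in>I. (\<lambda>y. x + y) ` U)"
    using compactE_image[OF cpt, of UNIV "\<lambda>x. (\<lambda>y. x + y) ` U"] op by metis
  have "emeasure m (\<Union>x\<in>I. (\<lambda>y. x + y) ` U) \<le> (\<Sum>x\<in>I. emeasure m ((\<lambda>y. x + y) ` U))"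
    using op s by (intro emeasure_subadditive_finite I) auto
  also have "\<dots> = 0" using haar_image[OF m] U 0 by simp
  also have "(\<Union>x\<in>I. (\<lambda>y. x + y) ` U) = UNIV" using I(2) by blast
  finally show False using haar_total[OF m] by simp
qed

text \<open>Haar measure separates the two kinds of sets: nonempty open sets have positive measure,
  countable sets are null. Infinitude of the group enters here.\<close>

lemma open_not_countable:
  fixes m :: "'g::{topological_ab_group_add, t2_space} measure"
    and U :: "'g set"
  assumes "compact (UNIV :: 'g set)" "infinite (UNIV :: 'g set)" "haar m" "open U" "U \<noteq> {}"
  shows "uncountable U"
  using haar_open_pos[OF assms(1,3-5)] haar_countable_null[OF assms(3,2)] by blast

section \<open>The annihilator of \<open>C_Lambda\<close>\<close>

lemma csubspace_C_Lambda:
  fixes m :: "'g::topological_ab_group_add measure"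
  assumes cpt: "compact (UNIV :: 'g set)" and m: "haar m"
  shows "csubspace_fun (C_Lambda m L)"
proof -
  have int: "integrable m (\<lambda>x. f x * cnj (\<gamma> x))" if "continuous_on UNIV f" "\<gamma> \<in> dual_group" for f \<gamma>
    using that dual_groupD(1) by (intro radon_integrable[OF cpt haar_radon[OF m]] continuous_intros) auto
  show ?thesis
    unfolding csubspace_fun_def C_Lambda_def
    by (auto simp: fourier_def distrib_right int mult.assoc intro!: continuous_intros)
qed

lemma character_in_C_Lambda:
  assumes "haar m" "L \<subseteq> dual_group" "\<gamma> \<in> L" shows "\<gamma> \<in> C_Lambda m L"
  using assms dual_groupD(1)[of \<gamma>] fourier_character_orthogonal[OF assms(1), of \<gamma>] by (auto simp: C_Lambda_def)

lemma annihilator_atomless: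
  fixes m :: "'g::{topological_ab_group_add, t2_space} measure"
  assumes cpt: "compact (UNIV :: 'g set)" and m: "haar m" and L: "L \<subseteq> dual_group"
    and sr: "semi_riesz (dual_group - neg_set L)"
  shows "atomless_annihilator (C_Lambda m L)"
proof
  show "compact (UNIV :: 'g set)" by (rule cpt)
  show "csubspace_fun (C_Lambda m L)" by (rule csubspace_C_Lambda[OF cpt m])
  show "C_Lambda m L \<subseteq> bcontfun" by (auto simp: bcontfun_compact_eq[OF cpt] C_Lambda_def)
  fix \<Phi> :: "('g \<Rightarrow> complex) \<Rightarrow> complex" and h
  assume \<Phi>: "\<Phi> \<in> dual_sp bcontfun" "\<And>f. f \<in> C_Lambda m L \<Longrightarrow> \<Phi> f = 0"
  obtain \<mu> where \<mu>: "is_cmeasure \<mu>" "\<And>f. continuous_on UNIV f \<Longrightarrow> \<Phi> f = cm_int \<mu> f"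
    using cmeasure_representation[OF cpt \<Phi>(1)] by metis
  \<comment> \<open>The conjugation in \<open>fs_transform\<close> cancels the one in
    \<open>neg_set\<close>, which leaves the value of \<open>\<Phi>\<close> at a character of
    \<open>L\<close>.\<close>
  have "fs_transform \<mu> \<gamma> = 0" if \<gamma>: "\<gamma> \<in> neg_set L" for \<gamma>
  proof -
    obtain \<gamma>' where \<gamma>': "\<gamma>' \<in> L" "\<gamma> = (\<lambda>x. cnj (\<gamma>' x))" using \<gamma> by (auto simp: neg_set_def)
    then have "fs_transform \<mu> \<gamma> = \<Phi> \<gamma>'"
      using \<mu>(2) dual_groupD(1)[of \<gamma>'] L by (auto simp: fs_transform_def)
    then show ?thesis using \<Phi>(2) character_in_C_Lambda[OF m L \<gamma>'(1)] by simp
  qed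
  then have "\<mu> \<in> M_spec (dual_group - neg_set L)" using \<mu>(1) by (auto simp: M_spec_def)
  then have "cm_val \<mu> {h} = 0" using sr by (auto simp: semi_riesz_def M_diff_def)
  then show "has_atom \<Phi> h 0" using has_atom_cmeasure[OF cpt \<mu>, of h] by simp
qed

theorem theorem3p7:
  fixes m :: "'g::{topological_ab_group_add, t2_space} measure"
    and L :: "('g \<Rightarrow> complex) set"
    and T :: "('g \<Rightarrow> complex) \<Rightarrow> ('g \<Rightarrow> complex)"
  assumes "compact (UNIV :: 'g set)" and "infinite (UNIV :: 'g set)"
    and "haar m"
    and "L \<subseteq> dual_group"
    and "semi_riesz (dual_group - neg_set L)"
    and "bdd_clin (C_Lambda m L) supn (C_Lambda m L) supn T"
    and "weakly_compact_op (C_Lambda m L) T \<or> factors_c0 (C_Lambda m L) T \<or>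
         (\<forall>h. continuous_on UNIV (\<lambda>g. pi_fun (C_Lambda m L) h (adj_pt (C_Lambda m L) T g)))"
  shows "opnorm_on (C_Lambda m L) (\<lambda>f x. f x + T f x) = 1 + opnorm_on (C_Lambda m L) T"
proof -
  let ?S = "C_Lambda m L"
  interpret atomless_annihilator ?S by (rule annihilator_atomless[OF assms(1,3-5)])
  obtain K where K: "0 \<le> K" "\<And>f. f \<in> ?S \<Longrightarrow> supn (T f) \<le> K * supn f"
    using bdd_clin_boundE[OF assms(6) S(2)] by blast
  interpret atomless_annihilator_operator ?S T K
    using assms(6) K by unfold_locales
  have unc: "uncountable U" if "open U" "U \<noteq> {}" for U :: "'g set"
    by (rule open_not_countable[OF assms(1-3) that])
  show ?thesis
  proof (rule daugavet_of_small_atoms)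
    fix U :: "'g set" and e :: real assume U: "open U" "U \<noteq> {}" and e: "0 < e"
    show "\<exists>s\<in>U. norm (pmass s (adj_pt ?S T s)) \<le> e"
    proof (cases "factors_c0 ?S T")
      case True
      then obtain D where D: "countable D" "\<And>t s. t \<notin> D \<Longrightarrow> pmass t (adj_pt ?S T s) = 0"
        using factors_c0_countable_atoms by blast
      obtain s where "s \<in> U" "s \<notin> D" using unc[OF U] D(1) countable_subset[of U D] by blast
      then show ?thesis using D(2) e by (intro bexI[of _ s]) auto
    next
      case False
      \<comment> \<open>Without a factorisation both remaining hypotheses give this continuity: weak
        compactness by \<open>weakly_compact_continuous\<close>, the other because
        \<open>pi_fun\<close> and \<open>pmass\<close> agree on the dual of
        \<open>?S\<close>.\<close>
      have cont: "continuous_on UNIV (\<lambda>s. pmass t (adj_pt ?S T s))" for t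
        using assms(7) False weakly_compact_continuous pi_fun_eq[OF adj_pt_dual_sp] by auto
      have inf: "infinite V" if "open V" "V \<noteq> {}" for V :: "'g set"
        using unc[OF that] countable_finite by blast
      show ?thesis by (rule small_atoms_continuous[OF cont inf U e])
    qed
  qed
qed

end
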